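(* Let $\mathbb H_3^{\mathbb C}$, $\Delta$, $|\nabla f|$, $\rho_a$ and $Q$ be as in the context, and let $K$ be a constant such that $|\nabla e^{t\Delta/4}f|\le K\,e^{t\Delta/4}|\nabla f|$ for all $t\ge0$ and all $f\in C^1_c(\mathbb H_3^{\mathbb C})$ (such a constant exists). Then for every $a>0$ the logarithmic Sobolev inequality $$\int |f|^2\log|f|\,\rho_a\,dm\le c\,Q(f)+\beta\|f\|^2_{L^2(\rho_a)}+\|f\|^2_{L^2(\rho_a)}\log\|f\|_{L^2(\rho_a)}$$ holds for all $f$ with $Q(f)<\infty$, with $c=2K^2a$ and $\beta=0$.
   Context: The complex Heisenberg group $\mathbb H_3^{\mathbb C}$ is $\mathbb C^3$ with the product $(z_1,z_2,z_3)\cdot(z_1',z_2',z_3')=(z_1+z_1',z_2+z_2',z_3+z_3'+\frac12(z_1z_2'-z_2z_1'))$; its Lie algebra is $\mathbb C^3$ with bracket $[(z_1,z_2,z_3),(z_1',z_2',z_3')]=(0,0,z_1z_2'-z_1'z_2)$, identity $0$, and Haar measure $m$ = Lebesgue measure on $\mathbb C^3$. Let $e_1,e_2$ be the first two standard basis vectors, and let $X_1,Y_1,X_2,Y_2$ be the left-invariant real vector fields equal at the identity to $e_1,ie_1,e_2,ie_2$ (in complex notation, $Z_1=\frac12(X_1-iY_1)=\partial_{z_1}-\frac12z_2\partial_{z_3}$, $Z_2=\frac12(X_2-iY_2)=\partial_{z_2}+\frac12z_1\partial_{z_3}$). Sub-Laplacian $\Delta=X_1^2+Y_1^2+X_2^2+Y_2^2$;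 $|\nabla f|^2=\sum_{j=1}^2(|X_jf|^2+|Y_jf|^2)$. The heat kernel $\rho_s$ is the smooth positive probability density with $e^{s\Delta/4}f(x)=\int f(xy^{-1})\rho_s(y)\,dm(y)$. For $a>0$, $Q$ is the closure in $L^2(\rho_a)=L^2(\rho_a\,dm)$ of $Q_0(f_1,f_2)=\int\sum_j(X_jf_1\,X_j\bar f_2+Y_jf_1\,Y_j\bar f_2)\rho_a\,dm$ on $C_c^\infty$, with $Q(f)=Q(f,f)$ ($Q(f)=\infty$ outside its domain). *)

theory Defs
  imports "HOL-Analysis.Analysis"
begin

text \<open>The complex Heisenberg group H_3^C, realised on the type complex \<times> complex \<times> complex
  (a euclidean space of real dimension 6; Lebesgue measure = Haar measure m).\<close>

type_synonym H3 = "complex \<times> complex \<times> complex"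

definition hmul :: "H3 \<Rightarrow> H3 \<Rightarrow> H3" where
  "hmul x y = (case x of (z1, z2, z3) \<Rightarrow> case y of (w1, w2, w3) \<Rightarrow>
     (z1 + w1, z2 + w2, z3 + w3 + (z1 * w2 - z2 * w1) / 2))"

definition hinv :: "H3 \<Rightarrow> H3" where
  "hinv x = - x"

text \<open>Left-invariant vector field equal to v at the identity:
  (X_v f)(x) = d/ds f(x \<cdot> exp(s v)) at s = 0 (exp(s v) = s v in exponential coordinates).\<close>
definition lvf :: "H3 \<Rightarrow> (H3 \<Rightarrow> 'b::real_normed_vector) \<Rightarrow> H3 \<Rightarrow> 'b" where
  "lvf v f x = vector_derivative (\<lambda>s::real. f (hmul x (s *\<^sub>R v))) (at 0)"

definition e1 :: H3 where "e1 = (1, 0, 0)"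
definition e2 :: H3 where "e2 = (0, 1, 0)"

definition hdirs :: "H3 list" where
  "hdirs = [e1, (\<i>, 0, 0), e2, (0, \<i>, 0)]"

definition subLap :: "(H3 \<Rightarrow> 'b::real_normed_vector) \<Rightarrow> H3 \<Rightarrow> 'b" where
  "subLap f x = (\<Sum>v\<leftarrow>hdirs. lvf v (lvf v f) x)"

definition gradnorm :: "(H3 \<Rightarrow> complex) \<Rightarrow> H3 \<Rightarrow> real" where
  "gradnorm f x = sqrt (\<Sum>v\<leftarrow>hdirs. (cmod (lvf v f x))\<^sup>2)"

coinductive smooth_fun :: "(H3 \<Rightarrow> 'b::real_normed_vector) \<Rightarrow> bool" where
  "(\<forall>x. f differentiable (at x)) \<Longrightarrow>
   (\<forall>u. smooth_fun (\<lambda>x. frechet_derivative f (at x) u)) \<Longrightarrow> smooth_fun f"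

definition compact_supp :: "(H3 \<Rightarrow> 'b::real_normed_vector) \<Rightarrow> bool" where
  "compact_supp f \<longleftrightarrow> compact (closure {x. f x \<noteq> 0})"

definition C1c :: "(H3 \<Rightarrow> 'b::real_normed_vector) \<Rightarrow> bool" where
  "C1c f \<longleftrightarrow> (\<forall>x. f differentiable (at x)) \<and>
     (\<forall>u. continuous_on UNIV (\<lambda>x. frechet_derivative f (at x) u)) \<and> compact_supp f"

definition Ccinf :: "(H3 \<Rightarrow> 'b::real_normed_vector) \<Rightarrow> bool" where
  "Ccinf f \<longleftrightarrow> smooth_fun f \<and> compact_supp f"

definition heat_kernel :: "(real \<Rightarrow> H3 \<Rightarrow> real) \<Rightarrow> bool" where
  "heat_kernel \<rho> \<longleftrightarrow>
     (\<forall>s>0. smooth_fun (\<rho> s) \<and> (\<forall>x. \<rho> s x > 0) \<and>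
            integrable lebesgue (\<rho> s) \<and> integral\<^sup>L lebesgue (\<rho> s) = 1) \<and>
     (\<forall>s>0. \<forall>x. ((\<lambda>r. \<rho> r x) has_real_derivative (subLap (\<rho> s) x / 4)) (at s)) \<and>
     (\<forall>s>0. \<forall>t>0. \<forall>x. \<rho> (s + t) x = (\<integral>z. \<rho> s z * \<rho> t (hmul (hinv z) x) \<partial>lebesgue)) \<and>
     (\<forall>g::H3 \<Rightarrow> real. continuous_on UNIV g \<and> compact_supp g \<longrightarrow>
        ((\<lambda>s. \<integral>y. g y * \<rho> s y \<partial>lebesgue) \<longlongrightarrow> g 0) (at_right 0))"

definition heatsg :: "(real \<Rightarrow> H3 \<Rightarrow> real) \<Rightarrow> real \<Rightarrow> (H3 \<Rightarrow> 'b::{banach, second_countable_topology})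
    \<Rightarrow> H3 \<Rightarrow> 'b" where
  "heatsg \<rho> t f x = (if t = 0 then f x
     else (\<integral>y. \<rho> t y *\<^sub>R f (hmul x (hinv y)) \<partial>lebesgue))"

definition Q0 :: "(real \<Rightarrow> H3 \<Rightarrow> real) \<Rightarrow> real \<Rightarrow> (H3 \<Rightarrow> complex) \<Rightarrow> (H3 \<Rightarrow> complex) \<Rightarrow> complex" where
  "Q0 \<rho> a f g = (\<integral>x. (\<Sum>v\<leftarrow>hdirs. lvf v f x * cnj (lvf v g x)) * complex_of_real (\<rho> a x) \<partial>lebesgue)"

definition L2sq :: "(real \<Rightarrow> H3 \<Rightarrow> real) \<Rightarrow> real \<Rightarrow> (H3 \<Rightarrow> complex) \<Rightarrow> ennreal" where
  "L2sq \<rho> a f = (\<integral>\<^sup>+ x. ennreal ((cmod (f x))\<^sup>2 * \<rho> a x) \<partial>lebesgue)"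

text \<open>fs is an approximating sequence for f for the closure of Q_0: fs n in C_c^\<infinity>,
  fs n \<rightarrow> f in L^2(\<rho>_a), and (fs n) is Cauchy for Q_0.\<close>
definition Q_approx :: "(real \<Rightarrow> H3 \<Rightarrow> real) \<Rightarrow> real \<Rightarrow> (H3 \<Rightarrow> complex) \<Rightarrow> (nat \<Rightarrow> H3 \<Rightarrow> complex) \<Rightarrow> bool" where
  "Q_approx \<rho> a f fs \<longleftrightarrow> (\<forall>n. Ccinf (fs n)) \<and>
     (\<lambda>n. L2sq \<rho> a (\<lambda>x. fs n x - f x)) \<longlonglongrightarrow> 0 \<and>
     (\<forall>\<epsilon>>0. \<exists>N. \<forall>m\<ge>N. \<forall>n\<ge>N. Re (Q0 \<rho> a (\<lambda>x. fs m x - fs n x) (\<lambda>x. fs m x - fs n x)) < \<epsilon>)"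

definition Q_dom :: "(real \<Rightarrow> H3 \<Rightarrow> real) \<Rightarrow> real \<Rightarrow> (H3 \<Rightarrow> complex) \<Rightarrow> bool" where
  "Q_dom \<rho> a f \<longleftrightarrow> f \<in> borel_measurable lebesgue \<and> L2sq \<rho> a f < \<infinity> \<and> (\<exists>fs. Q_approx \<rho> a f fs)"

definition Qform :: "(real \<Rightarrow> H3 \<Rightarrow> real) \<Rightarrow> real \<Rightarrow> (H3 \<Rightarrow> complex) \<Rightarrow> ennreal" where
  "Qform \<rho> a f = (if Q_dom \<rho> a f then
      ennreal (THE q. \<exists>fs. Q_approx \<rho> a f fs \<and> (\<lambda>n. Re (Q0 \<rho> a (fs n) (fs n))) \<longlonglongrightarrow> q)
    else \<infinity>)"

definition L2norm :: "(real \<Rightarrow> H3 \<Rightarrow> real) \<Rightarrow> real \<Rightarrow> (H3 \<Rightarrow> complex) \<Rightarrow> real" where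
  "L2norm \<rho> a f = sqrt (enn2real (L2sq \<rho> a f))"

end

theory Submission
  imports Defs
begin

text \<open>
  For \<open>f\<close> smooth with compact support put \<open>u\<^sub>s = P\<^bsub>a-s\<^esub>|f|\<^sup>2\<close> and \<open>\<phi>(u) = (u + \<epsilon>) log (u + \<epsilon>)\<close>. Then
  \<open>d/ds \<integral> \<phi>(u\<^sub>s) \<rho>\<^sub>s = (1/4) \<integral> \<phi>''(u\<^sub>s) |\<nabla>u\<^sub>s|\<^sup>2 \<rho>\<^sub>s\<close>, and the gradient bound together with the
  Cauchy-Schwarz inequality gives \<open>|\<nabla>u\<^sub>s|\<^sup>2 \<le> 4 K\<^sup>2 u\<^sub>s P\<^bsub>a-s\<^esub>|\<nabla>f|\<^sup>2\<close>, so the derivative is at most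
  \<open>K\<^sup>2 \<integral> |\<nabla>f|\<^sup>2 \<rho>\<^sub>a\<close>. Integrating over \<open>[0, a]\<close> yields the inequality (with the better constant
  \<open>K\<^sup>2 a / 2\<close>), and Fatou's lemma extends it to the domain of the closed form.

  The heat kernel is only known to solve the heat equation pointwise, separately in time and space.
  To pass to the weak form, Hunt-type moment bounds for the convolution semigroup provide a locally
  uniform lower bound for the difference quotients \<open>(\<rho>\<^bsub>t+d\<^esub> - \<rho>\<^sub>t)/d\<close>; a Fatou argument then makes
  \<open>\<rho>\<close> a weak supersolution, and conservation of mass makes it a solution. The symmetry of \<open>\<rho>\<^sub>t\<close> under
  inversion, which identifies \<open>P\<^sub>t f(0)\<close> with \<open>\<integral> f \<rho>\<^sub>t\<close>, is the case \<open>\<phi>(u) = u\<close> of the computation above.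
\<close>

text \<open>The kernel comes with no decay at infinity and no uniformity in its time derivative, so
  integrals against it can be neither differentiated in time nor integrated by parts directly. Two
  substitutes carry the argument: all densities have mass one, which turns pointwise convergence in
  time into L^1 convergence, and cut-offs adapted to the dilations of the group have a sub-Laplacian
  of size O(\<lambda>). A second obstacle is handedness: the heat equation is given with
  left-invariant fields, whereas perturbing the left factor in the semigroup law produces
  right-invariant ones. Only when both Laplacians agree on the kernel does the sub-Laplacian commute
  with the semigroup. Since \<phi>(u) has no compact support, the weak equation must be extended to
  functions with bounded derivatives, and these bounds come from the gradient hypothesis itself.
  Finally, the value of the closed form is a definite description, so closability has to be proved
  before the value can be computed.\<close>

declare split_paired_All [simp del] split_paired_Ex [simp del]

section \<open>The group law as vector addition plus a nilpotent bilinear correction\<close>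

text \<open>Half of the Lie bracket. It is bounded bilinear, alternating and kills its own values,
  so the group axioms become linear algebra, and multiplying x by y displaces x by a vector linear
  in y.\<close>

definition hbr :: "H3 \<Rightarrow> H3 \<Rightarrow> H3" where
  "hbr x y = (0, 0, (fst x * fst (snd y) - fst (snd x) * fst y) / 2)"

lemma hmul_hbr: "hmul x y = x + y + hbr x y"
  by (cases x; cases y) (auto simp: hmul_def hbr_def)

lemma norm_fst_snd_le:
  "norm (fst x) \<le> norm x" "norm (fst (snd x)) \<le> norm x" "norm (snd (snd x)) \<le> norm x" for x :: H3
proof -
  show "norm (fst x) \<le> norm x" by (rule norm_fst_le[of "fst x" "snd x", simplified])
  have *: "norm (snd x) \<le> norm x" by (rule norm_snd_le[of "snd x" "fst x", simplified])
  show "norm (fst (snd x)) \<le> norm x"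
    using norm_fst_le[of "fst (snd x)" "snd (snd x)"] * by simp
  show "norm (snd (snd x)) \<le> norm x"
    using norm_snd_le[of "snd (snd x)" "fst (snd x)"] * by simp
qed

lemma norm_hbr_le: "norm (hbr x y) \<le> norm x * norm y"
proof -
  have "norm (hbr x y) = norm ((fst x * fst (snd y) - fst (snd x) * fst y) / 2)"
    by (simp add: hbr_def)
  also have "\<dots> \<le> (norm (fst x * fst (snd y)) + norm (fst (snd x) * fst y)) / 2"
    by (simp add: norm_divide norm_triangle_ineq4)
  also have "\<dots> \<le> (norm x * norm y + norm x * norm y) / 2"
    unfolding norm_mult
    by (intro divide_right_mono add_mono mult_mono norm_fst_snd_le) auto
  finally show ?thesis by simp
qed

lemma bounded_bilinear_hbr: "bounded_bilinear hbr"
proof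
  fix a a' b b' :: H3 and r :: real
  show "hbr (a + a') b = hbr a b + hbr a' b" "hbr a (b + b') = hbr a b + hbr a b'"
    by (simp_all add: hbr_def algebra_simps diff_divide_distrib add_divide_distrib)
  show "hbr (r *\<^sub>R a) b = r *\<^sub>R hbr a b" "hbr a (r *\<^sub>R b) = r *\<^sub>R hbr a b"
    by (simp_all add: hbr_def algebra_simps scaleR_conv_of_real)
  show "\<exists>K. \<forall>a b. norm (hbr a b) \<le> norm a * norm b * K"
    using norm_hbr_le by (intro exI[of _ 1]) simp
qed

interpretation hbr: bounded_bilinear hbr by (rule bounded_bilinear_hbr)

lemma hbr_self [simp]: "hbr x x = 0"
  by (simp add: hbr_def algebra_simps zero_prod_def)

lemma hbr_hbr [simp]: "hbr x (hbr y z) = 0" "hbr (hbr y z) x = 0"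
  by (simp_all add: hbr_def zero_prod_def)

lemma hbr_swap: "hbr y x = - hbr x y"
  by (simp add: hbr_def algebra_simps minus_divide_left)

lemma hmul_assoc: "hmul (hmul x y) z = hmul x (hmul y z)"
  by (simp add: hmul_hbr hbr.add_left hbr.add_right algebra_simps)

lemma hmul_0 [simp]: "hmul 0 x = x" "hmul x 0 = x"
  by (simp_all add: hmul_hbr hbr.zero_left hbr.zero_right)

lemma hmul_minus [simp]: "hmul x (- x) = 0" "hmul (- x) x = 0"
  by (simp_all add: hmul_hbr hbr.minus_left hbr.minus_right)

lemma hmul_minus_cancel [simp]: "hmul (- x) (hmul x y) = y" "hmul x (hmul (- x) y) = y"
  "hmul (hmul y x) (- x) = y" "hmul (hmul y (- x)) x = y"
  by (simp_all add: hmul_assoc) (simp_all add: hmul_assoc[symmetric])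

lemma minus_hmul: "- hmul x y = hmul (- y) (- x)"
  by (simp add: hmul_hbr hbr.minus_left hbr.minus_right hbr_swap[of x y])

lemma hmul_flow: "hmul (hmul x (s *\<^sub>R v)) (t *\<^sub>R v) = hmul x ((s + t) *\<^sub>R v)"
proof -
  have "hmul (s *\<^sub>R v) (t *\<^sub>R v) = (s + t) *\<^sub>R v"
    by (simp add: hmul_hbr hbr.scaleR_left hbr.scaleR_right algebra_simps)
  then show ?thesis by (simp add: hmul_assoc)
qed

lemma continuous_on_hmul [continuous_intros]:
  fixes f g :: "'a::topological_space \<Rightarrow> H3"
  assumes "continuous_on S f" "continuous_on S g"
  shows "continuous_on S (\<lambda>x. hmul (f x) (g x))"
  unfolding hmul_hbr by (intro continuous_intros hbr.continuous_on assms)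

lemma borel_measurable_hmul [measurable]:
  assumes "f \<in> borel_measurable M" "g \<in> borel_measurable M"
  shows "(\<lambda>x. hmul (f x) (g x)) \<in> borel_measurable M"
proof -
  have "continuous_on UNIV (\<lambda>p::H3\<times>H3. hmul (fst p) (snd p))" by (intro continuous_intros)
  from borel_measurable_continuous_on[OF this, of "\<lambda>x. (f x, g x)" M] assms show ?thesis by simp
qed

lemma continuous_imp_borel [simp]: "continuous_on UNIV f \<Longrightarrow> f \<in> borel_measurable borel"
  for f :: "'a::topological_space \<Rightarrow> 'b::topological_space"
  by (rule borel_measurable_continuous_onI)

subsection \<open>Invariance of Lebesgue measure\<close>

lemma nn_integral_lborel_plus:
  fixes f :: "'a::euclidean_space \<Rightarrow> ennreal"
  assumes [measurable]: "f \<in> borel_measurable borel"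
  shows "(\<integral>\<^sup>+x. f (c + x) \<partial>lborel) = (\<integral>\<^sup>+x. f x \<partial>lborel)"
proof -
  have "(\<integral>\<^sup>+x. f x \<partial>lborel) = (\<integral>\<^sup>+x. f x \<partial>distr lborel borel ((+) c))"
    by (simp add: lborel_distr_plus)
  also have "\<dots> = (\<integral>\<^sup>+x. f (c + x) \<partial>lborel)"
    by (subst nn_integral_distr) auto
  finally show ?thesis ..
qed

lemma nn_integral_lborel_H3:
  fixes f :: "H3 \<Rightarrow> ennreal"
  assumes [measurable]: "f \<in> borel_measurable borel"
  shows "(\<integral>\<^sup>+x. f x \<partial>lborel) = (\<integral>\<^sup>+a. \<integral>\<^sup>+b. \<integral>\<^sup>+c. f (a, b, c) \<partial>lborel \<partial>lborel \<partial>lborel)"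
proof -
  have m1: "f \<in> borel_measurable (lborel \<Otimes>\<^sub>M lborel)" by (simp add: lborel_prod)
  have m2: "(\<lambda>y. f (a, y)) \<in> borel_measurable (lborel \<Otimes>\<^sub>M lborel)" for a by (simp add: lborel_prod)
  have "(\<integral>\<^sup>+x. f x \<partial>lborel) = (\<integral>\<^sup>+a. \<integral>\<^sup>+y. f (a, y) \<partial>lborel \<partial>lborel)"
    using lborel.nn_integral_fst[OF m1] by (simp add: lborel_prod)
  also have "\<dots> = (\<integral>\<^sup>+a. \<integral>\<^sup>+b. \<integral>\<^sup>+c. f (a, b, c) \<partial>lborel \<partial>lborel \<partial>lborel)"
    using lborel.nn_integral_fst[OF m2] by (simp add: lborel_prod)
  finally show ?thesis .
qed

text \<open>Left and right translations both have this triangular shape: a constant shift of the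
  first two coordinates and, with these fixed, a shift of the central one. Tonelli reduces each to
  translation invariance on the complex plane.\<close>

lemma nn_integral_shear:
  fixes f :: "H3 \<Rightarrow> ennreal" and z :: H3 and L :: "complex \<Rightarrow> complex \<Rightarrow> complex"
  assumes [measurable]: "f \<in> borel_measurable borel"
    and L: "continuous_on UNIV (\<lambda>p. L (fst p) (snd p))"
  shows "(\<integral>\<^sup>+x. f (a0 + fst x, b0 + fst (snd x), L (fst x) (fst (snd x)) + snd (snd x)) \<partial>lborel)
    = (\<integral>\<^sup>+x. f x \<partial>lborel)"
proof -
  have "continuous_on UNIV (\<lambda>x::H3. (a0 + fst x, b0 + fst (snd x), L (fst x) (fst (snd x)) + snd (snd x)))"
    by (intro continuous_on_compose2[OF L, of _ "\<lambda>x. (fst x, fst (snd x))", simplified] continuous_intros)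
  then have fm: "(\<lambda>x::H3. f (a0 + fst x, b0 + fst (snd x), L (fst x) (fst (snd x)) + snd (snd x))) \<in> borel_measurable borel"
    by (intro measurable_compose[OF _ assms(1)] continuous_imp_borel)
  have [measurable]: "(\<lambda>b. \<integral>\<^sup>+c. f (a, b, c) \<partial>lborel) \<in> borel_measurable borel" for a
    using lborel.borel_measurable_nn_integral_fst[of "\<lambda>y. f (a, y)" borel] 
    by (simp add: borel_prod cong: measurable_cong_sets)
  have [measurable]: "(\<lambda>a. \<integral>\<^sup>+b. \<integral>\<^sup>+c. f (a, b, c) \<partial>lborel \<partial>lborel) \<in> borel_measurable borel"
  proof -
    have "(\<integral>\<^sup>+b. \<integral>\<^sup>+c. f (a, b, c) \<partial>lborel \<partial>lborel) = (\<integral>\<^sup>+y. f (a, y) \<partial>lborel)" for a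
    proof -
      have m2: "(\<lambda>y. f (a, y)) \<in> borel_measurable (lborel \<Otimes>\<^sub>M lborel)" by (simp add: lborel_prod)
      show ?thesis using lborel.nn_integral_fst[OF m2] by (simp add: lborel_prod)
    qed
    moreover have "(\<lambda>a. \<integral>\<^sup>+y. f (a, y) \<partial>lborel) \<in> borel_measurable borel"
      using lborel.borel_measurable_nn_integral_fst[of f borel] 
      by (simp add: borel_prod cong: measurable_cong_sets)
    ultimately show ?thesis by simp
  qed
  have "(\<integral>\<^sup>+x. f (a0 + fst x, b0 + fst (snd x), L (fst x) (fst (snd x)) + snd (snd x)) \<partial>lborel)
    = (\<integral>\<^sup>+a. \<integral>\<^sup>+b. \<integral>\<^sup>+c. f (a0 + a, b0 + b, L a b + c) \<partial>lborel \<partial>lborel \<partial>lborel)"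
    by (subst nn_integral_lborel_H3[OF fm]) auto
  also have "\<dots> = (\<integral>\<^sup>+a. \<integral>\<^sup>+b. \<integral>\<^sup>+c. f (a0 + a, b0 + b, c) \<partial>lborel \<partial>lborel \<partial>lborel)"
    by (intro nn_integral_cong nn_integral_lborel_plus) measurable
  also have "\<dots> = (\<integral>\<^sup>+a. \<integral>\<^sup>+b. \<integral>\<^sup>+c. f (a0 + a, b, c) \<partial>lborel \<partial>lborel \<partial>lborel)"
    by (intro nn_integral_cong nn_integral_lborel_plus[of "\<lambda>b. \<integral>\<^sup>+c. f (_, b, c) \<partial>lborel"]) measurable
  also have "\<dots> = (\<integral>\<^sup>+a. \<integral>\<^sup>+b. \<integral>\<^sup>+c. f (a, b, c) \<partial>lborel \<partial>lborel \<partial>lborel)"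
    by (intro nn_integral_lborel_plus[of "\<lambda>a. \<integral>\<^sup>+b. \<integral>\<^sup>+c. f (a, b, c) \<partial>lborel \<partial>lborel"]) measurable
  also have "\<dots> = (\<integral>\<^sup>+x. f x \<partial>lborel)" by (rule nn_integral_lborel_H3[symmetric]) simp
  finally show ?thesis .
qed

lemma distr_lborel_eqI:
  fixes h :: "H3 \<Rightarrow> H3"
  assumes [measurable]: "h \<in> borel_measurable borel"
    and "\<And>f. f \<in> borel_measurable borel \<Longrightarrow> (\<integral>\<^sup>+x. f (h x) \<partial>lborel) = (\<integral>\<^sup>+x. f x \<partial>lborel)"
  shows "distr lborel borel h = lborel"
proof (rule measure_eqI)
  fix A assume "A \<in> sets (distr lborel borel h)"
  then have [measurable]: "A \<in> sets borel" by simp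
  have "emeasure (distr lborel borel h) A = (\<integral>\<^sup>+x. indicator A x \<partial>distr lborel borel h)" by simp
  also have "\<dots> = (\<integral>\<^sup>+x. indicator A (h x) \<partial>lborel)" by (rule nn_integral_distr) auto
  also have "\<dots> = (\<integral>\<^sup>+x. indicator A x \<partial>lborel)" by (rule assms(2)) simp
  finally show "emeasure (distr lborel borel h) A = emeasure lborel A" by simp
qed simp

lemma distr_hmul_left: "distr lborel borel (hmul z) = lborel"
proof (rule distr_lborel_eqI)
  fix f :: "H3 \<Rightarrow> ennreal" assume [measurable]: "f \<in> borel_measurable borel"
  have "hmul z x = (fst z + fst x, fst (snd z) + fst (snd x),
     (snd (snd z) + (fst z * fst (snd x) - fst (snd z) * fst x) / 2) + snd (snd x))" for x
    by (cases z; cases x) (simp add: hmul_def)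
  then show "(\<integral>\<^sup>+x. f (hmul z x) \<partial>lborel) = (\<integral>\<^sup>+x. f x \<partial>lborel)"
    using nn_integral_shear[of f "\<lambda>a b. snd (snd z) + (fst z * b - fst (snd z) * a) / 2" "fst z" "fst (snd z)"]
    by (simp add: continuous_intros)
qed simp

lemma distr_hmul_right: "distr lborel borel (\<lambda>x. hmul x z) = lborel"
proof (rule distr_lborel_eqI)
  fix f :: "H3 \<Rightarrow> ennreal" assume [measurable]: "f \<in> borel_measurable borel"
  have "hmul x z = (fst z + fst x, fst (snd z) + fst (snd x),
     (snd (snd z) - (fst z * fst (snd x) - fst (snd z) * fst x) / 2) + snd (snd x))" for x
    by (cases z; cases x) (simp add: hmul_def field_simps)
  then show "(\<integral>\<^sup>+x. f (hmul x z) \<partial>lborel) = (\<integral>\<^sup>+x. f x \<partial>lborel)"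
    using nn_integral_shear[of f "\<lambda>a b. snd (snd z) - (fst z * b - fst (snd z) * a) / 2" "fst z" "fst (snd z)"]
    by (simp add: continuous_intros)
qed simp

lemma distr_uminus_H3: "distr lborel borel (uminus :: H3 \<Rightarrow> H3) = lborel"
  by (subst (2) lborel_affine[of "-1" 0]) (auto simp: density_1 one_ennreal_def[symmetric])

lemma
  fixes f :: "H3 \<Rightarrow> 'b::{banach, second_countable_topology}"
  assumes [measurable]: "f \<in> borel_measurable borel"
  shows integral_hmul_left: "(\<integral>x. f (hmul z x) \<partial>lborel) = (\<integral>x. f x \<partial>lborel)"
    and integral_hmul_right: "(\<integral>x. f (hmul x z) \<partial>lborel) = (\<integral>x. f x \<partial>lborel)"
    and integral_uminus_H3: "(\<integral>x. f (- x) \<partial>lborel) = (\<integral>x. f x \<partial>lborel)"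
    and integrable_uminus_H3: "integrable lborel (\<lambda>x. f (- x)) \<longleftrightarrow> integrable lborel f"
proof -
  have 1: "hmul z \<in> measurable lborel borel" "(\<lambda>x. hmul x z) \<in> measurable lborel borel"
    "uminus \<in> measurable (lborel :: H3 measure) borel" by simp_all
  show "(\<integral>x. f (hmul z x) \<partial>lborel) = (\<integral>x. f x \<partial>lborel)"
    using integral_distr[OF 1(1), of f] by (simp add: distr_hmul_left)
  show "(\<integral>x. f (hmul x z) \<partial>lborel) = (\<integral>x. f x \<partial>lborel)"
    using integral_distr[OF 1(2), of f] by (simp add: distr_hmul_right)
  show "(\<integral>x. f (- x) \<partial>lborel) = (\<integral>x. f x \<partial>lborel)"
    using integral_distr[OF 1(3), of f] by (simp add: distr_uminus_H3)
  show "integrable lborel (\<lambda>x. f (- x)) \<longleftrightarrow> integrable lborel f"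
    using integrable_distr_eq[OF 1(3), of f] by (simp add: distr_uminus_H3)
qed

subsection \<open>Left-invariant derivatives\<close>

text \<open>The derivative is carried as an explicit partner, with continuity of both functions
  built in. The rules of calculus then need no differentiability side conditions on
  \<open>lvf\<close>, and differentiation under an integral applies at once.\<close>

definition hder :: "H3 \<Rightarrow> (H3 \<Rightarrow> 'b::real_normed_vector) \<Rightarrow> (H3 \<Rightarrow> 'b) \<Rightarrow> bool" where
  "hder v f f' \<longleftrightarrow> continuous_on UNIV f \<and> continuous_on UNIV f' \<and>
     (\<forall>x. ((\<lambda>s. f (hmul x (s *\<^sub>R v))) has_vector_derivative f' x) (at 0))"

text \<open>Compact support in a form that is stable under products, sums and translations by
  arithmetic with radii; \<open>compact_supp_bsupp\<close> gives the equivalence.\<close>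

definition bsupp :: "(H3 \<Rightarrow> 'b::zero) \<Rightarrow> bool" where
  "bsupp f \<longleftrightarrow> (\<exists>R. \<forall>x. R < norm x \<longrightarrow> f x = 0)"

lemma hder_contD: "hder v f f' \<Longrightarrow> continuous_on UNIV f" "hder v f f' \<Longrightarrow> continuous_on UNIV f'"
  by (auto simp: hder_def)

text \<open>The points \<open>hmul x (s *\<^sub>R v)\<close> form an orbit of a one-parameter
  subgroup, so a derivative at parameter 0 for every base point is a derivative at every
  parameter.\<close>

lemma hder_flow:
  assumes "hder v f f'"
  shows "((\<lambda>s. f (hmul x (s *\<^sub>R v))) has_vector_derivative f' (hmul x (s *\<^sub>R v))) (at s within S)"
proof -
  have "((\<lambda>t. f (hmul (hmul x (s *\<^sub>R v)) (t *\<^sub>R v))) has_vector_derivative f' (hmul x (s *\<^sub>R v))) (at (s - s))"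
    using assms by (auto simp: hder_def)
  then have "((\<lambda>t. f (hmul (hmul x (s *\<^sub>R v)) (t *\<^sub>R v))) \<circ> (\<lambda>t. t - s) has_vector_derivative 1 *\<^sub>R f' (hmul x (s *\<^sub>R v))) (at s)"
    by (intro vector_diff_chain_at) (auto intro!: derivative_eq_intros)
  then have "((\<lambda>s. f (hmul x (s *\<^sub>R v))) has_vector_derivative f' (hmul x (s *\<^sub>R v))) (at s)"
    by (simp add: o_def hmul_flow)
  then show ?thesis by (rule has_vector_derivative_at_within)
qed

lemma lvf_eq_hder: "hder v f f' \<Longrightarrow> lvf v f = f'"
  by (auto simp: lvf_def hder_def intro!: ext vector_derivative_at)

lemma hder_const: "hder v (\<lambda>x. c) (\<lambda>x. 0)"
  by (auto simp: hder_def intro!: derivative_eq_intros)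

lemma hder_add: "hder v f f' \<Longrightarrow> hder v g g' \<Longrightarrow> hder v (\<lambda>x. f x + g x) (\<lambda>x. f' x + g' x)"
  by (auto simp: hder_def intro!: derivative_eq_intros continuous_intros)

lemma hder_diff: "hder v f f' \<Longrightarrow> hder v g g' \<Longrightarrow> hder v (\<lambda>x. f x - g x) (\<lambda>x. f' x - g' x)"
  by (auto simp: hder_def intro!: derivative_eq_intros continuous_intros)

lemma hder_bilinear:
  assumes "bounded_bilinear B" "hder v f f'" "hder v g g'"
  shows "hder v (\<lambda>x. B (f x) (g x)) (\<lambda>x. B (f' x) (g x) + B (f x) (g' x))"
proof -
  have "((\<lambda>s. B (f (hmul x (s *\<^sub>R v))) (g (hmul x (s *\<^sub>R v)))) has_vector_derivative
      B (f x) (g' x) + B (f' x) (g x)) (at 0)" for x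
    using bounded_bilinear.has_vector_derivative[OF assms(1) hder_flow[OF assms(2), of x 0]
        hder_flow[OF assms(3), of x 0]] by simp
  then show ?thesis using assms(2,3)
    by (auto simp: hder_def add.commute intro!: bounded_bilinear.continuous_on[OF assms(1)] continuous_intros)
qed

lemma hder_mult: "hder v f f' \<Longrightarrow> hder v g g' \<Longrightarrow> hder v (\<lambda>x. f x * g x) (\<lambda>x. f' x * g x + f x * g' x)"
  for f g :: "H3 \<Rightarrow> 'b::real_normed_algebra"
  by (rule hder_bilinear[OF bounded_bilinear_mult])

lemma hder_cmult: "hder v f f' \<Longrightarrow> hder v (\<lambda>x. c * f x) (\<lambda>x. c * f' x)"
  for f :: "H3 \<Rightarrow> 'b::real_normed_algebra"
  using hder_mult[OF hder_const[of v c]] by fastforce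

lemma hder_linear:
  assumes "bounded_linear B" "hder v f f'"
  shows "hder v (\<lambda>x. B (f x)) (\<lambda>x. B (f' x))"
  using assms(2) 
  by (auto simp: hder_def intro!: bounded_linear.continuous_on[OF assms(1)] bounded_linear.has_vector_derivative[OF assms(1)])

lemma hder_left_translate: "hder v f f' \<Longrightarrow> hder v (\<lambda>y. f (hmul x y)) (\<lambda>y. f' (hmul x y))"
  by (auto simp: hder_def hmul_assoc[symmetric] intro!: continuous_intros continuous_on_compose2[of UNIV f] continuous_on_compose2[of UNIV f'])

lemma hder_chain:
  fixes f :: "H3 \<Rightarrow> real"
  assumes f: "hder v f f'" and S: "\<And>x. f x \<in> S"
    and phi: "\<And>u. u \<in> S \<Longrightarrow> (\<phi> has_real_derivative \<phi>' u) (at u)" and c: "continuous_on S \<phi>'"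
  shows "hder v (\<lambda>x. \<phi> (f x)) (\<lambda>x. \<phi>' (f x) * f' x)"
proof -
  have cf: "continuous_on UNIV f" "continuous_on UNIV f'" using f by (auto simp: hder_def)
  have "continuous_on S \<phi>" using phi by (auto intro!: continuous_at_imp_continuous_on DERIV_isCont)
  then have 1: "continuous_on UNIV (\<lambda>x. \<phi> (f x))" using S by (intro continuous_on_compose2[OF _ cf(1)]) auto
  have 2: "continuous_on UNIV (\<lambda>x. \<phi>' (f x) * f' x)"
    using S by (intro continuous_intros continuous_on_compose2[OF c cf(1)] cf) auto
  have "((\<phi> \<circ> (\<lambda>s. f (hmul x (s *\<^sub>R v)))) has_vector_derivative f' x * \<phi>' (f x)) (at 0)" for x
    using f phi[OF S[of x]]
    by (intro field_vector_diff_chain_at) (auto simp: hder_def)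
  then show ?thesis using 1 2 by (auto simp: hder_def o_def mult.commute)
qed

lemma hder_bsupp0:
  assumes f: "hder v f f'" and R: "\<And>x. R < norm x \<Longrightarrow> f x = 0" and x: "R < norm x"
  shows "f' x = 0"
proof -
  have o: "open ((\<lambda>s::real. norm (hmul x (s *\<^sub>R v))) -` {R<..})"
    by (intro open_vimage continuous_intros open_greaterThan)
  have "((\<lambda>s. f (hmul x (s *\<^sub>R v))) has_vector_derivative f' x) (at 0)" using f by (auto simp: hder_def)
  from has_vector_derivative_transform_within_open[OF this o]
  have "((\<lambda>s::real. 0) has_vector_derivative f' x) (at 0)" using x R by simp
  moreover have "((\<lambda>s::real. 0) has_vector_derivative 0) (at 0)" by simp
  ultimately show ?thesis by (rule vector_derivative_unique_at)
qed

lemma hder_bsupp: "hder v f f' \<Longrightarrow> bsupp f \<Longrightarrow> bsupp f'"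
  unfolding bsupp_def using hder_bsupp0 by metis

lemma bsupp_mult_left: "bsupp f \<Longrightarrow> bsupp (\<lambda>x. f x * g x)" for f g :: "H3 \<Rightarrow> 'b::mult_zero"
  unfolding bsupp_def by (metis mult_zero_left mult_zero_right)
lemma bsupp_mult_right: "bsupp g \<Longrightarrow> bsupp (\<lambda>x. f x * g x)" for f g :: "H3 \<Rightarrow> 'b::mult_zero"
  unfolding bsupp_def by (metis mult_zero_left mult_zero_right)
lemma bsupp_add: 
  fixes f g :: "H3 \<Rightarrow> 'b::monoid_add"
  assumes "bsupp f" "bsupp g" shows "bsupp (\<lambda>x. f x + g x)"
proof -
  obtain R S where "\<forall>x. R < norm x \<longrightarrow> f x = 0" "\<forall>x. S < norm x \<longrightarrow> g x = 0" using assms by (auto simp: bsupp_def)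
  then show ?thesis unfolding bsupp_def by (intro exI[of _ "max R S"]) auto
qed
lemma bsupp_sum: "finite I \<Longrightarrow> (\<And>i. i \<in> I \<Longrightarrow> bsupp (f i)) \<Longrightarrow> bsupp (\<lambda>x. \<Sum>i\<in>I. f i x)"
  for f :: "'i \<Rightarrow> H3 \<Rightarrow> 'b::comm_monoid_add"
  by (induction I rule: finite_induct) (auto intro: bsupp_add simp: bsupp_def[of "\<lambda>x. 0"])

lemma bsupp_left_translate:
  fixes f :: "H3 \<Rightarrow> 'b::zero"
  assumes "bsupp f" shows "bsupp (\<lambda>y. f (hmul x y))"
proof -
  obtain R where R: "\<And>x. R < norm x \<Longrightarrow> f x = 0" using assms by (auto simp: bsupp_def)
  have "f (hmul x y) = 0" if "norm x + \<bar>R\<bar> + norm x * \<bar>R\<bar> < norm y" for y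
  proof (rule R, rule ccontr)
    assume "\<not> R < norm (hmul x y)"
    then have le: "norm (hmul x y) \<le> \<bar>R\<bar>" by simp
    have "norm y = norm (hmul (- x) (hmul x y))" by simp
    also have "\<dots> \<le> norm x + norm (hmul x y) + norm x * norm (hmul x y)"
      unfolding hmul_hbr[of "-x" "hmul x y"]
      by (rule order.trans[OF norm_triangle_ineq] add_mono order.trans[OF norm_triangle_ineq] order.trans[OF norm_hbr_le] | simp)+
    also have "\<dots> \<le> norm x + \<bar>R\<bar> + norm x * \<bar>R\<bar>"
      using le by (intro add_mono mult_left_mono) auto
    finally show False using that by simp
  qed
  then show ?thesis unfolding bsupp_def by blast
qed

lemma bsupp_cbox:
  assumes "\<And>x::H3. R < norm x \<Longrightarrow> f x = 0"
  obtains a b where "\<And>x. x \<notin> cbox a b \<Longrightarrow> f x = 0" "cball 0 R \<subseteq> cbox a b"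
proof -
  obtain a b where "cball (0::H3) R \<subseteq> cbox a b"
    using bounded_subset_cbox_symmetric[OF bounded_cball] by metis
  then show ?thesis using assms by (intro that[of a b]) (auto simp: subset_eq not_le[symmetric] )
qed

lemma integrable_cont_supp:
  fixes f :: "H3 \<Rightarrow> 'b::euclidean_space"
  assumes c: "continuous_on UNIV f" and s: "\<And>x. x \<notin> cbox a b \<Longrightarrow> f x = 0"
  shows "integrable lborel f" "(\<integral>x. f x \<partial>lborel) = integral (cbox a b) f"
proof -
  have "integrable lborel (\<lambda>x. indicator (cbox a b) x *\<^sub>R f x)"
    using borel_integrable_compact[OF compact_cbox continuous_on_subset[OF c subset_UNIV], of a b]
    by (simp add: set_integrable_def)
  moreover have "(\<lambda>x. indicator (cbox a b) x *\<^sub>R f x) = f" using s by (auto simp: indicator_def)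
  ultimately show 1: "integrable lborel f" by simp
  have if_s: "(\<lambda>x. if x \<in> cbox a b then f x else 0) = f" using s by auto
  have "(f has_integral (\<integral>x. f x \<partial>lborel)) UNIV" by (rule has_integral_integral_lborel[OF 1])
  then have "(f has_integral (\<integral>x. f x \<partial>lborel)) (cbox a b)"
    using has_integral_restrict_UNIV[of "cbox a b" f] if_s by simp
  then show "(\<integral>x. f x \<partial>lborel) = integral (cbox a b) f" by (simp add: integral_unique)
qed

lemma integrable_bsupp:
  fixes f :: "H3 \<Rightarrow> 'b::euclidean_space"
  assumes c: "continuous_on UNIV f" and s: "bsupp f"
  shows "integrable lborel f"
proof -
  obtain R where "\<And>x. R < norm x \<Longrightarrow> f x = 0" using s by (auto simp: bsupp_def)
  from bsupp_cbox[of R f, OF this] obtain a b where "\<And>x. x \<notin> cbox a b \<Longrightarrow> f x = 0" by metis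
  then show ?thesis by (rule integrable_cont_supp[OF c])
qed

lemma bounded_bsupp:
  fixes f :: "H3 \<Rightarrow> 'b::real_normed_vector"
  assumes c: "continuous_on UNIV f" and s: "bsupp f"
  obtains M where "M > 0" "\<And>x. norm (f x) \<le> M"
proof -
  obtain R where R: "\<And>x. R < norm x \<Longrightarrow> f x = 0" using s by (auto simp: bsupp_def)
  have "compact (f ` cball 0 R)" by (intro compact_continuous_image continuous_on_subset[OF c]) auto
  then obtain B where B: "B > 0" "\<And>x. x \<in> cball 0 R \<Longrightarrow> norm (f x) \<le> B"
    using compact_imp_bounded[OF \<open>compact (f ` cball 0 R)\<close>] unfolding bounded_pos by (metis imageI)
  have "norm (f x) \<le> B" for x
    using B R[of x] by (cases "R < norm x") auto
  then show ?thesis using that B(1) by blast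
qed

text \<open>Lebesgue measure is invariant under right translation, so the integral of
  \<open>h\<close> along the flow does not depend on \<open>s\<close>; differentiate this at 0 under
  the integral.\<close>

lemma integral_hder_eq_0:
  fixes h :: "H3 \<Rightarrow> 'b::euclidean_space"
  assumes h: "hder v h h'" and supp: "bsupp h"
  shows "(\<integral>x. h' x \<partial>lborel) = 0"
proof -
  obtain R where R: "\<And>x. R < norm x \<Longrightarrow> h x = 0" using supp by (auto simp: bsupp_def)
  \<comment> \<open>Points that the flow of \<open>v\<close> carries into the ball of radius
    \<open>\<bar>R\<bar>\<close> within time 1 have at most this norm, so a single box contains the
    supports of all translates involved.\<close>
  define R' where "R' = \<bar>R\<bar> + norm v + \<bar>R\<bar> * norm v"
  have R': "h (hmul x (s *\<^sub>R v)) = 0" if s: "s \<in> {-1..1}" and x: "R' < norm x" for s x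
  proof (rule R, rule ccontr)
    let ?w = "hmul x (s *\<^sub>R v)"
    assume "\<not> R < norm ?w"
    then have le: "norm ?w \<le> \<bar>R\<bar>" by simp
    have sv: "norm (s *\<^sub>R v) \<le> norm v" using s by (auto intro!: mult_left_le_one_le)
    have "norm x = norm (hmul ?w (- (s *\<^sub>R v)))" by simp
    also have "\<dots> \<le> norm ?w + norm (s *\<^sub>R v) + norm ?w * norm (s *\<^sub>R v)"
      unfolding hmul_hbr[of ?w]
      using norm_triangle_ineq[of "?w + - (s *\<^sub>R v)" "hbr ?w (- (s *\<^sub>R v))"]
        norm_triangle_ineq[of ?w "- (s *\<^sub>R v)"] norm_hbr_le[of ?w "- (s *\<^sub>R v)"] by (simp only: norm_minus_cancel)
    also have "\<dots> \<le> R'" unfolding R'_def using le sv by (intro add_mono mult_mono) auto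
    finally show False using x by simp
  qed
  define R2 where "R2 = max R R'"
  have R2: "R2 < norm x \<Longrightarrow> h x = 0" for x using R by (auto simp: R2_def)
  obtain a b where ab: "\<And>x. x \<notin> cbox a b \<Longrightarrow> h x = 0" "cball 0 R2 \<subseteq> cbox a b"
    using bsupp_cbox[of R2 h, OF R2] by metis
  have out: "R2 < norm x" if "x \<notin> cbox a b" for x using ab(2) that by (auto simp: subset_eq not_le[symmetric])
  have hs: "h (hmul x (s *\<^sub>R v)) = 0" if "s \<in> {-1..1}" "x \<notin> cbox a b" for s x
    using R'[OF that(1), of x] out[OF that(2)] by (auto simp: R2_def)
  have h's: "h' x = 0" if "x \<notin> cbox a b" for x by (rule hder_bsupp0[OF h R2 out[OF that]])
  have ch: "continuous_on UNIV h" "continuous_on UNIV h'" using hder_contD[OF h] by auto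
  have chs: "continuous_on UNIV (\<lambda>x. h (hmul x (s *\<^sub>R v)))" for s
    by (intro continuous_on_compose2[OF ch(1)] continuous_intros) auto
  have "((\<lambda>s. integral (cbox a b) (\<lambda>x. h (hmul x (s *\<^sub>R v)))) has_vector_derivative
      integral (cbox a b) (\<lambda>x. h' (hmul x (0 *\<^sub>R v)))) (at 0 within {-1..1})"
  proof (rule leibniz_rule_vector_derivative)
    show "continuous_on ({- 1..1} \<times> cbox a b) (\<lambda>(s, x). h' (hmul x (s *\<^sub>R v)))"
      unfolding case_prod_beta by (intro continuous_on_compose2[OF ch(2)] continuous_intros) auto
    show "(\<lambda>x. h (hmul x (s *\<^sub>R v))) integrable_on cbox a b" for s
      by (intro integrable_continuous continuous_on_subset[OF chs]) auto
  qed (auto intro: hder_flow[OF h])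
  moreover have "integral (cbox a b) (\<lambda>x. h (hmul x (s *\<^sub>R v))) = (\<integral>x. h x \<partial>lborel)" if "s \<in> {-1..1}" for s
  proof -
    have "integral (cbox a b) (\<lambda>x. h (hmul x (s *\<^sub>R v))) = (\<integral>x. h (hmul x (s *\<^sub>R v)) \<partial>lborel)"
      using integrable_cont_supp(2)[OF chs hs[OF that]] by simp
    also have "\<dots> = (\<integral>x. h x \<partial>lborel)" using ch by (intro integral_hmul_right) auto
    finally show ?thesis .
  qed
  ultimately have "((\<lambda>s. \<integral>x. h x \<partial>lborel) has_vector_derivative integral (cbox a b) h') (at 0 within {-1..1})"
    by (intro has_vector_derivative_transform[of 0 "{-1..1}" "\<lambda>s. \<integral>x. h x \<partial>lborel"]) auto
  moreover have "((\<lambda>s. \<integral>x. h x \<partial>lborel) has_vector_derivative 0) (at 0 within {-1..1})" by simp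
  moreover have "at 0 within {-1..1} = at (0::real)" by (intro at_within_interior) (auto simp: interior_atLeastAtMost_real)
  ultimately have "integral (cbox a b) h' = 0" by (metis vector_derivative_unique_at)
  then show ?thesis using integrable_cont_supp(2)[OF ch(2) h's] by simp
qed

lemma integral_hder_by_parts:
  fixes f g :: "H3 \<Rightarrow> 'b::{euclidean_space, real_normed_algebra}"
  assumes f: "hder v f f'" and g: "hder v g g'" and s: "bsupp f \<or> bsupp g"
  shows "(\<integral>x. f' x * g x \<partial>lborel) = - (\<integral>x. f x * g' x \<partial>lborel)"
proof -
  note c = hder_contD[OF f] hder_contD[OF g]
  have "bsupp (\<lambda>x. f x * g x)" using s by (auto intro: bsupp_mult_left bsupp_mult_right)
  from integral_hder_eq_0[OF hder_mult[OF f g] this]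
  have "(\<integral>x. f' x * g x + f x * g' x \<partial>lborel) = 0" .
  moreover have "integrable lborel (\<lambda>x. f' x * g x)" "integrable lborel (\<lambda>x. f x * g' x)"
    using s hder_bsupp[OF f] hder_bsupp[OF g] c
    by (auto intro!: integrable_bsupp continuous_intros intro: bsupp_mult_left bsupp_mult_right)
  ultimately show ?thesis by (simp add: add_eq_0_iff2)
qed

text \<open>A left-invariant field in \<open>x\<close> commutes with the left translation by
  \<open>- z\<close> and therefore falls on \<open>k\<close>; the regularity of the convolution
  comes entirely from \<open>k\<close>.\<close>

lemma convolution_leibniz:
  fixes k :: "H3 \<Rightarrow> real"
  assumes p: "continuous_on UNIV p" "bsupp p" and k: "hder v k k'"
  shows "hder v (\<lambda>x. \<integral>z. p z * k (hmul (- z) x) \<partial>lborel) (\<lambda>x. \<integral>z. p z * k' (hmul (- z) x) \<partial>lborel)"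
proof -
  obtain R where R: "\<And>x. R < norm x \<Longrightarrow> p x = 0" using p by (auto simp: bsupp_def)
  obtain a b where ab: "\<And>x. x \<notin> cbox a b \<Longrightarrow> p x = 0" using bsupp_cbox[of R p, OF R] by metis
  note ck = hder_contD[OF k]
  have c: "continuous_on UNIV (\<lambda>(x, z). p z * j (hmul (- z) x))" if "continuous_on UNIV j" for j :: "H3 \<Rightarrow> real"
    unfolding case_prod_beta
    by (intro continuous_intros continuous_on_compose2[OF p(1)] continuous_on_compose2[OF that]) auto
  have c1: "continuous_on UNIV (\<lambda>z. p z * j (hmul (- z) x))" if "continuous_on UNIV j" for x and j :: "H3 \<Rightarrow> real"
    by (intro continuous_intros continuous_on_compose2[OF p(1)] continuous_on_compose2[OF that]) auto
  have eq: "(\<integral>z. p z * j (hmul (- z) x) \<partial>lborel) = integral (cbox a b) (\<lambda>z. p z * j (hmul (- z) x))"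
    if "continuous_on UNIV j" for x and j :: "H3 \<Rightarrow> real"
    by (rule integrable_cont_supp(2)[OF c1[OF that]]) (simp add: ab)
  have cc: "continuous_on UNIV (\<lambda>x. integral (cbox a b) (\<lambda>z. p z * j (hmul (- z) x)))" 
    if "continuous_on UNIV j" for j :: "H3 \<Rightarrow> real"
    by (rule integral_continuous_on_param) (rule continuous_on_subset[OF c[OF that]], simp)
  have "((\<lambda>s. integral (cbox a b) (\<lambda>z. p z * k (hmul (- z) (hmul x (s *\<^sub>R v))))) has_vector_derivative
     integral (cbox a b) (\<lambda>z. p z * k' (hmul (- z) (hmul x (0 *\<^sub>R v))))) (at 0 within UNIV)" for x
  proof (rule leibniz_rule_vector_derivative)
    show "((\<lambda>s. p t * k (hmul (- t) (hmul x (s *\<^sub>R v)))) has_vector_derivative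
        p t * k' (hmul (- t) (hmul x (s *\<^sub>R v)))) (at s within UNIV)" for s t
      using hder_flow[OF k, of "hmul (-t) x" s UNIV] has_vector_derivative_mult_right by (fastforce simp: hmul_assoc)
    show "(\<lambda>z. p z * k (hmul (- z) (hmul x (s *\<^sub>R v)))) integrable_on cbox a b" for s
      by (intro integrable_continuous continuous_on_subset[OF c1[OF ck(1)]]) auto
    show "continuous_on (UNIV \<times> cbox a b) (\<lambda>(s, z). p z * k' (hmul (- z) (hmul x (s *\<^sub>R v))))"
      unfolding case_prod_beta
      by (intro continuous_intros continuous_on_compose2[OF p(1)] continuous_on_compose2[OF ck(2)]) auto
  qed auto
  then show ?thesis unfolding hder_def eq[OF ck(1)] eq[OF ck(2)] using cc[OF ck(1)] cc[OF ck(2)] by simp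
qed

section \<open>The four horizontal directions and the sub-Laplacian\<close>

abbreviation "HD \<equiv> set hdirs"

lemma HD_eq: "HD = {(1, 0, 0), (\<i>, 0, 0), (0, 1, 0), (0, \<i>, 0)}"
  by (simp add: hdirs_def e1_def e2_def)

lemma sum_list_hdirs: "(\<Sum>v\<leftarrow>hdirs. f v) = (\<Sum>v\<in>HD. f v)"
  by (rule sum_list_distinct_conv_sum_set) (simp add: hdirs_def e1_def e2_def complex_eq_iff)

lemma card_HD: "card HD = 4"
  by (simp add: HD_eq card_insert_if complex_eq_iff)

text \<open>Horizontal regularity with the derivatives as data. The sub-Laplacian involves only the
  pure second derivatives, and only these are recorded.\<close>

definition hC2 :: "(H3 \<Rightarrow> real) \<Rightarrow> (H3 \<Rightarrow> H3 \<Rightarrow> real) \<Rightarrow> (H3 \<Rightarrow> H3 \<Rightarrow> real) \<Rightarrow> bool" where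
  "hC2 f f1 f2 \<longleftrightarrow> (\<forall>v\<in>HD. hder v f (f1 v) \<and> hder v (f1 v) (f2 v))"

definition HL :: "(H3 \<Rightarrow> H3 \<Rightarrow> real) \<Rightarrow> H3 \<Rightarrow> real" where
  "HL f2 x = (\<Sum>v\<in>HD. f2 v x)"

lemma hC2D: "hC2 f f1 f2 \<Longrightarrow> v \<in> HD \<Longrightarrow> hder v f (f1 v)" "hC2 f f1 f2 \<Longrightarrow> v \<in> HD \<Longrightarrow> hder v (f1 v) (f2 v)"
  by (auto simp: hC2_def)

lemma hC2_cont: 
  assumes "hC2 f f1 f2"
  shows "continuous_on UNIV f" "v \<in> HD \<Longrightarrow> continuous_on UNIV (f1 v)" 
    "v \<in> HD \<Longrightarrow> continuous_on UNIV (f2 v)" "continuous_on UNIV (HL f2)"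
proof -
  show 1: "v \<in> HD \<Longrightarrow> continuous_on UNIV (f2 v)" for v using hC2D[OF assms] hder_contD by blast
  show "v \<in> HD \<Longrightarrow> continuous_on UNIV (f1 v)" using hC2D[OF assms] hder_contD by blast
  have "hder (1,0,0) f (f1 (1,0,0))" by (rule hC2D[OF assms]) (simp add: HD_eq)
  then show "continuous_on UNIV f" by (rule hder_contD)
  show "continuous_on UNIV (HL f2)" unfolding HL_def[abs_def] by (intro continuous_on_sum 1)
qed

lemma hC2_bsupp: "hC2 f f1 f2 \<Longrightarrow> bsupp f \<Longrightarrow> v \<in> HD \<Longrightarrow> bsupp (f1 v)"
  "hC2 f f1 f2 \<Longrightarrow> bsupp f \<Longrightarrow> v \<in> HD \<Longrightarrow> bsupp (f2 v)"
  "hC2 f f1 f2 \<Longrightarrow> bsupp f \<Longrightarrow> bsupp (HL f2)"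
proof -
  show 1: "hC2 f f1 f2 \<Longrightarrow> bsupp f \<Longrightarrow> v \<in> HD \<Longrightarrow> bsupp (f1 v)" for v using hC2D hder_bsupp by blast
  show 2: "hC2 f f1 f2 \<Longrightarrow> bsupp f \<Longrightarrow> v \<in> HD \<Longrightarrow> bsupp (f2 v)" for v using 1 hC2D hder_bsupp by blast
  show "hC2 f f1 f2 \<Longrightarrow> bsupp f \<Longrightarrow> bsupp (HL f2)" 
    unfolding HL_def[abs_def] by (intro bsupp_sum 2) auto
qed

lemma hC2_cmult: "hC2 f f1 f2 \<Longrightarrow> hC2 (\<lambda>x. c * f x) (\<lambda>v x. c * f1 v x) (\<lambda>v x. c * f2 v x)"
  by (auto simp: hC2_def intro: hder_cmult)
lemma hC2_add: "hC2 f f1 f2 \<Longrightarrow> hC2 g g1 g2 \<Longrightarrow> hC2 (\<lambda>x. f x + g x) (\<lambda>v x. f1 v x + g1 v x) (\<lambda>v x. f2 v x + g2 v x)"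
  by (auto simp: hC2_def intro: hder_add)
lemma hC2_left_translate: "hC2 f f1 f2 \<Longrightarrow> hC2 (\<lambda>y. f (hmul x y)) (\<lambda>v y. f1 v (hmul x y)) (\<lambda>v y. f2 v (hmul x y))"
  unfolding hC2_def by (intro ballI conjI hder_left_translate) blast+

lemma hC2_mult:
  assumes f: "hC2 f f1 f2" and g: "hC2 g g1 g2"
  shows "hC2 (\<lambda>x. f x * g x) (\<lambda>v x. f1 v x * g x + f x * g1 v x) 
    (\<lambda>v x. f2 v x * g x + 2 * (f1 v x * g1 v x) + f x * g2 v x)"
  unfolding hC2_def
proof (intro ballI conjI)
  fix v assume v: "v \<in> HD"
  note fv = hC2D[OF f v] hC2D[OF g v]
  show "hder v (\<lambda>x. f x * g x) (\<lambda>x. f1 v x * g x + f x * g1 v x)" using fv by (intro hder_mult)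
  have "hder v (\<lambda>x. f1 v x * g x + f x * g1 v x) (\<lambda>x. (f2 v x * g x + f1 v x * g1 v x) + (f1 v x * g1 v x + f x * g2 v x))"
    using fv by (intro hder_add hder_mult)
  then show "hder v (\<lambda>x. f1 v x * g x + f x * g1 v x) (\<lambda>x. f2 v x * g x + 2 * (f1 v x * g1 v x) + f x * g2 v x)"
    by (simp add: algebra_simps)
qed

text \<open>The set \<open>S\<close> contains the range of \<open>f\<close>, so \<phi> has to be
  regular only there; this admits logarithms.\<close>

lemma hC2_chain:
  assumes f: "hC2 f f1 f2" and S: "\<And>x. f x \<in> S"
    and phi: "\<And>u. u \<in> S \<Longrightarrow> (\<phi> has_real_derivative \<phi>' u) (at u)"
    and phi': "\<And>u. u \<in> S \<Longrightarrow> (\<phi>' has_real_derivative \<phi>'' u) (at u)" and c: "continuous_on S \<phi>''"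
  shows "hC2 (\<lambda>x. \<phi> (f x)) (\<lambda>v x. \<phi>' (f x) * f1 v x) (\<lambda>v x. \<phi>'' (f x) * (f1 v x)\<^sup>2 + \<phi>' (f x) * f2 v x)"
  unfolding hC2_def
proof (intro ballI conjI)
  fix v assume v: "v \<in> HD"
  note fv = hC2D[OF f v]
  have c': "continuous_on S \<phi>'" using phi' by (auto intro!: continuous_at_imp_continuous_on DERIV_isCont)
  show "hder v (\<lambda>x. \<phi> (f x)) (\<lambda>x. \<phi>' (f x) * f1 v x)"
    by (rule hder_chain[OF fv(1) S phi c'])
  have "hder v (\<lambda>x. \<phi>' (f x)) (\<lambda>x. \<phi>'' (f x) * f1 v x)"
    by (rule hder_chain[OF fv(1) S phi' c])
  from hder_mult[OF this fv(2)]
  show "hder v (\<lambda>x. \<phi>' (f x) * f1 v x) (\<lambda>x. \<phi>'' (f x) * (f1 v x)\<^sup>2 + \<phi>' (f x) * f2 v x)"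
    by (simp add: power2_eq_square mult_ac)
qed

lemma hC2_convolution:
  assumes "continuous_on UNIV p" "bsupp p" and k: "hC2 k k1 k2"
  shows "hC2 (\<lambda>x. \<integral>z. p z * k (hmul (- z) x) \<partial>lborel) (\<lambda>v x. \<integral>z. p z * k1 v (hmul (- z) x) \<partial>lborel)
     (\<lambda>v x. \<integral>z. p z * k2 v (hmul (- z) x) \<partial>lborel)"
  using convolution_leibniz[OF assms(1,2)] k by (auto simp: hC2_def)

text \<open>The fields are divergence free for Lebesgue measure, so each is formally skew and the
  sub-Laplacian formally symmetric. One compactly supported factor is enough; the other will be a
  heat kernel.\<close>

lemma integral_HL_by_parts:
  assumes f: "hC2 f f1 f2" and g: "hC2 g g1 g2" and s: "bsupp f \<or> bsupp g"
  shows "(\<integral>x. HL f2 x * g x \<partial>lborel) = (\<integral>x. f x * HL g2 x \<partial>lborel)"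
    "integrable lborel (\<lambda>x. HL f2 x * g x)" "integrable lborel (\<lambda>x. f x * HL g2 x)"
proof -
  note c = hC2_cont[OF f] hC2_cont[OF g]
  note bs = hC2_bsupp[OF f] hC2_bsupp[OF g]
  have i1: "integrable lborel (\<lambda>x. f2 v x * g x)" if "v \<in> HD" for v
    using s bs(2)[of v] that c(1) c(3)[OF that] c(5)
    by (auto intro!: integrable_bsupp continuous_intros intro: bsupp_mult_left bsupp_mult_right)
  have i2: "integrable lborel (\<lambda>x. f x * g2 v x)" if "v \<in> HD" for v
    using s bs(5)[of v] that c(1) c(5) c(7)[OF that]
    by (auto intro!: integrable_bsupp continuous_intros intro: bsupp_mult_left bsupp_mult_right)
  have e: "(\<integral>x. f2 v x * g x \<partial>lborel) = (\<integral>x. f x * g2 v x \<partial>lborel)" if v: "v \<in> HD" for v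
  proof -
    have "(\<integral>x. f2 v x * g x \<partial>lborel) = - (\<integral>x. f1 v x * g1 v x \<partial>lborel)"
      using s bs(1)[OF _ v] by (intro integral_hder_by_parts[OF hC2D(2)[OF f v] hC2D(1)[OF g v]]) auto
    moreover have "(\<integral>x. f1 v x * g1 v x \<partial>lborel) = - (\<integral>x. f x * g2 v x \<partial>lborel)"
      using s bs(4)[OF _ v] by (intro integral_hder_by_parts[OF hC2D(1)[OF f v] hC2D(2)[OF g v]]) auto
    ultimately show ?thesis by simp
  qed
  show "(\<integral>x. HL f2 x * g x \<partial>lborel) = (\<integral>x. f x * HL g2 x \<partial>lborel)"
    by (simp add: HL_def sum_distrib_left sum_distrib_right Bochner_Integration.integral_sum i1 i2 e)
  show "integrable lborel (\<lambda>x. HL f2 x * g x)" "integrable lborel (\<lambda>x. f x * HL g2 x)"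
    by (simp_all add: HL_def sum_distrib_left sum_distrib_right i1 i2)
qed

subsection \<open>Frechet regularity\<close>

text \<open>Regularity is tested on the values \<open>f' x u\<close> with \<open>u\<close> fixed, so
  the recursion stays among functions into the same space instead of climbing through spaces of
  linear maps.\<close>

primrec Ck :: "nat \<Rightarrow> (H3 \<Rightarrow> 'b::real_normed_vector) \<Rightarrow> bool" where
  "Ck 0 f \<longleftrightarrow> continuous_on UNIV f"
| "Ck (Suc n) f \<longleftrightarrow> (\<exists>f'. (\<forall>x. (f has_derivative f' x) (at x)) \<and> (\<forall>u. Ck n (\<lambda>x. f' x u)))"

lemma smooth_fun_Ck: "smooth_fun f \<Longrightarrow> Ck n f"
proof (induction n arbitrary: f)
  case 0
  then have "\<forall>x. f differentiable (at x)" by (auto elim: smooth_fun.cases)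
  then show ?case by (auto simp: continuous_on_eq_continuous_at intro: differentiable_imp_continuous_within)
next
  case (Suc n)
  then have "\<forall>x. f differentiable (at x)" "\<forall>u. smooth_fun (\<lambda>x. frechet_derivative f (at x) u)"
    by (auto elim: smooth_fun.cases)
  then show ?case unfolding Ck.simps
    by (intro exI[of _ "\<lambda>x. frechet_derivative f (at x)"] conjI allI Suc.IH)
       (simp_all only: frechet_derivative_works[symmetric])
qed

lemma Ck_continuous: "Ck n f \<Longrightarrow> continuous_on UNIV f"
  by (cases n) (auto simp: continuous_on_eq_continuous_at intro: has_derivative_continuous)

lemma Ck_Suc_imp: "Ck (Suc n) f \<Longrightarrow> Ck n f"
proof (induction n arbitrary: f)
  case 0 then show ?case using Ck_continuous by fastforce
next
  case (Suc n)
  then obtain f' where "\<forall>x. (f has_derivative f' x) (at x)" "\<forall>u. Ck (Suc n) (\<lambda>x. f' x u)" by auto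
  then show ?case using Suc.IH by auto
qed

lemma Ck_const: "Ck n (\<lambda>x. c)"
proof (induction n arbitrary: c)
  case (Suc n) then show ?case by (auto intro!: exI[of _ "\<lambda>x u. 0"])
qed simp

lemma Ck_linear_fun: "bounded_linear L \<Longrightarrow> Ck n L"
  by (cases n) (auto intro!: exI[of _ "\<lambda>x. L"] Ck_const bounded_linear_imp_has_derivative linear_continuous_on)

lemma Ck_add: "Ck n f \<Longrightarrow> Ck n g \<Longrightarrow> Ck n (\<lambda>x. f x + g x)"
proof (induction n arbitrary: f g)
  case 0 then show ?case by (auto intro: continuous_intros)
next
  case (Suc n)
  then obtain f' g' where 1: "\<forall>x. (f has_derivative f' x) (at x)" "\<forall>u. Ck n (\<lambda>x. f' x u)"
      "\<forall>x. (g has_derivative g' x) (at x)" "\<forall>u. Ck n (\<lambda>x. g' x u)" by auto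
  show ?case unfolding Ck.simps
    by (rule exI[of _ "\<lambda>x u. f' x u + g' x u"]) (use 1 Suc.IH in \<open>auto intro!: has_derivative_add\<close>)
qed

lemma Ck_bilinear:
  assumes B: "bounded_bilinear B"
  shows "Ck n f \<Longrightarrow> Ck n g \<Longrightarrow> Ck n (\<lambda>x. B (f x) (g x))"
proof (induction n arbitrary: f g)
  case 0 then show ?case by (auto intro: bounded_bilinear.continuous_on[OF B])
next
  case (Suc n)
  then obtain f' g' where 1: "\<And>x. (f has_derivative f' x) (at x)" "\<And>u. Ck n (\<lambda>x. f' x u)"
      "\<And>x. (g has_derivative g' x) (at x)" "\<And>u. Ck n (\<lambda>x. g' x u)" unfolding Ck.simps by blast
  have 2: "Ck n f" "Ck n g" using Suc.prems Ck_Suc_imp by blast+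
  show ?case unfolding Ck.simps
    by (intro exI[of _ "\<lambda>x u. B (f x) (g' x u) + B (f' x u) (g x)"] allI conjI
          bounded_bilinear.FDERIV[OF B] Ck_add Suc.IH 1 2)
qed

lemma Ck_linear:
  assumes B: "bounded_linear B"
  shows "Ck n f \<Longrightarrow> Ck n (\<lambda>x. B (f x))"
proof (induction n arbitrary: f)
  case 0 then show ?case by (auto intro: bounded_linear.continuous_on[OF B])
next
  case (Suc n)
  then obtain f' where 1: "\<And>x. (f has_derivative f' x) (at x)" "\<And>u. Ck n (\<lambda>x. f' x u)" unfolding Ck.simps by blast
  show ?case unfolding Ck.simps
    by (intro exI[of _ "\<lambda>x u. B (f' x u)"] allI conjI bounded_linear.has_derivative[OF B] Suc.IH 1)
qed

lemma Ck_uminus_arg: "Ck n f \<Longrightarrow> Ck n (\<lambda>x. f (- x))"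
proof (induction n arbitrary: f)
  case 0 then show ?case by (auto intro!: continuous_on_compose2[of UNIV f] continuous_intros)
next
  case (Suc n)
  then obtain f' where 1: "\<And>x. (f has_derivative f' x) (at x)" "\<And>u. Ck n (\<lambda>x. f' x u)" unfolding Ck.simps by blast
  have "((\<lambda>x. f (- x)) has_derivative (\<lambda>u. f' (- x) (- u))) (at x)" for x
    by (rule has_derivative_compose[OF _ 1(1), of uminus]) (auto intro!: derivative_eq_intros)
  then show ?case unfolding Ck.simps
    by (intro exI[of _ "\<lambda>x u. f' (- x) (- u)"] allI conjI Suc.IH 1)
qed

lemma Ck_sum: "finite I \<Longrightarrow> (\<And>i. i \<in> I \<Longrightarrow> Ck n (f i)) \<Longrightarrow> Ck n (\<lambda>x. \<Sum>i\<in>I. f i x)"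
  by (induction I rule: finite_induct) (auto intro: Ck_const Ck_add)

lemma has_derivative_hmul_flow:
  assumes "(f has_derivative f') (at x)"
  shows "((\<lambda>s::real. f (hmul x (s *\<^sub>R v))) has_vector_derivative f' (v + hbr x v)) (at 0)"
proof -
  have "((\<lambda>s::real. hmul x (s *\<^sub>R v)) has_derivative (\<lambda>s. s *\<^sub>R (v + hbr x v))) (at 0)"
    unfolding hmul_hbr hbr.scaleR_right by (auto intro!: derivative_eq_intros simp: algebra_simps)
  from has_derivative_compose[OF this, of f f'] assms
  have "((\<lambda>s::real. f (hmul x (s *\<^sub>R v))) has_derivative (\<lambda>s. f' (s *\<^sub>R (v + hbr x v)))) (at 0)" by simp
  moreover have "f' (s *\<^sub>R w) = s *\<^sub>R f' w" for s w
    using assms has_derivative_bounded_linear linear_simps(5) by blast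
  ultimately show ?thesis by (simp add: has_vector_derivative_def)
qed

text \<open>The field evaluates \<open>f' x\<close> at the moving vector \<open>v + hbr x v\<close>,
  whereas \<open>Ck\<close> controls fixed directions. The moving part is central and real-linear in
  \<open>x\<close>, so it expands over the two central basis vectors with linear
  coefficients.\<close>

lemma Ck_hder:
  fixes f :: "H3 \<Rightarrow> 'b::real_normed_vector"
  assumes f: "Ck (Suc n) f"
  shows "\<exists>f'. hder v f f' \<and> Ck n f'"
proof -
  obtain f' where 1: "\<And>x. (f has_derivative f' x) (at x)" "\<And>u. Ck n (\<lambda>x. f' x u)" using f unfolding Ck.simps by blast
  define c where "c x = (fst x * fst (snd v) - fst (snd x) * fst v) / 2" for x :: H3
  have lin: "linear (f' x)" for x using 1(1) has_derivative_bounded_linear bounded_linear.linear by blast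
  have "hbr x v = Re (c x) *\<^sub>R (0, 0, 1) + Im (c x) *\<^sub>R (0, 0, \<i>)" for x
    by (simp add: hbr_def c_def[symmetric] scaleR_conv_of_real complex_eq_iff)
  then have eq: "f' x (v + hbr x v) = f' x v + (Re (c x) *\<^sub>R f' x (0, 0, 1) + Im (c x) *\<^sub>R f' x (0, 0, \<i>))" for x
    by (simp only: linear_add[OF lin] linear_scale[OF lin])
  have "bounded_linear (\<lambda>x::H3. Re (c x))" "bounded_linear (\<lambda>x::H3. Im (c x))"
    unfolding c_def
    by (rule bounded_linear_compose[OF bounded_linear_Re] bounded_linear_compose[OF bounded_linear_Im]
        bounded_linear_divide[THEN bounded_linear_compose] bounded_linear_sub
        bounded_linear_compose[OF bounded_linear_mult_left] bounded_linear_fst bounded_linear_compose[OF bounded_linear_fst] bounded_linear_snd)+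
  then have cl: "Ck n (\<lambda>x::H3. Re (c x))" "Ck n (\<lambda>x::H3. Im (c x))" by (auto intro: Ck_linear_fun)
  have k: "Ck n (\<lambda>x. f' x (v + hbr x v))" unfolding eq
    by (intro Ck_add 1 Ck_bilinear[OF bounded_bilinear_scaleR] cl)
  have "hder v f (\<lambda>x. f' x (v + hbr x v))"
    unfolding hder_def using Ck_continuous[OF f] Ck_continuous[OF k] has_derivative_hmul_flow[OF 1(1)] by blast
  with k show ?thesis by blast
qed

lemma Ck_lvf: "Ck (Suc n) f \<Longrightarrow> hder v f (lvf v f)" "Ck (Suc n) f \<Longrightarrow> Ck n (lvf v f)"
  using Ck_hder[of n f v] lvf_eq_hder by metis+

lemma Ck_hC2: "Ck 2 f \<Longrightarrow> hC2 f (\<lambda>v. lvf v f) (\<lambda>v. lvf v (lvf v f))"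
  unfolding hC2_def numeral_2_eq_2 using Ck_lvf by blast

lemma HL_subLap: "HL (\<lambda>v. lvf v (lvf v f)) x = subLap f x"
  by (simp add: HL_def subLap_def sum_list_hdirs)

subsection \<open>Cut-off functions\<close>

text \<open>The exponent is at least 2, so the difference quotient at the kink is a positive power
  of the positive part and tends to 0.\<close>

lemma DERIV_max_power:
  "((\<lambda>y::real. max 0 y ^ Suc (Suc n)) has_real_derivative real (Suc (Suc n)) * max 0 y ^ Suc n) (at y)"
proof -
  consider "y > 0" | "y < 0" | "y = 0" by linarith
  then show ?thesis
  proof cases
    case 1
    have "((\<lambda>y::real. y ^ Suc (Suc n)) has_real_derivative real (Suc (Suc n)) * y ^ Suc n) (at y)"
      using DERIV_pow[of "Suc (Suc n)" y] by simp
    then show ?thesis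
      by (rule has_field_derivative_transform_within_open[of _ _ _ "{0<..}", THEN DERIV_cong]) (use 1 in \<open>auto simp: max_def\<close>)
  next
    case 2
    have "((\<lambda>y::real. 0) has_real_derivative 0) (at y)" by simp
    then show ?thesis
      by (rule has_field_derivative_transform_within_open[of _ _ _ "{..<0}", THEN DERIV_cong]) (use 2 in \<open>auto simp: max_def\<close>)
  next
    case 3
    have "((\<lambda>h::real. max 0 h ^ Suc n) \<longlongrightarrow> max 0 0 ^ Suc n) (at 0)" by (intro tendsto_intros)
    then have "((\<lambda>h::real. max 0 h ^ Suc (Suc n) / h) \<longlongrightarrow> 0) (at 0)"
      by (rule Lim_transform_eventually[THEN tendsto_eq_rhs]) (auto simp: eventually_at_filter max_def)
    then show ?thesis using 3 by (simp add: DERIV_def)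
  qed
qed

lemma DERIV_eta:
  "((\<lambda>r::real. max 0 (1 - r) ^ 3) has_real_derivative - 3 * max 0 (1 - r) ^ 2) (at r)"
  "((\<lambda>r::real. - 3 * max 0 (1 - r) ^ 2) has_real_derivative 6 * max 0 (1 - r)) (at r)"
proof -
  have a: "((\<lambda>r::real. 1 - r) has_real_derivative -1) (at r)" by (auto intro!: derivative_eq_intros)
  show "((\<lambda>r::real. max 0 (1 - r) ^ 3) has_real_derivative - 3 * max 0 (1 - r) ^ 2) (at r)"
    using DERIV_chain2[OF DERIV_max_power[of 1 "1 - r"] a] by (simp add: numeral_eq_Suc)
  have "((\<lambda>r::real. max 0 (1 - r) ^ 2) has_real_derivative - 2 * max 0 (1 - r)) (at r)"
    using DERIV_chain2[OF DERIV_max_power[of 0 "1 - r"] a] by (simp add: numeral_eq_Suc)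
  from DERIV_cmult[OF this, of "-3"]
  show "((\<lambda>r::real. - 3 * max 0 (1 - r) ^ 2) has_real_derivative 6 * max 0 (1 - r)) (at r)" by simp
qed

text \<open>The squared Euclidean norm after the group dilation by sqrt lam, which scales the centre
  by lam. First and second horizontal derivatives of functions of it therefore scale like sqrt lam
  and lam.\<close>

definition hq :: "real \<Rightarrow> H3 \<Rightarrow> real" where
  "hq lam x = lam * (fst x \<bullet> fst x + fst (snd x) \<bullet> fst (snd x)) + lam\<^sup>2 * (snd (snd x) \<bullet> snd (snd x))"

text \<open>The central entry of \<open>hbr x v\<close>: the rate at which the central coordinate
  changes along \<open>v\<close>. It is constant along that flow.\<close>

definition hw :: "H3 \<Rightarrow> H3 \<Rightarrow> complex" where
  "hw v x = (fst x * fst (snd v) - fst (snd x) * fst v) / 2"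

definition hq1 :: "real \<Rightarrow> H3 \<Rightarrow> H3 \<Rightarrow> real" where
  "hq1 lam v x = 2 * lam * (fst x \<bullet> fst v + fst (snd x) \<bullet> fst (snd v)) + 2 * lam\<^sup>2 * (snd (snd x) \<bullet> hw v x)"

definition hq2 :: "real \<Rightarrow> H3 \<Rightarrow> H3 \<Rightarrow> real" where
  "hq2 lam v x = 2 * lam * (fst v \<bullet> fst v + fst (snd v) \<bullet> fst (snd v)) + 2 * lam\<^sup>2 * (hw v x \<bullet> hw v x)"

lemma hder_coord:
  assumes "v \<in> HD"
  shows "hder v (\<lambda>x. fst x) (\<lambda>x. fst v)" "hder v (\<lambda>x. fst (snd x)) (\<lambda>x. fst (snd v))"
    "hder v (\<lambda>x. snd (snd x)) (hw v)" "hder v (hw v) (\<lambda>x. 0)"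
proof -
  have v: "snd (snd v) = 0" using assms by (auto simp: HD_eq)
  have c: "continuous_on UNIV (hw v)" unfolding hw_def by (intro continuous_intros) auto
  have z: "hw v (hmul x (s *\<^sub>R v)) = hw v x" for x s
    by (simp add: hw_def hmul_hbr hbr_def algebra_simps)
  show "hder v (hw v) (\<lambda>x. 0)" unfolding hder_def z using c by simp
  have e: "fst (hmul x (s *\<^sub>R v)) = fst x + s *\<^sub>R fst v" "fst (snd (hmul x (s *\<^sub>R v))) = fst (snd x) + s *\<^sub>R fst (snd v)"
    "snd (snd (hmul x (s *\<^sub>R v))) = snd (snd x) + s *\<^sub>R hw v x" for x s
    using v by (simp_all only: hmul_hbr hbr.scaleR_right fst_add snd_add fst_scaleR snd_scaleR)
      (simp_all add: hbr_def hw_def)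
  have d: "((\<lambda>s::real. a + s *\<^sub>R b) has_vector_derivative b) (at 0)" for a b :: complex
    by (auto intro!: derivative_eq_intros)
  show "hder v (\<lambda>x. fst x) (\<lambda>x. fst v)" unfolding hder_def e by (intro conjI allI d continuous_intros)
  show "hder v (\<lambda>x. fst (snd x)) (\<lambda>x. fst (snd v))" unfolding hder_def e by (intro conjI allI d continuous_intros)
  show "hder v (\<lambda>x. snd (snd x)) (hw v)" unfolding hder_def e by (intro conjI allI d c continuous_intros)
qed

lemma hC2_hq: "hC2 (hq lam) (hq1 lam) (hq2 lam)"
  unfolding hC2_def
proof (intro ballI conjI)
  fix v assume v: "v \<in> HD"
  note c = hder_coord[OF v]
  note b = hder_bilinear[OF bounded_bilinear_inner]
  have "hder v (hq lam) (\<lambda>x. lam * ((fst v \<bullet> fst x + fst x \<bullet> fst v) + (fst (snd v) \<bullet> fst (snd x) + fst (snd x) \<bullet> fst (snd v)))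
      + lam\<^sup>2 * (hw v x \<bullet> snd (snd x) + snd (snd x) \<bullet> hw v x))"
    unfolding hq_def[abs_def] by (intro hder_add hder_cmult b c)
  then show "hder v (hq lam) (hq1 lam v)"
    by (simp add: hq1_def[abs_def] inner_commute algebra_simps)
  have "hder v (hq1 lam v) (\<lambda>x. 2 * lam * ((fst v \<bullet> fst v + fst x \<bullet> 0) + (fst (snd v) \<bullet> fst (snd v) + fst (snd x) \<bullet> 0))
      + 2 * lam\<^sup>2 * (hw v x \<bullet> hw v x + snd (snd x) \<bullet> 0))"
    unfolding hq1_def[abs_def] by (intro hder_add hder_cmult b c hder_const)
  then show "hder v (hq1 lam v) (hq2 lam v)" by (simp add: hq2_def[abs_def])
qed

text \<open>The cube is the lowest integer power of a positive part with continuous second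
  derivative. As lam decreases to 0 these cut-offs increase to 1.\<close>

definition chi :: "real \<Rightarrow> H3 \<Rightarrow> real" where "chi lam x = max 0 (1 - hq lam x) ^ 3"
definition chi1 :: "real \<Rightarrow> H3 \<Rightarrow> H3 \<Rightarrow> real" where
  "chi1 lam v x = - 3 * max 0 (1 - hq lam x) ^ 2 * hq1 lam v x"
definition chi2 :: "real \<Rightarrow> H3 \<Rightarrow> H3 \<Rightarrow> real" where
  "chi2 lam v x = 6 * max 0 (1 - hq lam x) * (hq1 lam v x)\<^sup>2 + - 3 * max 0 (1 - hq lam x) ^ 2 * hq2 lam v x"

lemma hC2_chi: "hC2 (chi lam) (chi1 lam) (chi2 lam)"
  unfolding chi_def[abs_def] chi1_def[abs_def] chi2_def[abs_def]
  by (rule hC2_chain[OF hC2_hq, of _ UNIV "\<lambda>r. max 0 (1 - r) ^ 3" "\<lambda>r. - 3 * max 0 (1 - r) ^ 2" "\<lambda>r. 6 * max 0 (1 - r)"])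
     (rule UNIV_I DERIV_eta | intro continuous_intros)+

lemma hq_nonneg: "0 \<le> lam \<Longrightarrow> 0 \<le> hq lam x"
  by (simp add: hq_def)

lemma chi_range: "0 \<le> lam \<Longrightarrow> 0 \<le> chi lam x \<and> chi lam x \<le> 1"
  using hq_nonneg[of lam x] by (auto simp: chi_def intro!: power_le_one)

lemma chi_0 [simp]: "chi lam 0 = 1"
  by (simp add: chi_def hq_def)

lemma chi_uminus [simp]: "chi lam (- x) = chi lam x"
  by (simp add: chi_def hq_def)

lemma chi_antimono:
  assumes "0 \<le> lam" "lam \<le> lam'" shows "chi lam' x \<le> chi lam x"
proof -
  have "hq lam x \<le> hq lam' x" unfolding hq_def using assms
    by (intro add_mono mult_right_mono power_mono) auto
  then show ?thesis unfolding chi_def by (intro power_mono) auto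
qed

lemma chi_tendsto: "((\<lambda>lam. chi lam x) \<longlongrightarrow> 1) (at 0)"
  unfolding chi_def hq_def by (auto intro!: tendsto_eq_intros)

lemma bsupp_chi:
  assumes "0 < lam" shows "bsupp (chi lam)"
proof -
  define m where "m = min lam (lam\<^sup>2)"
  have m: "m > 0" "m \<le> lam" "m \<le> lam\<^sup>2" using assms by (auto simp: m_def)
  have "chi lam x = 0" if "1 / m + 1 < norm x" for x
  proof -
    have "norm x \<ge> 1" using that m(1) by (smt (verit) divide_pos_pos)
    have "1 \<le> m * norm x" using that m(1) by (simp add: field_simps)
    also have "\<dots> \<le> m * (norm x)\<^sup>2"
      using m(1) \<open>norm x \<ge> 1\<close> by (intro mult_left_mono self_le_power) auto
    also have "\<dots> = m * (fst x \<bullet> fst x + fst (snd x) \<bullet> fst (snd x)) + m * (snd (snd x) \<bullet> snd (snd x))"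
      by (simp add: power2_norm_eq_inner inner_prod_def algebra_simps)
    also have "\<dots> \<le> hq lam x" unfolding hq_def using m by (intro add_mono mult_right_mono) auto
    finally show ?thesis by (simp add: chi_def)
  qed
  then show ?thesis unfolding bsupp_def by blast
qed

text \<open>On the support the dilated coordinates have norm at most 1, which gives 6 sqrt lam as a
  bound for \<open>hq1\<close> and 4 lam for \<open>hq2\<close>. The constants are 18 = 3 * 6 and
  228 = 6 * 36 + 3 * 4.\<close>

lemma chi_bounds:
  assumes l: "0 < lam" and v: "v \<in> HD"
  shows "\<bar>chi1 lam v x\<bar> \<le> 18 * sqrt lam" "\<bar>chi2 lam v x\<bar> \<le> 228 * lam"
proof -
  define m where "m = max 0 (1 - hq lam x)"
  have m: "0 \<le> m" "m \<le> 1" using hq_nonneg[of lam x] l by (auto simp: m_def)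
  have "\<bar>chi1 lam v x\<bar> \<le> 18 * sqrt lam \<and> \<bar>chi2 lam v x\<bar> \<le> 228 * lam"
  proof (cases "hq lam x < 1")
    case False
    then have "m = 0" by (simp add: m_def)
    then show ?thesis using l by (simp add: chi1_def chi2_def m_def[symmetric])
  next
    case True
    define r where "r = sqrt lam"
    have r: "0 < r" "r\<^sup>2 = lam" using l by (auto simp: r_def)
    define A B C where "A = norm (fst x)" and "B = norm (fst (snd x))" and "C = norm (snd (snd x))"
    have pos: "0 \<le> A" "0 \<le> B" "0 \<le> C" by (auto simp: A_def B_def C_def)
    have q: "r\<^sup>2 * (A\<^sup>2 + B\<^sup>2) + (r\<^sup>2)\<^sup>2 * C\<^sup>2 < 1"
      using True by (simp add: hq_def r A_def B_def C_def power2_norm_eq_inner)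
    have "(r * A)\<^sup>2 \<le> 1\<^sup>2" "(r * B)\<^sup>2 \<le> 1\<^sup>2" "(r\<^sup>2 * C)\<^sup>2 \<le> 1\<^sup>2"
      using q zero_le_power2[of "r * A"] zero_le_power2[of "r * B"] zero_le_power2[of "r\<^sup>2 * C"]
      unfolding power_mult_distrib distrib_left one_power2 by linarith+
    then have b: "r * A \<le> 1" "r * B \<le> 1" "r\<^sup>2 * C \<le> 1" by (auto intro: power2_le_imp_le)
    have nv: "norm (fst v) + norm (fst (snd v)) = 1" "fst v \<bullet> fst v + fst (snd v) \<bullet> fst (snd v) = 1" 
      using v by (auto simp: HD_eq)
    have nv1: "norm (fst v) \<le> 1" "norm (fst (snd v)) \<le> 1"
      using nv(1) norm_ge_zero[of "fst v"] norm_ge_zero[of "fst (snd v)"] by linarith+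
    have "r * norm (hw v x) \<le> r * ((A * norm (fst (snd v)) + B * norm (fst v)) / 2)"
      using r(1) norm_triangle_ineq4[of "fst x * fst (snd v)" "fst (snd x) * fst v"]
      by (simp add: hw_def norm_divide norm_mult A_def B_def)
    also have "\<dots> = ((r * A) * norm (fst (snd v)) + (r * B) * norm (fst v)) / 2" by (simp add: algebra_simps)
    also have "\<dots> \<le> (1 * 1 + 1 * 1) / 2" using b nv1 pos r by (intro divide_right_mono add_mono mult_mono) auto
    finally have w: "r * norm (hw v x) \<le> 1" by simp
    have i: "\<bar>fst x \<bullet> fst v\<bar> \<le> A * 1" "\<bar>fst (snd x) \<bullet> fst (snd v)\<bar> \<le> B * 1"
      using Cauchy_Schwarz_ineq2[of "fst x" "fst v"] Cauchy_Schwarz_ineq2[of "fst (snd x)" "fst (snd v)"] nv1 pos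
      unfolding A_def B_def by (meson order.trans mult_left_mono norm_ge_zero)+
    have i3: "\<bar>snd (snd x) \<bullet> hw v x\<bar> \<le> C * norm (hw v x)"
      unfolding C_def by (rule Cauchy_Schwarz_ineq2)
    have "\<bar>hq1 lam v x\<bar> \<le> 2 * r\<^sup>2 * (A + B) + 2 * (r\<^sup>2)\<^sup>2 * (C * norm (hw v x))"
    proof -
      have "\<bar>hq1 lam v x\<bar> \<le> \<bar>2 * r\<^sup>2 * (fst x \<bullet> fst v + fst (snd x) \<bullet> fst (snd v))\<bar> + \<bar>2 * (r\<^sup>2)\<^sup>2 * (snd (snd x) \<bullet> hw v x)\<bar>"
        unfolding hq1_def r(2) by (rule abs_triangle_ineq)
      also have "\<dots> = 2 * r\<^sup>2 * \<bar>fst x \<bullet> fst v + fst (snd x) \<bullet> fst (snd v)\<bar> + 2 * (r\<^sup>2)\<^sup>2 * \<bar>snd (snd x) \<bullet> hw v x\<bar>"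
        by (simp add: abs_mult)
      also have "\<dots> \<le> 2 * r\<^sup>2 * (A + B) + 2 * (r\<^sup>2)\<^sup>2 * (C * norm (hw v x))"
        using i i3 by (intro add_mono mult_left_mono) auto
      finally show ?thesis .
    qed
    also have "\<dots> = r * (2 * (r * A) + 2 * (r * B) + 2 * ((r\<^sup>2 * C) * (r * norm (hw v x))))"
      by (simp add: algebra_simps power2_eq_square)
    also have "\<dots> \<le> r * (2 * 1 + 2 * 1 + 2 * (1 * 1))"
      using b w r pos by (intro mult_left_mono add_mono mult_mono) auto
    finally have q1: "\<bar>hq1 lam v x\<bar> \<le> 6 * r" by simp
    have "hq2 lam v x = 2 * lam + 2 * lam * (r * norm (hw v x))\<^sup>2"
unfolding hq2_def nv(2) dot_square_norm[of "hw v x"] r(2)[symmetric]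
      by (simp add: power_mult_distrib power2_eq_square)
    moreover have "(r * norm (hw v x))\<^sup>2 \<le> 1" using w r by (intro power_le_one) auto
    ultimately have q2: "0 \<le> hq2 lam v x" "hq2 lam v x \<le> 4 * lam"
      using l by (auto simp: mult_le_cancel_left1)
    have m2: "m\<^sup>2 \<le> 1" using m by (intro power_le_one) auto
    have "\<bar>chi1 lam v x\<bar> = 3 * m\<^sup>2 * \<bar>hq1 lam v x\<bar>" using m by (simp add: chi1_def m_def[symmetric] abs_mult)
    also have "\<dots> \<le> 3 * 1 * (6 * r)" using m2 q1 by (intro mult_mono) auto
    finally have 1: "\<bar>chi1 lam v x\<bar> \<le> 18 * sqrt lam" by (simp add: r_def)
    have "(hq1 lam v x)\<^sup>2 \<le> (6 * r)\<^sup>2" using q1 by (metis power2_abs abs_ge_zero power_mono)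
    then have "(hq1 lam v x)\<^sup>2 \<le> 36 * lam" using r by (simp add: power_mult_distrib)
    then have "6 * m * (hq1 lam v x)\<^sup>2 \<le> 6 * 1 * (36 * lam)" using m by (intro mult_mono) auto
    moreover have "3 * m\<^sup>2 * hq2 lam v x \<le> 3 * 1 * (4 * lam)" using m2 q2 by (intro mult_mono) auto
    moreover have "0 \<le> 6 * m * (hq1 lam v x)\<^sup>2" "0 \<le> 3 * m\<^sup>2 * hq2 lam v x" using m q2 by auto
    moreover have "chi2 lam v x = 6 * m * (hq1 lam v x)\<^sup>2 - 3 * m\<^sup>2 * hq2 lam v x"
      by (simp add: chi2_def m_def[symmetric])
    ultimately have 2: "\<bar>chi2 lam v x\<bar> \<le> 228 * lam" by linarith
    from 1 2 show ?thesis by simp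
  qed
  then show "\<bar>chi1 lam v x\<bar> \<le> 18 * sqrt lam" "\<bar>chi2 lam v x\<bar> \<le> 228 * lam" by auto
qed

lemma HL_chi_bound: "0 < lam \<Longrightarrow> \<bar>HL (chi2 lam) x\<bar> \<le> 912 * lam"
proof -
  assume l: "0 < lam"
  have "\<bar>HL (chi2 lam) x\<bar> \<le> (\<Sum>v\<in>HD. \<bar>chi2 lam v x\<bar>)" unfolding HL_def by (rule sum_abs)
  also have "\<dots> \<le> (\<Sum>v\<in>HD. 228 * lam)" by (intro sum_mono chi_bounds l)
  finally show ?thesis by (simp add: card_HD)
qed

subsection \<open>Families of probability densities\<close>

text \<open>Abstracted from the heat kernel because the same estimates serve its reflection under
  inversion. The regularity in time is pointwise continuity only.\<close>

locale prob_family =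
  fixes r :: "real \<Rightarrow> H3 \<Rightarrow> real"
  assumes r_nonneg: "t > 0 \<Longrightarrow> 0 \<le> r t x"
    and r_cont: "t > 0 \<Longrightarrow> continuous_on UNIV (r t)"
    and r_integrable: "t > 0 \<Longrightarrow> integrable lborel (r t)"
    and r_integral: "t > 0 \<Longrightarrow> (\<integral>x. r t x \<partial>lborel) = 1"
    and r_isCont: "t > 0 \<Longrightarrow> isCont (\<lambda>t. r t x) t"
begin

lemma r_measurable [measurable]: "t > 0 \<Longrightarrow> r t \<in> borel_measurable borel"
  using r_cont by simp

lemma integrable_r_mult:
  assumes t: "t > 0" and [measurable]: "k \<in> borel_measurable borel" and k: "\<And>x. \<bar>k x\<bar> \<le> M"
  shows "integrable lborel (\<lambda>x. r t x * k x)"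
proof (rule Bochner_Integration.integrable_bound)
  show "integrable lborel (\<lambda>x. M * r t x)" using r_integrable[OF t] by simp
  show "AE x in lborel. norm (r t x * k x) \<le> norm (M * r t x)"
    using k r_nonneg[OF t] 
    by (auto simp: abs_mult mult.commute[of _ "r t _"] intro!: mult_left_mono order.trans[OF k] AE_I2)
  show "(\<lambda>x. r t x * k x) \<in> borel_measurable lborel" using t by measurable
qed

lemma integral_r_mult_mono:
  assumes t: "t > 0" and "k \<in> borel_measurable borel" "\<And>x. \<bar>k x\<bar> \<le> M" "j \<in> borel_measurable borel" "\<And>x. \<bar>j x\<bar> \<le> M'"
    and "\<And>x. k x \<le> j x"
  shows "(\<integral>x. r t x * k x \<partial>lborel) \<le> (\<integral>x. r t x * j x \<partial>lborel)"
  by (intro integral_mono integrable_r_mult[OF t, where M=M] integrable_r_mult[OF t, where M=M'] mult_left_mono assms r_nonneg)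

lemma integral_r_const: "t > 0 \<Longrightarrow> (\<integral>x. r t x * c \<partial>lborel) = c"
  using r_integral by simp

lemma integral_r_le:
  assumes t: "t > 0" and "k \<in> borel_measurable borel" "\<And>x. \<bar>k x\<bar> \<le> M" "\<And>x. k x \<le> c"
  shows "(\<integral>x. r t x * k x \<partial>lborel) \<le> c"
  using integral_r_mult_mono[OF t assms(2,3), of "\<lambda>x. c" "\<bar>c\<bar>"] assms(4) unfolding integral_r_const[OF t] by simp

lemma integral_r_ge:
  assumes t: "t > 0" and "k \<in> borel_measurable borel" "\<And>x. \<bar>k x\<bar> \<le> M" "\<And>x. c \<le> k x"
  shows "c \<le> (\<integral>x. r t x * k x \<partial>lborel)"
  using integral_r_mult_mono[OF t, of "\<lambda>x. c" "\<bar>c\<bar>" k M] assms unfolding integral_r_const[OF t] by simp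

lemma integral_r_abs_le:
  assumes t: "t > 0" and "k \<in> borel_measurable borel" "\<And>x. \<bar>k x\<bar> \<le> M"
  shows "\<bar>\<integral>x. r t x * k x \<partial>lborel\<bar> \<le> M"
proof -
  have "k x \<le> M" "- M \<le> k x" for x using assms(3)[of x] by auto
  then show ?thesis using integral_r_le[OF assms, of M] integral_r_ge[OF assms, of "-M"] by auto
qed

lemma continuous_integral_r:
  fixes k :: "'x::metric_space \<Rightarrow> H3 \<Rightarrow> real"
  assumes t: "t > 0" and m: "\<And>x. k x \<in> borel_measurable borel" and b: "\<And>x y. \<bar>k x y\<bar> \<le> M"
    and c: "\<And>y. continuous_on UNIV (\<lambda>x. k x y)"
  shows "continuous_on UNIV (\<lambda>x. \<integral>y. r t y * k x y \<partial>lborel)"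
  unfolding continuous_on_sequentially comp_def
proof safe
  fix X :: "nat \<Rightarrow> 'x" and x assume X: "X \<longlonglongrightarrow> x"
  note [measurable] = m
  show "(\<lambda>n. \<integral>y. r t y * k (X n) y \<partial>lborel) \<longlonglongrightarrow> (\<integral>y. r t y * k x y \<partial>lborel)"
  proof (rule integral_dominated_convergence[where w="\<lambda>y. M * r t y"])
    show "integrable lborel (\<lambda>y. M * r t y)" using r_integrable[OF t] by simp
    have "(\<lambda>n. k (X n) y) \<longlonglongrightarrow> k x y" for y
      using continuous_on_tendsto_compose[OF c X] by simp
    then show "AE y in lborel. (\<lambda>n. r t y * k (X n) y) \<longlonglongrightarrow> r t y * k x y"
      by (auto intro!: AE_I2 tendsto_intros)
    show "AE y in lborel. norm (r t y * k (X n) y) \<le> M * r t y" for n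
      using b r_nonneg[OF t] by (auto simp: abs_mult mult.commute[of M] intro!: AE_I2 mult_left_mono)
  qed (use t in measurable)
qed

text \<open>All densities have mass one, so by Scheffe's lemma pointwise convergence in time is
  convergence in L^1. This replaces domination of the densities and lets bounded test functions move
  together with the time.\<close>

lemma r_L1_convergence:
  assumes s: "s > 0" "\<And>n. X n > 0" "X \<longlonglongrightarrow> s"
    and m: "\<And>n. k n \<in> borel_measurable borel" "k0 \<in> borel_measurable borel" and b: "\<And>n x. \<bar>k n x\<bar> \<le> M"
    and c: "\<And>x. (\<lambda>n. k n x) \<longlonglongrightarrow> k0 x"
  shows "(\<lambda>n. \<integral>x. r (X n) x * k n x \<partial>lborel) \<longlonglongrightarrow> (\<integral>x. r s x * k0 x \<partial>lborel)"
proof -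
  note [measurable] = m
  have M: "0 \<le> M" using b[of 0 undefined] by linarith
  have ptw: "(\<lambda>n. r (X n) x) \<longlonglongrightarrow> r s x" for x
    using isCont_tendsto_compose[OF r_isCont[OF s(1)] s(3)] .
  have nn1: "(\<integral>\<^sup>+ x. ennreal (norm (r t x)) \<partial>lborel) = 1" if "t > 0" for t
    using nn_integral_eq_integral[OF r_integrable[OF that]] r_nonneg[OF that] r_integral[OF that] by simp
  have "(\<lambda>n. \<integral>\<^sup>+ x. norm (r (X n) x - r s x) \<partial>lborel) \<longlonglongrightarrow> 0"
    using s r_integrable[OF s(1)] nn1 ptw by (intro Scheffe_lemma2) auto
  moreover have "(\<integral>\<^sup>+ x. norm (r (X n) x - r s x) \<partial>lborel) = ennreal (\<integral>x. \<bar>r (X n) x - r s x\<bar> \<partial>lborel)" for n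
    using r_integrable[OF s(1)] r_integrable[OF s(2)]
    by (subst nn_integral_eq_integral) auto
  ultimately have L1: "(\<lambda>n. \<integral>x. \<bar>r (X n) x - r s x\<bar> \<partial>lborel) \<longlonglongrightarrow> 0"
    by (simp add: ennreal_tendsto_0_iff)
  have 1: "(\<lambda>n. \<integral>x. r s x * k n x \<partial>lborel) \<longlonglongrightarrow> (\<integral>x. r s x * k0 x \<partial>lborel)"
  proof (rule integral_dominated_convergence[where w="\<lambda>y. M * r s y"])
    show "integrable lborel (\<lambda>y. M * r s y)" using r_integrable[OF s(1)] by simp
    show "AE y in lborel. (\<lambda>n. r s y * k n y) \<longlonglongrightarrow> r s y * k0 y"
      using c by (auto intro!: AE_I2 tendsto_intros)
    show "AE y in lborel. norm (r s y * k n y) \<le> M * r s y" for n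
      using b r_nonneg[OF s(1)] by (auto simp: abs_mult mult.commute[of M] intro!: AE_I2 mult_left_mono)
  qed (use s in measurable)
  have 2: "norm ((\<integral>x. r (X n) x * k n x \<partial>lborel) - (\<integral>x. r s x * k n x \<partial>lborel)) \<le> M * (\<integral>x. \<bar>r (X n) x - r s x\<bar> \<partial>lborel)" for n
  proof -
    note i = integrable_r_mult[OF s(2) m(1) b] integrable_r_mult[OF s(1) m(1) b]
    have "(\<integral>x. r (X n) x * k n x \<partial>lborel) - (\<integral>x. r s x * k n x \<partial>lborel) = (\<integral>x. (r (X n) x - r s x) * k n x \<partial>lborel)"
      using i by (subst Bochner_Integration.integral_diff[symmetric]) (auto simp: algebra_simps)
    also have "norm \<dots> \<le> (\<integral>x. M * \<bar>r (X n) x - r s x\<bar> \<partial>lborel)"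
    proof (rule order.trans[OF integral_norm_bound], rule integral_mono)
      show "integrable lborel (\<lambda>x. norm ((r (X n) x - r s x) * k n x))"
        using integrable_norm[OF Bochner_Integration.integrable_diff[OF i(1)[of n n] i(2)[of n]]] by (simp add: algebra_simps)
      show "integrable lborel (\<lambda>x. M * \<bar>r (X n) x - r s x\<bar>)" using r_integrable s by auto
      show "norm ((r (X n) x - r s x) * k n x) \<le> M * \<bar>r (X n) x - r s x\<bar>" for x
        using mult_left_mono[OF b[of n x], of "\<bar>r (X n) x - r s x\<bar>"] by (simp add: abs_mult mult.commute)
    qed
    finally show ?thesis by simp
  qed
  have "(\<lambda>n. M * (\<integral>x. \<bar>r (X n) x - r s x\<bar> \<partial>lborel)) \<longlonglongrightarrow> 0" using tendsto_mult[OF tendsto_const L1, of M] by simp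
  then have "(\<lambda>n. (\<integral>x. r (X n) x * k n x \<partial>lborel) - (\<integral>x. r s x * k n x \<partial>lborel)) \<longlonglongrightarrow> 0"
    by (rule Lim_null_comparison[rotated]) (use 2 in auto)
  from tendsto_add[OF this 1] show ?thesis by simp
qed

lemma continuous_on_integral_r_time:
  assumes "k \<in> borel_measurable borel" "\<And>x. \<bar>k x\<bar> \<le> M"
  shows "continuous_on {0<..} (\<lambda>s. \<integral>x. r s x * k x \<partial>lborel)"
  unfolding continuous_on_sequentially comp_def using assms
  by (intro allI ballI impI r_L1_convergence[where M=M]) auto

end

subsection \<open>Small-time moments of the heat kernel\<close>

lemma compact_supp_bsupp:
  fixes f :: "H3 \<Rightarrow> 'b::real_normed_vector"
  shows "compact_supp f \<longleftrightarrow> bsupp f"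
proof
  assume "compact_supp f"
  then obtain R where "\<And>x. x \<in> closure {x. f x \<noteq> 0} \<Longrightarrow> norm x \<le> R"
    unfolding compact_supp_def by (meson compact_imp_bounded bounded_iff)
  then show "bsupp f" unfolding bsupp_def using closure_subset[of "{x. f x \<noteq> 0}"]
    by (metis (mono_tags, lifting) mem_Collect_eq not_le subsetD)
next
  assume "bsupp f"
  then obtain R where R: "\<And>x. R < norm x \<Longrightarrow> f x = 0" unfolding bsupp_def by blast
  have "{x. f x \<noteq> 0} \<subseteq> cball 0 R" using R by (force simp: not_le[symmetric])
  then show "compact_supp f" unfolding compact_supp_def
    by (meson bounded_cball bounded_subset compact_closure)
qed

locale heat =
  fixes \<rho> :: "real \<Rightarrow> H3 \<Rightarrow> real"
  assumes hk: "heat_kernel \<rho>"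
begin

lemma rho_smooth: "s > 0 \<Longrightarrow> smooth_fun (\<rho> s)" and rho_pos: "s > 0 \<Longrightarrow> \<rho> s x > 0"
  and rho_deriv: "s > 0 \<Longrightarrow> ((\<lambda>r. \<rho> r x) has_real_derivative (subLap (\<rho> s) x / 4)) (at s)"
  using hk unfolding heat_kernel_def by auto

lemma rho_Ck: "s > 0 \<Longrightarrow> Ck n (\<rho> s)"
  using rho_smooth smooth_fun_Ck by blast

lemma rho_cont: "s > 0 \<Longrightarrow> continuous_on UNIV (\<rho> s)"
  using rho_Ck Ck_continuous by blast

sublocale prob_family \<rho>
proof
  fix t :: real and x assume t: "t > 0"
  show "0 \<le> \<rho> t x" using rho_pos[OF t, of x] by simp
  show c: "continuous_on UNIV (\<rho> t)" by (rule rho_cont[OF t])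
  have m: "\<rho> t \<in> borel_measurable lborel" using c by simp
  have "integrable lebesgue (\<rho> t)" "integral\<^sup>L lebesgue (\<rho> t) = 1" using hk t unfolding heat_kernel_def by auto
  then show "integrable lborel (\<rho> t)" "(\<integral>x. \<rho> t x \<partial>lborel) = 1"
    using integrable_completion[OF m] integral_completion[OF m] by auto
  show "isCont (\<lambda>t. \<rho> t x) t" using rho_deriv[OF t, of x] by (rule DERIV_isCont)
qed

lemma rho_semigroup:
  assumes "s > 0" "t > 0"
  shows "\<rho> (s + t) x = (\<integral>z. \<rho> s z * \<rho> t (hmul (- z) x) \<partial>lborel)"
proof -
  have "continuous_on UNIV (\<lambda>z. \<rho> s z * \<rho> t (hmul (- z) x))"
    using assms by (intro continuous_intros rho_cont continuous_on_compose2[OF rho_cont[OF assms(2)]]) auto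
  then have "(\<lambda>z. \<rho> s z * \<rho> t (hmul (- z) x)) \<in> borel_measurable lborel" by simp
  from integral_completion[OF this] show ?thesis
    using hk assms unfolding heat_kernel_def hinv_def by auto
qed

text \<open>The integral of a non-integrable function is 0 by convention, whereas the semigroup law
  equates this one with a positive number.\<close>

lemma rho_semigroup_integrable:
  assumes "s > 0" "t > 0"
  shows "integrable lborel (\<lambda>z. \<rho> s z * \<rho> t (hmul (- z) x))"
proof (rule ccontr)
  assume "\<not> ?thesis"
  then have "\<rho> (s + t) x = 0" by (simp add: rho_semigroup assms not_integrable_integral_eq)
  then show False using rho_pos[of "s + t" x] assms by simp
qed

lemma rho_approx:
  assumes "continuous_on UNIV g" "bsupp (g :: H3 \<Rightarrow> real)"
  shows "((\<lambda>s. \<integral>y. \<rho> s y * g y \<partial>lborel) \<longlongrightarrow> g 0) (at_right 0)"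
proof -
  have "((\<lambda>s. \<integral>y. g y * \<rho> s y \<partial>lebesgue) \<longlongrightarrow> g 0) (at_right 0)"
    using hk assms unfolding heat_kernel_def compact_supp_bsupp by blast
  then show ?thesis
  proof (rule Lim_transform_eventually)
    have "(\<integral>y. g y * \<rho> s y \<partial>lebesgue) = (\<integral>y. \<rho> s y * g y \<partial>lborel)" if "s > 0" for s
    proof -
      have "(\<lambda>y. g y * \<rho> s y) \<in> borel_measurable lborel"
        using assms that rho_cont by (simp add: continuous_intros)
      from integral_completion[OF this] show ?thesis by (simp add: mult.commute)
    qed
    then show "\<forall>\<^sub>F s in at_right 0. (\<integral>y. g y * \<rho> s y \<partial>lebesgue) = (\<integral>y. \<rho> s y * g y \<partial>lborel)"
      by (auto simp: eventually_at_filter)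
  qed
qed

text \<open>The tail is dominated by mass one minus the integral of a tent function supported in the
  ball, and for tents convergence to the point mass is given.\<close>

lemma rho_tail:
  assumes r: "r > 0"
  shows "((\<lambda>s. \<integral>y. \<rho> s y * indicator {y. r < norm y} y \<partial>lborel) \<longlongrightarrow> 0) (at_right 0)"
proof -
  define g where "g y = max 0 (1 - norm y / r)" for y :: H3
  have gc: "continuous_on UNIV g" unfolding g_def using r by (intro continuous_intros) auto
  have g0: "g y = 0" if "r < norm y" for y using that r by (simp add: g_def max_def field_simps)
  have gs: "bsupp g" unfolding bsupp_def using g0 by blast
  have gb: "\<bar>g y\<bar> \<le> 1" for y using r by (auto simp: g_def max_def field_simps)
  have lim: "((\<lambda>s. 1 - (\<integral>y. \<rho> s y * g y \<partial>lborel)) \<longlongrightarrow> 0) (at_right 0)"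
    using tendsto_diff[OF tendsto_const[of 1] rho_approx[OF gc gs]] by (simp add: g_def)
  have le: "(\<integral>y. \<rho> s y * indicator {y. r < norm y} y \<partial>lborel) \<le> 1 - (\<integral>y. \<rho> s y * g y \<partial>lborel)"
     "0 \<le> (\<integral>y. \<rho> s y * indicator {y. r < norm y} y \<partial>lborel)" if s: "s > 0" for s
  proof -
    have m: "(indicator {y. r < norm y} :: H3 \<Rightarrow> real) \<in> borel_measurable borel" by simp
    have "(\<integral>y. \<rho> s y * indicator {y. r < norm y} y \<partial>lborel) \<le> (\<integral>y. \<rho> s y * (1 - g y) \<partial>lborel)"
      using gc gb g0 by (intro integral_r_mult_mono[OF s, where M=1 and M'=2])
        (auto simp: indicator_def g_def abs_le_iff intro: order.trans)
    also have "\<dots> = 1 - (\<integral>y. \<rho> s y * g y \<partial>lborel)"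
      using integrable_r_mult[OF s _ gb] gc r_integrable[OF s] r_integral[OF s]
      by (simp add: right_diff_distrib)
    finally show "(\<integral>y. \<rho> s y * indicator {y. r < norm y} y \<partial>lborel) \<le> 1 - (\<integral>y. \<rho> s y * g y \<partial>lborel)" .
    show "0 \<le> (\<integral>y. \<rho> s y * indicator {y. r < norm y} y \<partial>lborel)"
      using r_nonneg[OF s] by (intro Bochner_Integration.integral_nonneg) auto
  qed
  show ?thesis
    by (rule tendsto_sandwich[OF _ _ tendsto_const lim]) (auto simp: eventually_at_filter le)
qed

lemma rho_small_time:
  assumes "\<epsilon> > 0" and M: "M > 0" and r: "r > 0"
  obtains s0 where "s0 > 0" "\<And>s k \<eta>. 0 < s \<Longrightarrow> s < s0 \<Longrightarrow> k \<in> borel_measurable borel \<Longrightarrow> (\<And>y. \<bar>k y\<bar> \<le> M)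
    \<Longrightarrow> (\<And>y. norm y \<le> r \<Longrightarrow> \<bar>k y - c\<bar> \<le> \<eta>) \<Longrightarrow> \<bar>(\<integral>y. \<rho> s y * k y \<partial>lborel) - c\<bar> \<le> \<eta> + \<epsilon>"
proof -
  \<comment> \<open>Off the ball the distance from \<open>k\<close> to \<open>c\<close> is at most M
    + |c|, so this much tail mass costs \<epsilon>.\<close>
  let ?e = "\<epsilon> / (M + \<bar>c\<bar>)"
  have e: "?e > 0" using assms by auto
  have "\<forall>\<^sub>F s in at_right 0. (\<integral>y. \<rho> s y * indicator {y. r < norm y} y \<partial>lborel) < ?e"
    by (rule order_tendstoD(2)[OF rho_tail[OF r] e])
  then obtain s0 where s0: "s0 > 0" "\<And>s. 0 < s \<Longrightarrow> s < s0 \<Longrightarrow> (\<integral>y. \<rho> s y * indicator {y. r < norm y} y \<partial>lborel) < ?e"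
    unfolding eventually_at_right_field by auto
  show ?thesis
  proof (rule that[OF s0(1)])
    fix s and k :: "H3 \<Rightarrow> real" and \<eta> assume s: "0 < s" "s < s0" and k [measurable]: "k \<in> borel_measurable borel" and kM: "\<And>y. \<bar>k y\<bar> \<le> M"
      and kc: "\<And>y. norm y \<le> r \<Longrightarrow> \<bar>k y - c\<bar> \<le> \<eta>"
    have \<eta>: "0 \<le> \<eta>" using kc[of 0] r by auto
    have km: "\<bar>k y - c\<bar> \<le> \<eta> + (M + \<bar>c\<bar>) * indicator {y. r < norm y} y" for y
      using kc[of y] kM[of y] \<eta> by (auto simp: indicator_def)
    have kb: "\<bar>k y - c\<bar> \<le> M + \<bar>c\<bar>" for y using kM[of y] by auto
    have ib: "\<bar>\<eta> + (M + \<bar>c\<bar>) * indicator {y. r < norm y} y\<bar> \<le> \<eta> + (M + \<bar>c\<bar>)" for y :: H3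
      using \<eta> M by (auto simp: indicator_def)
    have "(\<integral>y. \<rho> s y * k y \<partial>lborel) - c = (\<integral>y. \<rho> s y * (k y - c) \<partial>lborel)"
      using integrable_r_mult[OF s(1) k kM] r_integrable[OF s(1)] r_integral[OF s(1)] by (simp add: right_diff_distrib)
    also have "\<bar>\<dots>\<bar> \<le> (\<integral>y. \<rho> s y * \<bar>k y - c\<bar> \<partial>lborel)"
      using integral_abs_bound[of lborel "\<lambda>y. \<rho> s y * (k y - c)"] r_nonneg[OF s(1)] by (simp add: abs_mult)
    also have "\<dots> \<le> (\<integral>y. \<rho> s y * (\<eta> + (M + \<bar>c\<bar>) * indicator {y. r < norm y} y) \<partial>lborel)"
      using km kb ib by (intro integral_r_mult_mono[OF s(1)]) auto
    also have "\<dots> = \<eta> + (M + \<bar>c\<bar>) * (\<integral>y. \<rho> s y * indicator {y. r < norm y} y \<partial>lborel)"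
    proof -
      have "integrable lborel (\<lambda>y. \<rho> s y * indicator {y. r < norm y} y)"
        by (rule integrable_r_mult[OF s(1), where M=1]) (auto simp: indicator_def)
      then show ?thesis using r_integrable[OF s(1)] r_integral[OF s(1)]
        by (simp add: distrib_left mult.left_commute[of _ "M + \<bar>c\<bar>"])
    qed
    also have "\<dots> \<le> \<eta> + (M + \<bar>c\<bar>) * ?e" using s0(2)[OF s] M by (intro add_left_mono mult_left_mono) auto
    also have "\<dots> = \<eta> + \<epsilon>" using M by simp
    finally show "\<bar>(\<integral>y. \<rho> s y * k y \<partial>lborel) - c\<bar> \<le> \<eta> + \<epsilon>" .
  qed
qed

lemma rho_approx_bounded:
  assumes c: "continuous_on UNIV g" and b: "\<And>x. \<bar>g x\<bar> \<le> M"
  shows "((\<lambda>s. \<integral>y. \<rho> s y * g y \<partial>lborel) \<longlongrightarrow> g 0) (at_right 0)"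
  unfolding tendsto_iff
proof (intro allI impI)
  fix e :: real assume e: "e > 0"
  obtain d where d: "d > 0" "\<And>y. norm y < d \<Longrightarrow> \<bar>g y - g 0\<bar> < e / 3"
    using c[unfolded continuous_on_iff, rule_format, of 0 "e/3"] e by (auto simp: dist_real_def)
  obtain s0 where s0: "s0 > 0" "\<And>s k \<eta>. 0 < s \<Longrightarrow> s < s0 \<Longrightarrow> k \<in> borel_measurable borel \<Longrightarrow> (\<And>y. \<bar>k y\<bar> \<le> \<bar>M\<bar> + 1)
    \<Longrightarrow> (\<And>y. norm y \<le> d/2 \<Longrightarrow> \<bar>k y - g 0\<bar> \<le> \<eta>) \<Longrightarrow> \<bar>(\<integral>y. \<rho> s y * k y \<partial>lborel) - g 0\<bar> \<le> \<eta> + e/3"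
    by (rule rho_small_time[of "e/3" "\<bar>M\<bar> + 1" "d/2" "g 0"]) (use e d(1) in simp_all)
  have "\<bar>(\<integral>y. \<rho> s y * g y \<partial>lborel) - g 0\<bar> < e" if "0 < s" "s < s0" for s
  proof -
    have "\<bar>(\<integral>y. \<rho> s y * g y \<partial>lborel) - g 0\<bar> \<le> e/3 + e/3"
    proof (rule s0(2)[OF that])
      show "g \<in> borel_measurable borel" using c by simp
      show "\<bar>g y\<bar> \<le> \<bar>M\<bar> + 1" for y using b[of y] by linarith
      show "\<bar>g y - g 0\<bar> \<le> e / 3" if "norm y \<le> d / 2" for y using d(2)[of y] that d(1) by simp
    qed
    then show ?thesis using e by simp
  qed
  then show "\<forall>\<^sub>F s in at_right 0. dist (\<integral>y. \<rho> s y * g y \<partial>lborel) (g 0) < e"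
    unfolding eventually_at_right_field dist_real_def using s0(1) by auto
qed

text \<open>Tonelli and the change of variables w = z y. Nonnegativity of \<open>g\<close> lets the
  exchange take place before any integrability on the product is known.\<close>

lemma rho_semigroup_integral:
  assumes s: "s > 0" and t: "t > 0" and c: "continuous_on UNIV g" and b: "\<And>x. 0 \<le> g x \<and> g x \<le> M"
  shows "(\<integral>w. \<rho> (s + t) w * g w \<partial>lborel) = (\<integral>z. \<rho> s z * (\<integral>y. \<rho> t y * g (hmul z y) \<partial>lborel) \<partial>lborel)"
proof -
  have ab: "\<bar>g x\<bar> \<le> M" for x using b[of x] by auto
  have st: "s + t > 0" using s t by simp
  note [measurable] = r_measurable[OF s] r_measurable[OF t] r_measurable[OF st]
  have gm [measurable]: "g \<in> borel_measurable borel" using c by simp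
  have ci: "continuous_on UNIV (\<lambda>z. \<integral>y. \<rho> t y * g (hmul z y) \<partial>lborel)"
  proof (rule continuous_integral_r[OF t _ ab])
    show "(\<lambda>y. g (hmul x y)) \<in> borel_measurable borel" for x by measurable
    show "continuous_on UNIV (\<lambda>x. g (hmul x y))" for y
      by (intro continuous_on_compose2[OF c] continuous_intros) auto
  qed
  have bi: "0 \<le> (\<integral>y. \<rho> t y * g (hmul z y) \<partial>lborel)" "\<bar>\<integral>y. \<rho> t y * g (hmul z y) \<partial>lborel\<bar> \<le> M" for z
    using b r_nonneg[OF t] by (simp add: Bochner_Integration.integral_nonneg, intro integral_r_abs_le[OF t _ ab]) simp
  have "ennreal (\<integral>w. \<rho> (s + t) w * g w \<partial>lborel) = (\<integral>\<^sup>+w. ennreal (\<rho> (s + t) w * g w) \<partial>lborel)"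
    using integrable_r_mult[OF st gm ab] b r_nonneg[OF st] by (subst nn_integral_eq_integral) auto
  also have "\<dots> = (\<integral>\<^sup>+w. \<integral>\<^sup>+z. ennreal (\<rho> s z * \<rho> t (hmul (- z) w) * g w) \<partial>lborel \<partial>lborel)"
  proof (rule nn_integral_cong)
    fix w
    have "(\<integral>\<^sup>+z. ennreal (\<rho> s z * \<rho> t (hmul (- z) w) * g w) \<partial>lborel) = (\<integral>\<^sup>+z. ennreal (\<rho> s z * \<rho> t (hmul (- z) w)) * ennreal (g w) \<partial>lborel)"
      using b r_nonneg s t by (intro nn_integral_cong ennreal_mult) auto
    also have "\<dots> = (\<integral>\<^sup>+z. ennreal (\<rho> s z * \<rho> t (hmul (- z) w)) \<partial>lborel) * ennreal (g w)"
      by (rule nn_integral_multc) measurable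
    also have "(\<integral>\<^sup>+z. ennreal (\<rho> s z * \<rho> t (hmul (- z) w)) \<partial>lborel) = ennreal (\<rho> (s + t) w)"
      unfolding rho_semigroup[OF s t] using r_nonneg s t
      by (intro nn_integral_eq_integral rho_semigroup_integrable) auto
    finally show "ennreal (\<rho> (s + t) w * g w) = (\<integral>\<^sup>+z. ennreal (\<rho> s z * \<rho> t (hmul (- z) w) * g w) \<partial>lborel)"
      using b r_nonneg[OF st] by (simp add: ennreal_mult)
  qed
  also have "\<dots> = (\<integral>\<^sup>+z. \<integral>\<^sup>+w. ennreal (\<rho> s z * \<rho> t (hmul (- z) w) * g w) \<partial>lborel \<partial>lborel)"
  proof (rule lborel_pair.Fubini')
    have "continuous_on UNIV (\<lambda>p. \<rho> s (fst p) * \<rho> t (hmul (- fst p) (snd p)) * g (snd p))"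
      by (intro continuous_intros continuous_on_compose2[OF c] continuous_on_compose2[OF rho_cont[OF t]]
          continuous_on_compose2[OF rho_cont[OF s]]) auto
    then have "(\<lambda>p. ennreal (\<rho> s (fst p) * \<rho> t (hmul (- fst p) (snd p)) * g (snd p))) \<in> borel_measurable borel"
      by (intro measurable_compose[OF continuous_imp_borel measurable_ennreal])
    then show "(\<lambda>(z, w). ennreal (\<rho> s z * \<rho> t (hmul (- z) w) * g w)) \<in> borel_measurable (lborel \<Otimes>\<^sub>M lborel)"
      by (simp add: lborel_prod case_prod_beta)
  qed
  also have "\<dots> = (\<integral>\<^sup>+z. \<integral>\<^sup>+y. ennreal (\<rho> s z * \<rho> t y * g (hmul z y)) \<partial>lborel \<partial>lborel)"
  proof (rule nn_integral_cong)
    fix z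
    have "(\<integral>\<^sup>+w. ennreal (\<rho> s z * \<rho> t (hmul (- z) w) * g w) \<partial>lborel)
      = (\<integral>\<^sup>+w. ennreal (\<rho> s z * \<rho> t (hmul (- z) w) * g w) \<partial>distr lborel borel (hmul z))"
      by (simp add: distr_hmul_left)
    also have "\<dots> = (\<integral>\<^sup>+y. ennreal (\<rho> s z * \<rho> t y * g (hmul z y)) \<partial>lborel)"
      by (subst nn_integral_distr) auto
    finally show "(\<integral>\<^sup>+w. ennreal (\<rho> s z * \<rho> t (hmul (- z) w) * g w) \<partial>lborel) = (\<integral>\<^sup>+y. ennreal (\<rho> s z * \<rho> t y * g (hmul z y)) \<partial>lborel)" .
  qed
  also have "\<dots> = (\<integral>\<^sup>+z. ennreal (\<rho> s z * (\<integral>y. \<rho> t y * g (hmul z y) \<partial>lborel)) \<partial>lborel)"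
  proof (rule nn_integral_cong)
    fix z
    have i: "integrable lborel (\<lambda>y. \<rho> t y * g (hmul z y))" by (rule integrable_r_mult[OF t _ ab]) measurable
    have "(\<integral>\<^sup>+y. ennreal (\<rho> s z * \<rho> t y * g (hmul z y)) \<partial>lborel) = (\<integral>\<^sup>+y. ennreal (\<rho> s z) * ennreal (\<rho> t y * g (hmul z y)) \<partial>lborel)"
      using b r_nonneg s t by (intro nn_integral_cong) (simp add: ennreal_mult mult.assoc)
    also have "\<dots> = ennreal (\<rho> s z) * (\<integral>\<^sup>+y. ennreal (\<rho> t y * g (hmul z y)) \<partial>lborel)"
      by (rule nn_integral_cmult) measurable
    also have "(\<integral>\<^sup>+y. ennreal (\<rho> t y * g (hmul z y)) \<partial>lborel) = ennreal (\<integral>y. \<rho> t y * g (hmul z y) \<partial>lborel)"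
      using i b r_nonneg[OF t] by (intro nn_integral_eq_integral) auto
    finally show "(\<integral>\<^sup>+y. ennreal (\<rho> s z * \<rho> t y * g (hmul z y)) \<partial>lborel) = ennreal (\<rho> s z * (\<integral>y. \<rho> t y * g (hmul z y) \<partial>lborel))"
      using bi r_nonneg[OF s] by (simp add: ennreal_mult)
  qed
  also have "\<dots> = ennreal (\<integral>z. \<rho> s z * (\<integral>y. \<rho> t y * g (hmul z y) \<partial>lborel) \<partial>lborel)"
    using bi r_nonneg[OF s] ci by (intro nn_integral_eq_integral integrable_r_mult[OF s _ bi(2)]) auto
  finally show ?thesis
    using b bi r_nonneg[OF st] r_nonneg[OF s] by (subst (asm) ennreal_inj) (auto intro!: Bochner_Integration.integral_nonneg)
qed

end

section \<open>Moment bounds linear in time\<close>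

lemma norm_hmul_diff: "norm (hmul x y - x) \<le> norm y + norm x * norm y"
  using norm_triangle_ineq[of y "hbr x y"] norm_hbr_le[of x y] by (simp add: hmul_hbr)

text \<open>The maximum at the identity is strict and exactly quadratic, which the moment argument
  exploits; compact support and Lipschitz continuity make the averages converge uniformly.\<close>

definition hbump :: "H3 \<Rightarrow> real" where "hbump y = max 0 (1 - (norm y)\<^sup>2)"

lemma hbump_range: "0 \<le> hbump y" "hbump y \<le> 1" "\<bar>hbump y\<bar> \<le> 1"
  by (auto simp: hbump_def)

lemma hbump_cont: "continuous_on UNIV hbump"
  unfolding hbump_def by (intro continuous_intros)

lemma hbump_eq: "norm y \<le> 1 \<Longrightarrow> hbump y = 1 - (norm y)\<^sup>2"
  by (simp add: hbump_def power_le_one)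

lemma hbump_lipschitz: "\<bar>hbump a - hbump b\<bar> \<le> 2 * norm (a - b)"
proof -
  have h: "hbump y = 1 - (min 1 (norm y))\<^sup>2" for y
  proof (cases "norm y \<le> 1")
    case True then show ?thesis by (simp add: hbump_eq)
  next
    case False
    then have "1 \<le> (norm y)\<^sup>2" by (intro one_le_power) simp
    then show ?thesis using False by (simp add: hbump_def)
  qed
  let ?a = "min 1 (norm a)" and ?b = "min 1 (norm b)"
  have "hbump a - hbump b = (?b - ?a) * (?a + ?b)"
    unfolding h by (simp only: power2_eq_square algebra_simps)
  then have "\<bar>hbump a - hbump b\<bar> = \<bar>?a - ?b\<bar> * (?a + ?b)"
    by (simp only: abs_mult abs_minus_commute) (simp add: min_def)
  also have "\<dots> \<le> norm (a - b) * 2"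
    using norm_triangle_ineq3[of a b] by (intro mult_mono) (auto simp: min_def)
  finally show ?thesis by simp
qed

text \<open>Right multiplication by \<open>y\<close> may displace \<open>x\<close> by |y| + |x| |y|,
  which is unbounded in \<open>x\<close>; but for |x| > 3 both values vanish.\<close>

lemma hbump_translate:
  assumes y: "norm y \<le> 1/4"
  shows "\<bar>hbump (hmul x y) - hbump x\<bar> \<le> 8 * norm y"
proof (cases "norm x > 3")
  case True
  have "norm x * norm y \<le> norm x * (1/4)" using y by (intro mult_left_mono) auto
  then have "norm (hmul x y) \<ge> 1" using norm_triangle_ineq3[of "hmul x y" x] norm_hmul_diff[of x y] y True
    by linarith
  then have "1 \<le> (norm (hmul x y))\<^sup>2" "1 \<le> (norm x)\<^sup>2" using True by (auto intro: one_le_power)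
  then have "hbump (hmul x y) = 0" "hbump x = 0" by (auto simp: hbump_def)
  then show ?thesis by simp
next
  case False
  then have "norm x * norm y \<le> 3 * norm y" by (intro mult_right_mono) auto
  then show ?thesis using hbump_lipschitz[of "hmul x y" x] norm_hmul_diff[of x y] by linarith
qed

context heat
begin

text \<open>Averages of the bump over right translates. Time 0 has its own clause so that the
  telescoping Cesaro sum can start there.\<close>

definition Tg :: "real \<Rightarrow> H3 \<Rightarrow> real" where
  "Tg t x = (if t = 0 then hbump x else \<integral>y. \<rho> t y * hbump (hmul x y) \<partial>lborel)"

lemma Tg_range: "t \<ge> 0 \<Longrightarrow> 0 \<le> Tg t x" "t \<ge> 0 \<Longrightarrow> Tg t x \<le> 1"
proof -
  have m: "(\<lambda>y. hbump (hmul x y)) \<in> borel_measurable borel"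
    by (intro continuous_imp_borel continuous_on_compose2[OF hbump_cont] continuous_intros) auto
  show "t \<ge> 0 \<Longrightarrow> 0 \<le> Tg t x" "t \<ge> 0 \<Longrightarrow> Tg t x \<le> 1"
    using integral_r_le[OF _ m hbump_range(3) hbump_range(2), of t] integral_r_ge[OF _ m hbump_range(3) hbump_range(1), of t]
    by (auto simp: Tg_def hbump_range)
qed

lemma Tg_cont: "t \<ge> 0 \<Longrightarrow> continuous_on UNIV (Tg t)"
proof -
  assume "t \<ge> 0"
  show ?thesis
  proof (cases "t = 0")
    case True then show ?thesis using hbump_cont by (simp add: Tg_def[abs_def])
  next
    case False
    then have t: "t > 0" using \<open>t \<ge> 0\<close> by simp
    have "continuous_on UNIV (\<lambda>x. \<integral>y. \<rho> t y * hbump (hmul x y) \<partial>lborel)"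
    proof (rule continuous_integral_r[OF t _ hbump_range(3)])
      show "(\<lambda>y. hbump (hmul x y)) \<in> borel_measurable borel" for x
        by (intro continuous_imp_borel continuous_on_compose2[OF hbump_cont] continuous_intros) auto
      show "continuous_on UNIV (\<lambda>x. hbump (hmul x y))" for y
        by (intro continuous_on_compose2[OF hbump_cont] continuous_intros) auto
    qed
    then show ?thesis using t by (simp add: Tg_def[abs_def])
  qed
qed

lemma Tg_semigroup:
  assumes d: "d > 0" and t: "t \<ge> 0"
  shows "(\<integral>y. \<rho> d y * Tg t (hmul x y) \<partial>lborel) = Tg (d + t) x"
proof (cases "t = 0")
  case True then show ?thesis using d by (simp add: Tg_def)
next
  case False
  then have t: "t > 0" using t by simp
  have "continuous_on UNIV (\<lambda>y. hbump (hmul x y))"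
    by (intro continuous_on_compose2[OF hbump_cont] continuous_intros) auto
  from rho_semigroup_integral[OF d t this, of 1]
  show ?thesis using d t hbump_range by (simp add: Tg_def hmul_assoc)
qed

lemma Tg_uniform:
  assumes "\<eta> > 0"
  obtains e0 where "e0 > 0" "\<And>t x. 0 \<le> t \<Longrightarrow> t \<le> e0 \<Longrightarrow> \<bar>Tg t x - hbump x\<bar> \<le> \<eta>"
proof -
  \<comment> \<open>Inside this radius the bump changes by at most 8 * (\<eta>/16); the tail mass
    supplies the other half of \<eta>.\<close>
  let ?r = "min (1/4) (\<eta>/16)"
  have "\<forall>\<^sub>F s in at_right 0. (\<integral>y. \<rho> s y * indicator {y. ?r < norm y} y \<partial>lborel) < \<eta>/2"
    using assms by (intro order_tendstoD(2)[OF rho_tail]) auto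
  then obtain s0 where s0: "s0 > 0" "\<And>s. 0 < s \<Longrightarrow> s < s0 \<Longrightarrow> (\<integral>y. \<rho> s y * indicator {y. ?r < norm y} y \<partial>lborel) < \<eta>/2"
    unfolding eventually_at_right_field by auto
  have "\<bar>Tg t x - hbump x\<bar> \<le> \<eta>" if t: "0 \<le> t" "t \<le> s0/2" for t x
  proof (cases "t = 0")
    case True then show ?thesis using assms by (simp add: Tg_def)
  next
    case False
    then have t0: "t > 0" using t by simp
    have m [measurable]: "(\<lambda>y. hbump (hmul x y)) \<in> borel_measurable borel"
      by (intro continuous_imp_borel continuous_on_compose2[OF hbump_cont] continuous_intros) auto
    have k: "\<bar>hbump (hmul x y) - hbump x\<bar> \<le> \<eta>/2 + indicator {y. ?r < norm y} y" for y
    proof (cases "norm y \<le> ?r")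
      case True then show ?thesis using hbump_translate[of y x] assms by (auto simp: indicator_def)
    next
      case False
      have "\<bar>hbump (hmul x y) - hbump x\<bar> \<le> 1" using hbump_range(1,2)[of x] hbump_range(1,2)[of "hmul x y"] by linarith
      then show ?thesis using False assms by (auto simp: indicator_def)
    qed
    have k1: "\<bar>\<bar>hbump (hmul x y) - hbump x\<bar>\<bar> \<le> 1" for y
      using hbump_range(1,2)[of x] hbump_range(1,2)[of "hmul x y"] by linarith
    have i1: "\<bar>\<eta>/2 + indicator {y. ?r < norm y} y\<bar> \<le> \<eta>/2 + 1" for y :: H3 using assms by (auto simp: indicator_def)
    have "Tg t x - hbump x = (\<integral>y. \<rho> t y * (hbump (hmul x y) - hbump x) \<partial>lborel)"
      using False integrable_r_mult[OF t0 m hbump_range(3)] r_integrable[OF t0] r_integral[OF t0]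
      by (simp add: Tg_def right_diff_distrib)
    also have "\<bar>\<dots>\<bar> \<le> (\<integral>y. \<rho> t y * \<bar>hbump (hmul x y) - hbump x\<bar> \<partial>lborel)"
      using integral_abs_bound[of lborel "\<lambda>y. \<rho> t y * (hbump (hmul x y) - hbump x)"] r_nonneg[OF t0] by (simp add: abs_mult)
    also have "\<dots> \<le> (\<integral>y. \<rho> t y * (\<eta>/2 + indicator {y. ?r < norm y} y) \<partial>lborel)"
      by (intro integral_r_mult_mono[OF t0 _ k1 _ i1] k) measurable
    also have "\<dots> = \<eta>/2 + (\<integral>y. \<rho> t y * indicator {y. ?r < norm y} y \<partial>lborel)"
    proof -
      have "integrable lborel (\<lambda>y. \<rho> t y * indicator {y. ?r < norm y} y)"
        by (rule integrable_r_mult[OF t0, where M=1]) (auto simp: indicator_def)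
      then show ?thesis using r_integrable[OF t0] r_integral[OF t0] by (simp add: distrib_left)
    qed
    also have "\<dots> \<le> \<eta>" using s0(2)[OF t0] t s0(1) by simp
    finally show ?thesis .
  qed
  then show ?thesis using that[of "s0/2"] s0(1) by auto
qed

text \<open>Moment bounds of the kind occurring in Hunt's theorem. The Cesaro mean \<open>F\<close> of the functions
  \<open>T\<^bsub>k d\<^esub> g\<close>, \<open>k < N\<close>, \<open>N d \<approx> e0\<close>, is uniformly close to \<open>g\<close>, and \<open>T\<^sub>d F - F\<close> telescopes to
  \<open>O(d)\<close>. Maximising \<open>F + |y|\<^sup>2/2 + s \<langle>e, y\<rangle>\<close> provides a point \<open>y0\<close> where \<open>F\<close> is touched from above by
  a concave paraboloid of slope about \<open>- 2 s e\<close>; evaluating \<open>T\<^sub>d F - F\<close> there, with \<open>e\<close> the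
  direction of the truncated mean, bounds all three quantities at once.\<close>

lemma hunt_bounds:
  obtains C e0 where "e0 > 0" "C > 0"
    "\<And>d. 0 < d \<Longrightarrow> d < e0 \<Longrightarrow> (\<integral>y. \<rho> d y * indicator {y. 1/2 < norm y} y \<partial>lborel) \<le> C * d"
    "\<And>d. 0 < d \<Longrightarrow> d < e0 \<Longrightarrow> (\<integral>y. \<rho> d y * (indicator (cball 0 (1/2)) y * (norm y)\<^sup>2) \<partial>lborel) \<le> C * d"
    "\<And>d. 0 < d \<Longrightarrow> d < e0 \<Longrightarrow> norm (\<integral>y. (\<rho> d y * indicator (cball 0 (1/2)) y) *\<^sub>R y \<partial>lborel) \<le> C * d"
proof -
  \<comment> \<open>An error \<delta> in F at each of the two points compared below yields |y0 -
    e/8|^2 \<le> 4 \<delta>; for \<delta> = 1/16384 this is (1/64)^2.\<close>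
  obtain e0 where e0: "e0 > 0" "\<And>t x. 0 \<le> t \<Longrightarrow> t \<le> e0 \<Longrightarrow> \<bar>Tg t x - hbump x\<bar> \<le> 1/16384"
    by (rule Tg_uniform[of "1/16384"]) auto
  define V where "V = cball (0::H3) (1/2)"
  have key: "(\<integral>y. \<rho> d y * indicator {y. 1/2 < norm y} y \<partial>lborel) / 32
      + (\<integral>y. \<rho> d y * (indicator V y * (norm y)\<^sup>2) \<partial>lborel) / 8
      + norm (\<integral>y. (\<rho> d y * indicator V y) *\<^sub>R y \<partial>lborel) / 8 \<le> 2 * d / e0"
    if d: "0 < d" "d < e0" for d
  proof -
    \<comment> \<open>The largest number of steps of length \<open>d\<close> within time
      \<open>e0\<close>. It is at least 1, so rounding costs a factor 2 at most.\<close>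
    define N where "N = nat \<lfloor>e0 / d\<rfloor>"
    have "1 \<le> e0 / d" using d by simp
    then have "1 \<le> \<lfloor>e0 / d\<rfloor>" by (simp add: le_floor_iff)
    then have rN: "real N = of_int \<lfloor>e0 / d\<rfloor>" and N1: "real N \<ge> 1" by (simp_all add: N_def)
    have NU: "real N \<le> e0 / d" and NL: "e0 / d < real N + 1" unfolding rN by linarith+
    have N: "N > 0" using N1 by simp
    have Nd: "real N * d \<le> e0" using NU d by (simp add: field_simps)
    have "e0 / d \<le> 2 * real N" using NL N1 by linarith
    then have Ninv: "1 / real N \<le> 2 * d / e0" using d e0 N1 by (simp add: field_simps)
    define F where "F x = (\<Sum>k<N. Tg (real k * d) x) / real N" for x
    have kd: "0 \<le> real k * d" "k < N \<Longrightarrow> real k * d \<le> e0" for k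
    proof -
      show "0 \<le> real k * d" using d by simp
      show "k < N \<Longrightarrow> real k * d \<le> e0" using Nd d mult_right_mono[of "real k" "real N" d] by linarith
    qed
    have Fc: "continuous_on UNIV F" unfolding F_def using N kd
      by (intro continuous_intros Tg_cont) auto
    have Fg: "\<bar>F x - hbump x\<bar> \<le> 1/16384" for x
    proof -
      have "F x - hbump x = (\<Sum>k<N. Tg (real k * d) x - hbump x) / real N"
        using N by (simp add: F_def sum_subtractf field_simps)
      also have "\<bar>\<dots>\<bar> \<le> (\<Sum>k<N. \<bar>Tg (real k * d) x - hbump x\<bar>) / real N"
        using N by (simp add: abs_divide divide_right_mono)
      also have "\<dots> \<le> (\<Sum>k<N. 1/16384) / real N"
        using kd e0(2) by (intro divide_right_mono sum_mono) auto
      finally show ?thesis using N by simp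
    qed
    have Fb: "\<bar>F x\<bar> \<le> 2" for x using Fg[of x] hbump_range(1,2)[of x] by linarith
    \<comment> \<open>The values of \<open>Tg\<close> lie in [0, 1], so the two ends that survive
      telescoping differ by at most 1 before division by N.\<close>
    have TF: "- (1 / real N) \<le> (\<integral>y. \<rho> d y * F (hmul x y) \<partial>lborel) - F x" for x
    proof -
      have i: "integrable lborel (\<lambda>y. \<rho> d y * Tg (real k * d) (hmul x y))" for k
      proof (rule integrable_r_mult[OF d(1)])
        show "(\<lambda>y. Tg (real k * d) (hmul x y)) \<in> borel_measurable borel"
          by (intro continuous_imp_borel continuous_on_compose2[OF Tg_cont[OF kd(1)]] continuous_intros) auto
        show "\<bar>Tg (real k * d) (hmul x y)\<bar> \<le> 1" for y using Tg_range[OF kd(1)] by simp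
      qed
      have "(\<integral>y. \<rho> d y * F (hmul x y) \<partial>lborel) = (\<integral>y. (\<Sum>k<N. \<rho> d y * Tg (real k * d) (hmul x y)) / real N \<partial>lborel)"
        by (simp add: F_def sum_distrib_left)
      also have "\<dots> = (\<Sum>k<N. \<integral>y. \<rho> d y * Tg (real k * d) (hmul x y) \<partial>lborel) / real N"
        by (simp add: Bochner_Integration.integral_sum[OF i])
      also have "\<dots> = (\<Sum>k<N. Tg (real (Suc k) * d) x) / real N"
        unfolding Tg_semigroup[OF d(1) kd(1)] by (simp add: algebra_simps)
      finally have "(\<integral>y. \<rho> d y * F (hmul x y) \<partial>lborel) - F x = (\<Sum>k<N. Tg (real (Suc k) * d) x - Tg (real k * d) x) / real N"
        by (simp add: F_def sum_subtractf diff_divide_distrib)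
      also have "\<dots> = (Tg (real N * d) x - Tg 0 x) / real N"
        using sum_lessThan_telescope[of "\<lambda>k. Tg (real k * d) x" N] by simp
      also have "\<dots> \<ge> - 1 / real N"
        using Tg_range(1)[OF kd(1)[of N], of x] Tg_range(2)[of 0 x] by (intro divide_right_mono) auto
      finally show ?thesis by simp
    qed
    define b where "b = (\<integral>y. (\<rho> d y * indicator V y) *\<^sub>R y \<partial>lborel)"
    \<comment> \<open>Testing the truncated mean against this direction recovers its norm;
      \<open>sgn 0 = 0\<close> covers a vanishing mean.\<close>
    define e where "e = sgn b"
    have ne: "norm e \<le> 1" by (simp add: e_def norm_sgn)
    have eb: "e \<bullet> b = norm b" by (cases "b = 0") (simp_all add: e_def sgn_div_norm dot_square_norm power2_eq_square)
    \<comment> \<open>As F is nearly 1 - |y|^2 on the unit ball, \<open>psi\<close> is nearly 1 -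
      |y|^2/2 + (e.y)/8, whose maximum is at e/8. Hence \<open>y0\<close> lies close to e/8.\<close>
    define psi where "psi y = F y + (norm y)\<^sup>2 / 2 + (e \<bullet> y) / 8" for y
    have "continuous_on (cball 0 1) psi" unfolding psi_def
      by (intro continuous_intros continuous_on_subset[OF Fc]) auto
    then obtain y0 where y0: "y0 \<in> cball 0 1" "\<And>y. y \<in> cball 0 1 \<Longrightarrow> psi y \<le> psi y0"
      using continuous_attains_sup[of "cball (0::H3) 1" psi] by (auto simp: compact_cball)
    have n0: "norm y0 \<le> 1" using y0(1) by simp
    let ?se = "(1/8) *\<^sub>R e"
    have nse: "norm ?se \<le> 1/8" using ne by simp
    have "psi ?se \<le> psi y0" using nse by (intro y0(2)) simp
    then have "F ?se + (?se \<bullet> ?se) / 2 + (e \<bullet> e) / 64 \<le> F y0 + (y0 \<bullet> y0) / 2 + (e \<bullet> y0) / 8"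
      by (simp add: psi_def dot_square_norm)
    moreover have "F ?se \<ge> 1 - ?se \<bullet> ?se - 1/16384" "F y0 \<le> 1 - y0 \<bullet> y0 + 1/16384"
      using Fg[of ?se] Fg[of y0] hbump_eq[of ?se] hbump_eq[OF n0] nse
      unfolding dot_square_norm abs_le_iff by linarith+
    moreover have "?se \<bullet> ?se = (e \<bullet> e) / 64" by simp
    moreover have "(norm (y0 - ?se))\<^sup>2 = y0 \<bullet> y0 - (e \<bullet> y0) / 4 + (e \<bullet> e) / 64"
      unfolding power2_norm_eq_inner by (simp add: inner_diff_left inner_diff_right inner_commute)
    ultimately have "(norm (y0 - ?se))\<^sup>2 \<le> (1/64)\<^sup>2" by (simp add: power_divide)
    then have y0e: "norm (y0 - ?se) \<le> 1/64" by (rule power2_le_imp_le) simp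
    have ny0: "norm y0 \<le> 9/64" using norm_triangle_ineq[of "y0 - ?se" ?se] y0e nse by simp
    \<comment> \<open>Maximality at \<open>y0\<close> reads F(y0 + D) - F(y0) \<le> -(y0 + e/8).D -
      |D|^2/2, and right multiplication by \<open>y\<close> is the displacement D = y +
      \<open>hbr y0 y\<close>. The slope y0 + e/8 is close to e/4.\<close>
    define l where "l y = (y0 + ?se) \<bullet> (y + hbr y0 y)" for y
    have nys: "norm (y0 + ?se) \<le> 17/64" using norm_triangle_ineq[of y0 ?se] ny0 nse by simp
    have lin: "bounded_linear l"
      unfolding l_def
      by (intro bounded_linear_compose[OF bounded_linear_inner_right] bounded_linear_add bounded_linear_ident hbr.bounded_linear_right)
    \<comment> \<open>The main term is |b|/4; the position error of \<open>y0\<close> and the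
      bracket cost at most 1/64 and 153/4096 of |b|.\<close>
    have lb: "l b \<ge> norm b / 8"
    proof -
      have "l b = 2 * (?se \<bullet> b) + (y0 - ?se) \<bullet> b + (y0 + ?se) \<bullet> hbr y0 b"
        by (simp add: l_def inner_add_left inner_add_right inner_diff_left)
      moreover have "?se \<bullet> b = norm b / 8" using eb by simp
      moreover have "\<bar>(y0 - ?se) \<bullet> b\<bar> \<le> (1/64) * norm b"
        using Cauchy_Schwarz_ineq2[of "y0 - ?se" b] mult_right_mono[OF y0e, of "norm b"] by simp
      moreover have "\<bar>(y0 + ?se) \<bullet> hbr y0 b\<bar> \<le> (17/64) * ((9/64) * norm b)"
      proof -
        have "\<bar>(y0 + ?se) \<bullet> hbr y0 b\<bar> \<le> norm (y0 + ?se) * norm (hbr y0 b)" by (rule Cauchy_Schwarz_ineq2)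
        also have "\<dots> \<le> (17/64) * (norm y0 * norm b)" using nys norm_hbr_le[of y0 b] by (intro mult_mono) auto
        also have "\<dots> \<le> (17/64) * ((9/64) * norm b)" using ny0 by (intro mult_left_mono mult_right_mono) auto
        finally show ?thesis .
      qed
      moreover have "0 \<le> norm b" by simp
      ultimately show ?thesis by linarith
    qed
    have nd: "norm (y + hbr y0 y) \<ge> (55/64) * norm y" "norm (y + hbr y0 y) \<le> (73/64) * norm y" for y
    proof -
      have "norm (hbr y0 y) \<le> (9/64) * norm y" using norm_hbr_le[of y0 y] mult_right_mono[OF ny0, of "norm y"] by simp
      then show "norm (y + hbr y0 y) \<ge> (55/64) * norm y" "norm (y + hbr y0 y) \<le> (73/64) * norm y"
        using norm_triangle_ineq[of y "hbr y0 y"] norm_diff_ineq[of y "hbr y0 y"] by linarith+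
    qed
    have hm: "hmul y0 y = y0 + (y + hbr y0 y)" for y by (simp add: hmul_hbr)
    \<comment> \<open>Inside \<open>V\<close> the quadratic coefficient is (1/2) (1/2)^2, from |D|
      \<ge> |y|/2. Outside, the product is at distance at least 1/4 from the identity, where F lies
      below F(y0) by at least 1/32.\<close>
    have upper: "F (hmul y0 y) - F y0 \<le> - (indicator V y * l y) - (indicator V y * (norm y)\<^sup>2) / 8
        - indicator {y. 1/2 < norm y} y / 32" for y
    proof (cases "norm y \<le> 1/2")
      case True
      let ?D = "y + hbr y0 y"
      have "norm (hmul y0 y) \<le> 1"
        using norm_triangle_ineq[of y0 ?D] ny0 nd(2)[of y] True unfolding hm by linarith
      then have "psi (hmul y0 y) \<le> psi y0" by (intro y0(2)) simp
      then have "F (hmul y0 y) - F y0 \<le> - ((y0 + ?se) \<bullet> ?D) - (norm ?D)\<^sup>2 / 2"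
        unfolding psi_def hm power2_norm_eq_inner
        by (simp add: inner_add_left inner_add_right inner_commute field_simps)
      moreover have "(norm ?D)\<^sup>2 \<ge> ((1/2) * norm y)\<^sup>2" using nd(1)[of y] norm_ge_zero[of y] by (intro power_mono) linarith+
      ultimately show ?thesis using True by (simp add: V_def l_def power_mult_distrib power_divide field_simps)
    next
      case False
      let ?D = "y + hbr y0 y"
      have "norm (hmul y0 y) \<ge> 1/4"
        using norm_diff_ineq[of ?D y0] ny0 nd(1)[of y] False unfolding hm by (simp add: add.commute)
      then have "(norm (hmul y0 y))\<^sup>2 \<ge> (1/4)\<^sup>2" by (intro power_mono) auto
      then have "hbump (hmul y0 y) \<le> 15/16" unfolding hbump_def
        by (intro max.boundedI) (simp_all add: power_divide)
      moreover have "(norm y0)\<^sup>2 \<le> (9/64)\<^sup>2" using ny0 by (intro power_mono) auto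
      ultimately have "F (hmul y0 y) - F y0 \<le> - (1/32)"
        using Fg[of y0] Fg[of "hmul y0 y"] hbump_eq[OF n0] unfolding power_divide abs_le_iff by simp
      then show ?thesis using False by (simp add: V_def)
    qed
    have lV: "\<bar>l y\<bar> \<le> 1" if "norm y \<le> 1/2" for y
    proof -
      have "\<bar>l y\<bar> \<le> norm (y0 + ?se) * norm (y + hbr y0 y)" unfolding l_def by (rule Cauchy_Schwarz_ineq2)
      also have "\<dots> \<le> 1 * 1" using nys nd(2)[of y] that norm_ge_zero[of "y + hbr y0 y"] by (intro mult_mono) linarith+
      finally show ?thesis by simp
    qed
    have lm [measurable]: "l \<in> borel_measurable borel" using lin by (simp add: linear_continuous_on)
    have Vm [measurable]: "V \<in> sets borel" by (simp add: V_def)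
    have nV: "(norm y)\<^sup>2 \<le> 1" if "norm y \<le> 1/2" for y :: H3 using that by (intro power_le_one) auto
    have i1: "integrable lborel (\<lambda>y. \<rho> d y * (indicator V y * l y))"
      using lV by (intro integrable_r_mult[OF d(1), where M=1]) (auto simp: indicator_def V_def)
    have i2: "integrable lborel (\<lambda>y. \<rho> d y * (indicator V y * (norm y)\<^sup>2))"
      using nV by (intro integrable_r_mult[OF d(1), where M=1]) (auto simp: indicator_def V_def)
    have i3: "integrable lborel (\<lambda>y. \<rho> d y * indicator {y. 1/2 < norm y} y)"
      by (intro integrable_r_mult[OF d(1), where M=1]) (auto simp: indicator_def)
    have i4: "integrable lborel (\<lambda>y. (\<rho> d y * indicator V y) *\<^sub>R y)"
    proof (rule Bochner_Integration.integrable_bound[OF r_integrable[OF d(1)]])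
      have [measurable]: "\<rho> d \<in> borel_measurable borel" by (rule r_measurable[OF d(1)])
      show "(\<lambda>y. (\<rho> d y * indicator V y) *\<^sub>R y) \<in> borel_measurable lborel" by measurable
      have "norm ((\<rho> d y * indicator V y) *\<^sub>R y) \<le> norm (\<rho> d y)" for y
        using r_nonneg[OF d(1), of y] by (auto simp: indicator_def V_def intro!: mult_left_le)
      then show "AE y in lborel. norm ((\<rho> d y * indicator V y) *\<^sub>R y) \<le> norm (\<rho> d y)" by (intro AE_I2)
    qed
    have Fm: "(\<lambda>y. F (hmul y0 y)) \<in> borel_measurable borel"
      by (intro continuous_imp_borel continuous_on_compose2[OF Fc] continuous_intros) auto
    have lint: "(\<integral>y. \<rho> d y * (indicator V y * l y) \<partial>lborel) = l b"
    proof -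
      have "(\<integral>y. \<rho> d y * (indicator V y * l y) \<partial>lborel) = (\<integral>y. l ((\<rho> d y * indicator V y) *\<^sub>R y) \<partial>lborel)"
        using linear_scale[OF bounded_linear.linear[OF lin]] by (simp add: mult.assoc)
      also have "\<dots> = l b" unfolding b_def by (rule integral_bounded_linear[OF lin i4])
      finally show ?thesis .
    qed
    have "- (1 / real N) \<le> (\<integral>y. \<rho> d y * F (hmul y0 y) \<partial>lborel) - F y0" by (rule TF)
    also have "\<dots> = (\<integral>y. \<rho> d y * (F (hmul y0 y) - F y0) \<partial>lborel)"
      using integrable_r_mult[OF d(1) Fm Fb] r_integrable[OF d(1)] r_integral[OF d(1)] by (simp add: right_diff_distrib)
    also have "\<dots> \<le> (\<integral>y. - (\<rho> d y * (indicator V y * l y)) - (\<rho> d y * (indicator V y * (norm y)\<^sup>2)) / 8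
        - (\<rho> d y * indicator {y. 1/2 < norm y} y) / 32 \<partial>lborel)"
    proof (rule integral_mono)
      show "integrable lborel (\<lambda>y. \<rho> d y * (F (hmul y0 y) - F y0))"
        using integrable_r_mult[OF d(1) Fm Fb] r_integrable[OF d(1)] by (simp add: right_diff_distrib)
      show "integrable lborel (\<lambda>y. - (\<rho> d y * (indicator V y * l y)) - (\<rho> d y * (indicator V y * (norm y)\<^sup>2)) / 8
        - (\<rho> d y * indicator {y. 1/2 < norm y} y) / 32)" using i1 i2 i3 by simp
      show "\<rho> d y * (F (hmul y0 y) - F y0) \<le> - (\<rho> d y * (indicator V y * l y)) - (\<rho> d y * (indicator V y * (norm y)\<^sup>2)) / 8
        - (\<rho> d y * indicator {y. 1/2 < norm y} y) / 32" for y
        using mult_left_mono[OF upper[of y] r_nonneg[OF d(1), of y]] by (simp add: algebra_simps)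
    qed
    also have "\<dots> = - l b - (\<integral>y. \<rho> d y * (indicator V y * (norm y)\<^sup>2) \<partial>lborel) / 8
        - (\<integral>y. \<rho> d y * indicator {y. 1/2 < norm y} y \<partial>lborel) / 32"
      using i1 i2 i3 by (simp add: lint)
    finally show ?thesis using lb Ninv unfolding b_def by linarith
  qed
  have nn: "0 \<le> (\<integral>y. \<rho> d y * indicator {y. 1/2 < norm y} y \<partial>lborel)"
    "0 \<le> (\<integral>y. \<rho> d y * (indicator V y * (norm y)\<^sup>2) \<partial>lborel)" if "d > 0" for d
    using r_nonneg[OF that] by (auto intro!: Bochner_Integration.integral_nonneg)
  \<comment> \<open>The terms of \<open>key\<close> are nonnegative, so each is at most the total;
    the smallest weight 1/32 gives the constant 32 * 2/e0.\<close>
  show ?thesis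
  proof (rule that[of e0 "64 / e0"])
    fix d assume d: "0 < d" "d < e0"
    have eq: "64 / e0 * d = 32 * (2 * d / e0)" by simp
    have pos: "0 \<le> 2 * d / e0" using d by simp
    note k = key[OF d] nn[OF d(1)] norm_ge_zero[of "\<integral>y. (\<rho> d y * indicator V y) *\<^sub>R y \<partial>lborel"]
    show "(\<integral>y. \<rho> d y * indicator {y. 1/2 < norm y} y \<partial>lborel) \<le> 64 / e0 * d" unfolding eq using k by linarith
    show "(\<integral>y. \<rho> d y * (indicator (cball 0 (1/2)) y * (norm y)\<^sup>2) \<partial>lborel) \<le> 64 / e0 * d"
      unfolding eq V_def[symmetric] using k pos by linarith
    show "norm (\<integral>y. (\<rho> d y * indicator (cball 0 (1/2)) y) *\<^sub>R y \<partial>lborel) \<le> 64 / e0 * d"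
      unfolding eq V_def[symmetric] using k pos by linarith
  qed (use e0 in auto)
qed

end

section \<open>A locally uniform lower bound for time increments of the kernel\<close>

text \<open>Continuity is known for each fixed direction only; expanding \<open>w\<close> in the
  basis makes it a uniform bound on the ball, and convexity of the ball keeps the segment inside for
  the mean value theorem.\<close>

lemma C1_directional_bound:
  fixes g :: "H3 \<Rightarrow> real"
  assumes g: "\<And>x. (g has_derivative g' x) (at x)" and c: "\<And>u. continuous_on UNIV (\<lambda>x. g' x u)"
  obtains K where "K \<ge> 0" "\<And>x w. norm x \<le> R \<Longrightarrow> \<bar>g' x w\<bar> \<le> K * norm w"
    "\<And>x w. norm x \<le> R \<Longrightarrow> norm (x + w) \<le> R \<Longrightarrow> \<bar>g (x + w) - g x\<bar> \<le> K * norm w"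
proof -
  have "\<exists>k\<ge>0. \<forall>x. norm x \<le> R \<longrightarrow> \<bar>g' x b\<bar> \<le> k" for b
  proof -
    have "compact ((\<lambda>x. g' x b) ` cball 0 R)"
      by (intro compact_continuous_image continuous_on_subset[OF c]) auto
    from compact_imp_bounded[OF this] obtain B where "B > 0" "\<And>x. x \<in> cball 0 R \<Longrightarrow> norm (g' x b) \<le> B"
      unfolding bounded_pos by (metis imageI)
    then show ?thesis by (intro exI[of _ B]) auto
  qed
  then obtain k where k: "\<And>b. k b \<ge> 0" "\<And>b x. norm x \<le> R \<Longrightarrow> \<bar>g' x b\<bar> \<le> k b" by metis
  define K where "K = (\<Sum>b\<in>(Basis::H3 set). k b)"
  have K: "K \<ge> 0" unfolding K_def using k by (intro sum_nonneg) auto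
  have lin: "linear (g' x)" for x using g has_derivative_bounded_linear bounded_linear.linear by blast
  have 1: "\<bar>g' x w\<bar> \<le> K * norm w" if "norm x \<le> R" for x w
  proof -
    have "g' x w = g' x (\<Sum>b\<in>Basis. (w \<bullet> b) *\<^sub>R b)" by (simp add: euclidean_representation)
    also have "\<dots> = (\<Sum>b\<in>Basis. (w \<bullet> b) * g' x b)"
      by (simp only: linear_sum[OF lin] linear_scale[OF lin] real_scaleR_def)
    also have "\<bar>\<dots>\<bar> \<le> (\<Sum>b\<in>Basis. \<bar>(w \<bullet> b) * g' x b\<bar>)" by (rule sum_abs)
    also have "\<dots> \<le> (\<Sum>b\<in>Basis. norm w * k b)"
      unfolding abs_mult using k(2)[OF that] by (intro sum_mono mult_mono Basis_le_norm) auto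
    finally show ?thesis by (simp add: K_def sum_distrib_left mult.commute)
  qed
  have 2: "\<bar>g (x + w) - g x\<bar> \<le> K * norm w" if x: "norm x \<le> R" "norm (x + w) \<le> R" for x w
  proof -
    have "((\<lambda>s. g (x + s *\<^sub>R w)) has_real_derivative g' (x + s *\<^sub>R w) w) (at s)" for s :: real
    proof -
      have "((\<lambda>s::real. x + s *\<^sub>R w) has_derivative (\<lambda>s. s *\<^sub>R w)) (at s)" by (auto intro!: derivative_eq_intros)
      from has_derivative_compose[OF this g]
      have "((\<lambda>s. g (x + s *\<^sub>R w)) has_derivative (\<lambda>h. g' (x + s *\<^sub>R w) (h *\<^sub>R w))) (at s)" .
      then show ?thesis by (simp add: has_field_derivative_def linear_scale[OF lin] mult_commute_abs)
    qed
    then obtain z where z: "0 < z" "z < 1" "g (x + 1 *\<^sub>R w) - g (x + 0 *\<^sub>R w) = (1 - 0) * g' (x + z *\<^sub>R w) w"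
      using MVT2[of 0 1 "\<lambda>s. g (x + s *\<^sub>R w)" "\<lambda>s. g' (x + s *\<^sub>R w) w"] by auto
    have "x + z *\<^sub>R w = (1 - z) *\<^sub>R x + z *\<^sub>R (x + w)" by (simp add: algebra_simps)
    also have "norm \<dots> \<le> (1 - z) * norm x + z * norm (x + w)"
      using norm_triangle_ineq[of "(1 - z) *\<^sub>R x" "z *\<^sub>R (x + w)"] z by simp
    also have "\<dots> \<le> (1 - z) * R + z * R" using x z by (intro add_mono mult_left_mono) auto
    finally have "norm (x + z *\<^sub>R w) \<le> R" by (simp add: algebra_simps)
    from 1[OF this, of w] z(3) show ?thesis by simp
  qed
  show ?thesis by (rule that[OF K 1 2])
qed

text \<open>The mean value theorem for f(x + s w) - s f'(x) w reduces the remainder to Lipschitz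
  bounds for the derivatives in the basis directions.\<close>

lemma Ck2_taylor:
  fixes f :: "H3 \<Rightarrow> real"
  assumes "Ck 2 f"
  obtains f' K M where "\<And>x. linear (f' x)" "K \<ge> 0" "M \<ge> 0" "\<And>x w. norm x \<le> R \<Longrightarrow> \<bar>f' x w\<bar> \<le> K * norm w"
    "\<And>x w. norm x \<le> R \<Longrightarrow> norm (x + w) \<le> R \<Longrightarrow> \<bar>f (x + w) - f x - f' x w\<bar> \<le> M * (norm w)\<^sup>2"
proof -
  obtain f' where f': "\<And>x. (f has_derivative f' x) (at x)" "\<And>u. Ck 1 (\<lambda>x. f' x u)"
    using assms unfolding numeral_2_eq_2 One_nat_def Ck.simps(2)[of "Suc 0"] by blast
  have lin: "linear (f' x)" for x using f' has_derivative_bounded_linear bounded_linear.linear by blast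
  obtain K where K: "K \<ge> 0" "\<And>x w. norm x \<le> R \<Longrightarrow> \<bar>f' x w\<bar> \<le> K * norm w"
    using C1_directional_bound[OF f'(1) Ck_continuous[OF f'(2)], of R] by metis
  have "\<exists>k\<ge>0. \<forall>x w. norm x \<le> R \<longrightarrow> norm (x + w) \<le> R \<longrightarrow> \<bar>f' (x + w) b - f' x b\<bar> \<le> k * norm w" for b
  proof -
    obtain g' where g': "\<And>x. ((\<lambda>x. f' x b) has_derivative g' x) (at x)" "\<And>u. Ck 0 (\<lambda>x. g' x u)"
      using f'(2)[of b] unfolding One_nat_def Ck.simps(2) by blast
    show ?thesis
      using C1_directional_bound[OF g'(1) Ck_continuous[OF g'(2)], of R] by metis
  qed
  then obtain k where k: "\<And>b. k b \<ge> 0" "\<And>b x w. norm x \<le> R \<Longrightarrow> norm (x + w) \<le> R \<Longrightarrow> \<bar>f' (x + w) b - f' x b\<bar> \<le> k b * norm w"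
    by metis
  define M where "M = (\<Sum>b\<in>(Basis::H3 set). k b)"
  have M: "M \<ge> 0" unfolding M_def using k by (intro sum_nonneg) auto
  have d: "\<bar>f' (x + v) w - f' x w\<bar> \<le> M * norm v * norm w" if "norm x \<le> R" "norm (x + v) \<le> R" for x v w
  proof -
    have e: "f' x w = (\<Sum>b\<in>Basis. (w \<bullet> b) * f' x b)" for x
      using linear_sum[OF lin, of x "\<lambda>b. (w \<bullet> b) *\<^sub>R b" Basis] linear_scale[OF lin, of x]
      by (simp add: euclidean_representation)
    have "\<bar>f' (x + v) w - f' x w\<bar> = \<bar>\<Sum>b\<in>Basis. (w \<bullet> b) * (f' (x + v) b - f' x b)\<bar>"
      unfolding e[of x] e[of "x + v"] by (simp add: sum_subtractf right_diff_distrib)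
    also have "\<dots> \<le> (\<Sum>b\<in>Basis. \<bar>(w \<bullet> b) * (f' (x + v) b - f' x b)\<bar>)" by (rule sum_abs)
    also have "\<dots> \<le> (\<Sum>b\<in>Basis. norm w * (k b * norm v))"
      unfolding abs_mult using k(2)[OF that] by (intro sum_mono mult_mono Basis_le_norm) auto
    finally show ?thesis by (simp add: M_def sum_distrib_left sum_distrib_right mult_ac)
  qed
  have t: "\<bar>f (x + w) - f x - f' x w\<bar> \<le> M * (norm w)\<^sup>2" if x: "norm x \<le> R" "norm (x + w) \<le> R" for x w
  proof -
    have "((\<lambda>s. f (x + s *\<^sub>R w) - s * f' x w) has_real_derivative f' (x + s *\<^sub>R w) w - f' x w) (at s)" for s :: real
    proof -
      have "((\<lambda>s::real. x + s *\<^sub>R w) has_derivative (\<lambda>s. s *\<^sub>R w)) (at s)" by (auto intro!: derivative_eq_intros)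
      from has_derivative_compose[OF this f'(1)]
      have "((\<lambda>s. f (x + s *\<^sub>R w)) has_derivative (\<lambda>h. f' (x + s *\<^sub>R w) (h *\<^sub>R w))) (at s)" .
      then have "((\<lambda>s. f (x + s *\<^sub>R w)) has_real_derivative f' (x + s *\<^sub>R w) w) (at s)"
        by (simp add: has_field_derivative_def linear_scale[OF lin] mult_commute_abs)
      then show ?thesis by (auto intro!: derivative_eq_intros)
    qed
    then obtain z where z: "0 < z" "z < 1"
      "f (x + 1 *\<^sub>R w) - 1 * f' x w - (f (x + 0 *\<^sub>R w) - 0 * f' x w) = (1 - 0) * (f' (x + z *\<^sub>R w) w - f' x w)"
      using MVT2[of 0 1 "\<lambda>s. f (x + s *\<^sub>R w) - s * f' x w" "\<lambda>s. f' (x + s *\<^sub>R w) w - f' x w"] by auto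
    have "x + z *\<^sub>R w = (1 - z) *\<^sub>R x + z *\<^sub>R (x + w)" by (simp add: algebra_simps)
    also have "norm \<dots> \<le> (1 - z) * norm x + z * norm (x + w)"
      using norm_triangle_ineq[of "(1 - z) *\<^sub>R x" "z *\<^sub>R (x + w)"] z by simp
    also have "\<dots> \<le> (1 - z) * R + z * R" using x z by (intro add_mono mult_left_mono) auto
    finally have zR: "norm (x + z *\<^sub>R w) \<le> R" by (simp add: algebra_simps)
    have "\<bar>f' (x + z *\<^sub>R w) w - f' x w\<bar> \<le> M * norm (z *\<^sub>R w) * norm w" by (rule d[OF x(1) zR])
    also have "\<dots> \<le> M * norm w * norm w"
      using M z by (intro mult_right_mono mult_left_mono) (auto simp: mult_left_le_one_le)
    finally show ?thesis using z(3) by (simp add: power2_eq_square mult.assoc algebra_simps)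
  qed
  show ?thesis by (rule that[OF lin K(1) M K(2) t])
qed

context heat
begin

text \<open>By the semigroup law the increment is the average of
  \<open>\<rho> t (hmul (- z) x) - \<rho> t x\<close> against \<open>\<rho> d\<close>. For |z| \<le>
  1/2, Taylor expansion and the first and second moments give O(d). For larger z there is no upper
  control of the kernel, but positivity bounds the difference below by \<open>- \<rho> t x\<close>
  on a set of mass O(d); hence the estimate is one-sided.\<close>

lemma rho_increment_lower_bound:
  assumes t: "t > 0" and R: "R \<ge> 0"
  obtains C d0 where "C > 0" "d0 > 0" "\<And>x d. norm x \<le> R \<Longrightarrow> 0 < d \<Longrightarrow> d < d0 \<Longrightarrow> \<rho> (t + d) x - \<rho> t x \<ge> - C * d"
proof -
  obtain C e0 where e0: "e0 > 0" "C > 0"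
    "\<And>d. 0 < d \<Longrightarrow> d < e0 \<Longrightarrow> (\<integral>y. \<rho> d y * indicator {y. 1/2 < norm y} y \<partial>lborel) \<le> C * d"
    "\<And>d. 0 < d \<Longrightarrow> d < e0 \<Longrightarrow> (\<integral>y. \<rho> d y * (indicator (cball 0 (1/2)) y * (norm y)\<^sup>2) \<partial>lborel) \<le> C * d"
    "\<And>d. 0 < d \<Longrightarrow> d < e0 \<Longrightarrow> norm (\<integral>y. (\<rho> d y * indicator (cball 0 (1/2)) y) *\<^sub>R y \<partial>lborel) \<le> C * d"
    by (rule hunt_bounds, rule that)
  define V where "V = cball (0::H3) (1/2)"
  \<comment> \<open>The factor \<open>- z\<close> on the left displaces \<open>x\<close> by at most
    (1 + R) |z|, so this ball contains every point of the expansion.\<close>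
  define R' where "R' = R + (1 + R)"
  obtain f' K M where f': "\<And>x. linear (f' x)" "K \<ge> 0" "M \<ge> 0" "\<And>x w. norm x \<le> R' \<Longrightarrow> \<bar>f' x w\<bar> \<le> K * norm w"
    "\<And>x w. norm x \<le> R' \<Longrightarrow> norm (x + w) \<le> R' \<Longrightarrow> \<bar>\<rho> t (x + w) - \<rho> t x - f' x w\<bar> \<le> M * (norm w)\<^sup>2"
    by (rule Ck2_taylor[OF rho_Ck[OF t], of R'], rule that)
  have "compact (\<rho> t ` cball 0 R)" by (intro compact_continuous_image continuous_on_subset[OF rho_cont[OF t]]) auto
  from compact_imp_bounded[OF this] obtain B where B: "B > 0" "\<And>x. x \<in> cball 0 R \<Longrightarrow> norm (\<rho> t x) \<le> B"
    unfolding bounded_pos by (metis imageI)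
  define C' where "C' = K * (1 + R) * C + M * (1 + R)\<^sup>2 * C + B * C"
  have C': "C' > 0" unfolding C'_def using e0 f' B R by (auto intro!: add_nonneg_pos)
  have "\<rho> (t + d) x - \<rho> t x \<ge> - C' * d" if x: "norm x \<le> R" and d: "0 < d" "d < e0" for x d
  proof -
    define L where "L z = - (z + hbr z x)" for z
    have hL: "hmul (- z) x = x + L z" for z by (simp add: L_def hmul_hbr hbr.minus_left)
    have nL: "norm (L z) \<le> (1 + R) * norm z" for z
    proof -
      have "norm (L z) \<le> norm z + norm (hbr z x)" unfolding L_def norm_minus_cancel by (rule norm_triangle_ineq)
      also have "\<dots> \<le> norm z + norm z * R" using norm_hbr_le[of z x] mult_left_mono[OF x, of "norm z"] by simp
      finally show ?thesis by (simp add: algebra_simps)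
    qed
    have xR': "norm x \<le> R'" using x R by (simp add: R'_def)
    define l where "l z = f' x (L z)" for z
    have "linear (\<lambda>z. L z)" unfolding L_def
      by (intro linear_compose_neg linear_compose_add linear_ident bounded_linear.linear[OF hbr.bounded_linear_left])
    then have ll: "linear l" unfolding l_def using linear_compose[of L "f' x"] f'(1)[of x] by (simp add: o_def)
    have lb: "\<bar>l z\<bar> \<le> K * (1 + R) * norm z" for z
    proof -
      have "\<bar>l z\<bar> \<le> K * norm (L z)" unfolding l_def by (rule f'(4)[OF xR'])
      also have "\<dots> \<le> K * ((1 + R) * norm z)" using nL f'(2) by (rule mult_left_mono)
      finally show ?thesis by (simp add: mult.assoc)
    qed
    have bl: "bounded_linear l" using ll lb by (auto simp: linear_conv_bounded_linear)
    have lower: "\<rho> t (hmul (- z) x) - \<rho> t x \<ge> indicator V z * l z - M * (1 + R)\<^sup>2 * (indicator V z * (norm z)\<^sup>2)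
        - B * indicator {y. 1/2 < norm y} z" for z
    proof (cases "norm z \<le> 1/2")
      case True
      have "(1 + R) * norm z \<le> 1 + R" using True R by (intro mult_left_le) auto
      then have "norm (L z) \<le> 1 + R" using nL[of z] by linarith
      then have "norm (x + L z) \<le> R'" using norm_triangle_ineq[of x "L z"] x unfolding R'_def by linarith
      from f'(5)[OF xR' this] have "\<rho> t (x + L z) - \<rho> t x \<ge> l z - M * (norm (L z))\<^sup>2" unfolding l_def by linarith
      moreover have "M * (norm (L z))\<^sup>2 \<le> M * ((1 + R) * norm z)\<^sup>2" using nL f'(3) by (intro mult_left_mono power_mono) auto
      ultimately show ?thesis using True by (simp add: hL V_def power_mult_distrib mult.assoc)
    next
      case False
      have "\<rho> t x \<le> B" using B(2)[of x] x by simp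
      moreover have "0 \<le> \<rho> t (hmul (- z) x)" by (rule r_nonneg[OF t])
      ultimately show ?thesis using False by (simp add: V_def)
    qed
    have Vm [measurable]: "V \<in> sets borel" by (simp add: V_def)
    have lm [measurable]: "l \<in> borel_measurable borel" using bl by (simp add: linear_continuous_on)
    have nV: "(norm y)\<^sup>2 \<le> 1" if "norm y \<le> 1/2" for y :: H3 using that by (intro power_le_one) auto
    have lV: "\<bar>l z\<bar> \<le> K * (1 + R)" if "norm z \<le> 1/2" for z
    proof -
      have "K * (1 + R) * norm z \<le> K * (1 + R)" using that f'(2) R by (intro mult_left_le) auto
      then show ?thesis using lb[of z] by linarith
    qed
    have i1: "integrable lborel (\<lambda>y. \<rho> d y * (indicator V y * l y))"
      using lV f'(2) R by (intro integrable_r_mult[OF d(1), where M="K * (1 + R)"]) (auto simp: indicator_def V_def)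
    have i2: "integrable lborel (\<lambda>y. \<rho> d y * (indicator V y * (norm y)\<^sup>2))"
      using nV by (intro integrable_r_mult[OF d(1), where M=1]) (auto simp: indicator_def V_def)
    have i3: "integrable lborel (\<lambda>y. \<rho> d y * indicator {y. 1/2 < norm y} y)"
      by (intro integrable_r_mult[OF d(1), where M=1]) (auto simp: indicator_def)
    have i4: "integrable lborel (\<lambda>y. (\<rho> d y * indicator V y) *\<^sub>R y)"
    proof (rule Bochner_Integration.integrable_bound[OF r_integrable[OF d(1)]])
      have [measurable]: "\<rho> d \<in> borel_measurable borel" by (rule r_measurable[OF d(1)])
      show "(\<lambda>y. (\<rho> d y * indicator V y) *\<^sub>R y) \<in> borel_measurable lborel" by measurable
      have "norm ((\<rho> d y * indicator V y) *\<^sub>R y) \<le> norm (\<rho> d y)" for y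
        using r_nonneg[OF d(1), of y] by (auto simp: indicator_def V_def intro!: mult_left_le)
      then show "AE y in lborel. norm ((\<rho> d y * indicator V y) *\<^sub>R y) \<le> norm (\<rho> d y)" by (intro AE_I2)
    qed
    define b where "b = (\<integral>y. (\<rho> d y * indicator V y) *\<^sub>R y \<partial>lborel)"
    have lint: "(\<integral>y. \<rho> d y * (indicator V y * l y) \<partial>lborel) = l b"
    proof -
      have "(\<integral>y. \<rho> d y * (indicator V y * l y) \<partial>lborel) = (\<integral>y. l ((\<rho> d y * indicator V y) *\<^sub>R y) \<partial>lborel)"
        using linear_scale[OF ll] by (simp add: mult.assoc)
      also have "\<dots> = l b" unfolding b_def by (rule integral_bounded_linear[OF bl i4])
      finally show ?thesis .
    qed
    have i5: "integrable lborel (\<lambda>z. \<rho> d z * (\<rho> t (hmul (- z) x) - \<rho> t x))"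
      using rho_semigroup_integrable[OF d(1) t] r_integrable[OF d(1)] by (simp add: right_diff_distrib)
    have "\<rho> (t + d) x - \<rho> t x = (\<integral>z. \<rho> d z * (\<rho> t (hmul (- z) x) - \<rho> t x) \<partial>lborel)"
      using rho_semigroup[OF d(1) t, of x] rho_semigroup_integrable[OF d(1) t] r_integrable[OF d(1)] r_integral[OF d(1)]
      by (simp add: right_diff_distrib add.commute)
    also have "\<dots> \<ge> (\<integral>z. \<rho> d z * (indicator V z * l z) - M * (1 + R)\<^sup>2 * (\<rho> d z * (indicator V z * (norm z)\<^sup>2))
        - B * (\<rho> d z * indicator {y. 1/2 < norm y} z) \<partial>lborel)"
    proof (rule integral_mono[OF _ i5])
      show "integrable lborel (\<lambda>z. \<rho> d z * (indicator V z * l z) - M * (1 + R)\<^sup>2 * (\<rho> d z * (indicator V z * (norm z)\<^sup>2))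
        - B * (\<rho> d z * indicator {y. 1/2 < norm y} z))" using i1 i2 i3 by simp
      show "\<rho> d z * (indicator V z * l z) - M * (1 + R)\<^sup>2 * (\<rho> d z * (indicator V z * (norm z)\<^sup>2))
        - B * (\<rho> d z * indicator {y. 1/2 < norm y} z) \<le> \<rho> d z * (\<rho> t (hmul (- z) x) - \<rho> t x)" for z
        using mult_left_mono[OF lower[of z] r_nonneg[OF d(1), of z]] by (simp add: algebra_simps)
    qed
    also have "(\<integral>z. \<rho> d z * (indicator V z * l z) - M * (1 + R)\<^sup>2 * (\<rho> d z * (indicator V z * (norm z)\<^sup>2))
        - B * (\<rho> d z * indicator {y. 1/2 < norm y} z) \<partial>lborel)
      = l b - M * (1 + R)\<^sup>2 * (\<integral>z. \<rho> d z * (indicator V z * (norm z)\<^sup>2) \<partial>lborel)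
        - B * (\<integral>z. \<rho> d z * indicator {y. 1/2 < norm y} z \<partial>lborel)"
      using i1 i2 i3 by (simp add: lint)
    finally have 1: "\<rho> (t + d) x - \<rho> t x \<ge> l b - M * (1 + R)\<^sup>2 * (\<integral>z. \<rho> d z * (indicator V z * (norm z)\<^sup>2) \<partial>lborel)
        - B * (\<integral>z. \<rho> d z * indicator {y. 1/2 < norm y} z \<partial>lborel)" .
    have "K * (1 + R) * norm b \<le> K * (1 + R) * (C * d)"
      using e0(5)[OF d] f'(2) R unfolding b_def V_def by (intro mult_left_mono) auto
    then have 2: "l b \<ge> - (K * (1 + R) * (C * d))" using lb[of b] by linarith
    have 3: "M * (1 + R)\<^sup>2 * (\<integral>z. \<rho> d z * (indicator V z * (norm z)\<^sup>2) \<partial>lborel) \<le> M * (1 + R)\<^sup>2 * (C * d)"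
      using e0(4)[OF d] f'(3) unfolding V_def by (intro mult_left_mono) auto
    have 4: "B * (\<integral>z. \<rho> d z * indicator {y. 1/2 < norm y} z \<partial>lborel) \<le> B * (C * d)"
      using e0(3)[OF d] B(1) by (intro mult_left_mono) auto
    have "C' * d = K * (1 + R) * (C * d) + M * (1 + R)\<^sup>2 * (C * d) + B * (C * d)"
      by (simp add: C'_def algebra_simps)
    then show ?thesis using 1 2 3 4 by linarith
  qed
  then show ?thesis using that[OF C' e0(1)] by blast
qed

end

subsection \<open>Weak form of the heat equation\<close>

text \<open>A supremum argument for the upper Dini derivative: continuity makes the set of points
  satisfying the \<epsilon>-relaxed inequality closed, and one good step leads beyond any supremum
  short of \<open>b\<close>.\<close>

lemma upper_dini_mono:
  fixes G :: "real \<Rightarrow> real"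
  assumes ab: "a \<le> b" and c: "continuous_on {a..b} G"
    and D: "\<And>x \<epsilon>. a \<le> x \<Longrightarrow> x < b \<Longrightarrow> \<epsilon> > 0 \<Longrightarrow> \<exists>d>0. x + d \<le> b \<and> G (x + d) \<ge> G x - \<epsilon> * d"
  shows "G a \<le> G b"
proof (rule field_le_epsilon)
  fix e :: real assume e: "e > 0"
  define \<epsilon> where "\<epsilon> = e / (b - a + 1)"
  have \<epsilon>: "\<epsilon> > 0" "\<epsilon> * (b - a) \<le> e" using e ab by (auto simp: \<epsilon>_def field_simps)
  define S where "S = {x \<in> {a..b}. G a - \<epsilon> * (x - a) \<le> G x}"
  have "closedin (top_of_set {a..b}) {x \<in> {a..b}. 0 \<le> G x - (G a - \<epsilon> * (x - a))}"
    using continuous_closedin_preimage[of "{a..b}" "\<lambda>x. G x - (G a - \<epsilon> * (x - a))" "{0..}"] c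
    by (simp add: vimage_def Int_def continuous_intros)
  then have "closed {x \<in> {a..b}. 0 \<le> G x - (G a - \<epsilon> * (x - a))}" by (rule closedin_closed_trans) simp
  then have S: "closed S" by (simp add: S_def)
  have Sne: "a \<in> S" using ab by (simp add: S_def)
  have bdd: "bdd_above S" by (auto simp: S_def bdd_above_def)
  define c where "c = Sup S"
  have cS: "c \<in> S" unfolding c_def using closed_contains_Sup[OF _ bdd S] Sne by auto
  have "c = b"
  proof (rule ccontr)
    assume "c \<noteq> b"
    then have "a \<le> c" "c < b" using cS by (auto simp: S_def)
    from D[OF this \<epsilon>(1)] obtain d where d: "d > 0" "c + d \<le> b" "G (c + d) \<ge> G c - \<epsilon> * d" by auto
    then have "c + d \<in> S" using cS by (auto simp: S_def algebra_simps)
    then have "c + d \<le> c" unfolding c_def using bdd by (intro cSup_upper)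
    then show False using d by simp
  qed
  then show "G a \<le> G b + e" using cS \<epsilon> by (auto simp: S_def)
qed

text \<open>The one-sided bound \<open>r_lower\<close> is the only uniformity of time increments
  that is assumed; it provides the integrable minorant in the Fatou argument.\<close>

locale heat_family = prob_family +
  fixes r1 r2 :: "real \<Rightarrow> H3 \<Rightarrow> H3 \<Rightarrow> real"
  assumes r_hC2: "t > 0 \<Longrightarrow> hC2 (r t) (r1 t) (r2 t)"
    and r_heat: "t > 0 \<Longrightarrow> ((\<lambda>s. r s x) has_real_derivative HL (r2 t) x / 4) (at t)"
    and r_lower: "t > 0 \<Longrightarrow> R \<ge> 0 \<Longrightarrow> \<exists>C d0. C > 0 \<and> d0 > 0 \<and>
        (\<forall>x d. norm x \<le> R \<longrightarrow> 0 < d \<longrightarrow> d < d0 \<longrightarrow> r (t + d) x - r t x \<ge> - C * d)"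
begin

lemma bounded_time_integrand:
  assumes "hC2 h h1 h2" "bsupp h"
  obtains M where "M > 0" "\<And>x. \<bar>HL h2 x / 4\<bar> \<le> M"
proof -
  have "continuous_on UNIV (\<lambda>x. HL h2 x / 4)" using hC2_cont(4)[OF assms(1)] by (intro continuous_intros) auto
  moreover have "bsupp (\<lambda>x. HL h2 x / 4)" using hC2_bsupp(3)[OF assms] by (auto simp: bsupp_def)
  ultimately show ?thesis by (rule bounded_bsupp) (use that in auto)
qed

text \<open>The difference quotients converge pointwise but are controlled from below only.
  Truncated from above at their limit they are dominated on the support of \<open>h\<close>, and
  since h \<ge> 0 the part cut away only helps.\<close>

lemma time_increment_ge:
  assumes h: "hC2 h h1 h2" "bsupp h" and pos: "\<And>x. h x \<ge> 0" and t: "t > 0" and \<epsilon>: "\<epsilon> > 0" and \<eta>: "\<eta> > 0"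
  shows "\<exists>d>0. d < \<eta> \<and> (\<integral>x. r (t + d) x * h x \<partial>lborel) - (\<integral>x. r t x * h x \<partial>lborel)
      \<ge> d * ((\<integral>x. r t x * (HL h2 x / 4) \<partial>lborel) - \<epsilon>)"
proof -
  obtain R where R: "\<And>x. R < norm x \<Longrightarrow> h x = 0" using h(2) by (auto simp: bsupp_def)
  obtain C d0 where C: "C > 0" "d0 > 0" 
    "\<And>x d. norm x \<le> \<bar>R\<bar> \<Longrightarrow> 0 < d \<Longrightarrow> d < d0 \<Longrightarrow> r (t + d) x - r t x \<ge> - C * d"
    using r_lower[OF t, of "\<bar>R\<bar>"] by auto
  note hc = hC2_cont(1)[OF h(1)]
  note rc = hC2_cont[OF r_hC2[OF t]]
  obtain Mh where Mh: "Mh > 0" "\<And>x. norm (h x) \<le> Mh" using bounded_bsupp[OF hc h(2)] by metis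
  have Mh': "\<bar>h x\<bar> \<le> Mh" for x using Mh(2)[of x] by simp
  define L where "L x = HL (r2 t) x / 4" for x
  have Lc: "continuous_on UNIV L" unfolding L_def using rc by (intro continuous_intros) auto
  define D where "D n = min d0 \<eta> / (real n + 2)" for n :: nat
  have m0: "min d0 \<eta> > 0" using C(2) \<eta> by simp
  have Dm: "D n < min d0 \<eta>" for n
    using divide_strict_left_mono[of 1 "real n + 2" "min d0 \<eta>"] m0 by (simp add: D_def)
  have D: "D n > 0" "D n < d0" "D n < \<eta>" for n
    using Dm[of n] m0 by (auto simp: D_def)
  have D0: "D \<longlonglongrightarrow> 0" 
    using LIMSEQ_ignore_initial_segment[OF lim_const_over_n[of "min d0 \<eta>"], of 2] by (simp add: D_def[abs_def] add.commute)
  define A where "A n x = (r (t + D n) x - r t x) / D n" for n x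
  have A: "(\<lambda>n. A n x) \<longlonglongrightarrow> L x" for x
  proof -
    have "((\<lambda>d. (r (t + d) x - r t x) / d) \<longlongrightarrow> L x) (at 0)"
      using r_heat[OF t, of x] by (simp add: DERIV_def L_def)
    moreover have "filterlim D (at 0) sequentially"
      by (simp add: filterlim_at D0 order_less_imp_not_eq2[OF D(1)])
    ultimately show ?thesis unfolding A_def by (rule filterlim_compose)
  qed
  have tD: "t + D n > 0" for n using D(1)[of n] t by linarith
  have Am [measurable]: "A n \<in> borel_measurable borel" for n unfolding A_def using tD t by measurable
  have Lm [measurable]: "L \<in> borel_measurable borel" using Lc by simp
  have hm [measurable]: "h \<in> borel_measurable borel" using hc by simp
  define B where "B n x = min (A n x) (L x) * h x" for n x
  have ih: "integrable lborel (\<lambda>x. L x * h x)"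
    using integral_HL_by_parts(2)[OF r_hC2[OF t] h(1)] h(2) by (simp add: L_def)
  have w: "integrable lborel (\<lambda>x. (C + \<bar>L x\<bar>) * h x)"
    using hc Lc h(2) by (intro integrable_bsupp continuous_intros bsupp_mult_right) auto
  have Bw: "norm (B n x) \<le> (C + \<bar>L x\<bar>) * h x" for n x
  proof (cases "R < norm x")
    case True then show ?thesis using R by (simp add: B_def)
  next
    case False
    then have "r (t + D n) x - r t x \<ge> - C * D n" using C(3)[of x "D n"] D by auto
    then have "A n x \<ge> - C" unfolding A_def using D(1)[of n] by (simp add: field_simps)
    then have "\<bar>min (A n x) (L x)\<bar> \<le> C + \<bar>L x\<bar>" using C(1) by linarith
    then show ?thesis unfolding B_def using pos[of x] by (simp add: abs_mult mult_right_mono)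
  qed
  have Blim: "(\<lambda>n. \<integral>x. B n x \<partial>lborel) \<longlonglongrightarrow> (\<integral>x. L x * h x \<partial>lborel)"
  proof (rule integral_dominated_convergence[OF _ _ w])
    show "AE x in lborel. (\<lambda>n. B n x) \<longlonglongrightarrow> L x * h x"
    proof (intro AE_I2)
      fix x
      have "(\<lambda>n. min (A n x) (L x)) \<longlonglongrightarrow> min (L x) (L x)" by (intro tendsto_intros A)
      then show "(\<lambda>n. B n x) \<longlonglongrightarrow> L x * h x" unfolding B_def by (intro tendsto_intros) simp
    qed
  qed (use Bw in \<open>auto simp: B_def intro!: AE_I2\<close>)
  have Bm [measurable]: "B n \<in> borel_measurable borel" for n unfolding B_def by measurable
  have iB: "integrable lborel (B n)" for n
    by (rule Bochner_Integration.integrable_bound[OF w]) (use Bw[of n] in \<open>auto intro!: AE_I2 intro: order.trans[OF _ abs_ge_self]\<close>)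
  have iA: "(\<integral>x. A n x * h x \<partial>lborel) = ((\<integral>x. r (t + D n) x * h x \<partial>lborel) - (\<integral>x. r t x * h x \<partial>lborel)) / D n"
    "integrable lborel (\<lambda>x. A n x * h x)" for n
  proof -
    note i = integrable_r_mult[OF tD hm Mh', of n] integrable_r_mult[OF t hm Mh']
    have e: "A n x * h x = (r (t + D n) x * h x - r t x * h x) / D n" for x by (simp add: A_def diff_divide_distrib algebra_simps)
    show "(\<integral>x. A n x * h x \<partial>lborel) = ((\<integral>x. r (t + D n) x * h x \<partial>lborel) - (\<integral>x. r t x * h x \<partial>lborel)) / D n"
      "integrable lborel (\<lambda>x. A n x * h x)" unfolding e using i by auto
  qed
  have "\<forall>\<^sub>F n in sequentially. (\<integral>x. B n x \<partial>lborel) > (\<integral>x. L x * h x \<partial>lborel) - \<epsilon>"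
    by (rule order_tendstoD(1)[OF Blim]) (use \<epsilon> in simp)
  then obtain n where n: "(\<integral>x. B n x \<partial>lborel) > (\<integral>x. L x * h x \<partial>lborel) - \<epsilon>"
    unfolding eventually_sequentially by auto
  have "(\<integral>x. B n x \<partial>lborel) \<le> (\<integral>x. A n x * h x \<partial>lborel)"
    using pos by (intro integral_mono iB iA) (auto simp: B_def intro!: mult_right_mono)
  with n have "(\<integral>x. L x * h x \<partial>lborel) - \<epsilon> \<le> ((\<integral>x. r (t + D n) x * h x \<partial>lborel) - (\<integral>x. r t x * h x \<partial>lborel)) / D n"
    by (simp add: iA)
  moreover have "(\<integral>x. L x * h x \<partial>lborel) = (\<integral>x. r t x * (HL h2 x / 4) \<partial>lborel)"
    using integral_HL_by_parts(1)[OF r_hC2[OF t] h(1)] h(2) by (simp add: L_def)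
  ultimately show ?thesis using D[of n] by (intro exI[of _ "D n"]) (simp add: field_simps)
qed

text \<open>The defect in Dynkin's formula for \<open>h\<close> between the times \<open>s\<close>
  and \<open>t\<close>; being a weak supersolution means that it is nonnegative for h \<ge>
  0.\<close>

definition Dyn :: "real \<Rightarrow> real \<Rightarrow> (H3 \<Rightarrow> real) \<Rightarrow> (H3 \<Rightarrow> H3 \<Rightarrow> real) \<Rightarrow> real" where
  "Dyn s t h h2 = (\<integral>x. r t x * h x \<partial>lborel) - (\<integral>x. r s x * h x \<partial>lborel)
     - integral {s..t} (\<lambda>u. \<integral>x. r u x * (HL h2 x / 4) \<partial>lborel)"

text \<open>The mean of \<open>h\<close> minus the integral of its expected rate of change has
  nonnegative upper Dini derivative by \<open>time_increment_ge\<close>, hence does not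
  decrease.\<close>

lemma Dyn_nonneg:
  assumes h: "hC2 h h1 h2" "bsupp h" and pos: "\<And>x. h x \<ge> 0" and st: "0 < s" "s \<le> t"
  shows "Dyn s t h h2 \<ge> 0"
proof -
  note hc = hC2_cont(1)[OF h(1)] hC2_cont(4)[OF h(1)]
  obtain Mh where Mh: "Mh > 0" "\<And>x. norm (h x) \<le> Mh" using bounded_bsupp[OF hc(1) h(2)] by metis
  have Mh': "\<bar>h x\<bar> \<le> Mh" for x using Mh(2)[of x] by simp
  obtain M where M: "M > 0" "\<And>x. \<bar>HL h2 x / 4\<bar> \<le> M" by (rule bounded_time_integrand[OF h], rule that)
  have hm: "h \<in> borel_measurable borel" "(\<lambda>x. HL h2 x / 4) \<in> borel_measurable borel"
    using hc by (auto intro!: continuous_imp_borel continuous_intros)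
  define F where "F u = (\<integral>x. r u x * h x \<partial>lborel)" for u
  define k where "k u = (\<integral>x. r u x * (HL h2 x / 4) \<partial>lborel)" for u
  have Fc: "continuous_on {0<..} F" unfolding F_def by (rule continuous_on_integral_r_time[OF hm(1) Mh'])
  have kc: "continuous_on {0<..} k" unfolding k_def by (rule continuous_on_integral_r_time[OF hm(2) M(2)])
  have sub: "{s..t} \<subseteq> {0<..}" using st by auto
  note kst = continuous_on_subset[OF kc sub]
  define G where "G u = F u - integral {s..u} k" for u
  have "G s \<le> G t"
  proof (rule upper_dini_mono[OF st(2)])
    show "continuous_on {s..t} G" unfolding G_def
      by (intro continuous_intros continuous_on_subset[OF Fc sub] indefinite_integral_continuous_1 integrable_continuous_real kst)
    fix x \<epsilon> :: real assume x: "s \<le> x" "x < t" and \<epsilon>: "\<epsilon> > 0"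
    have x0: "x > 0" using x st by simp
    have "continuous (at x within {0<..}) k" using kc x0 by (simp add: continuous_on_eq_continuous_within)
    then obtain e where e: "e > 0" "\<And>y. y > 0 \<Longrightarrow> \<bar>y - x\<bar> < e \<Longrightarrow> \<bar>k y - k x\<bar> < \<epsilon>/2"
      using \<epsilon> unfolding continuous_within_eps_delta by (auto simp: dist_real_def dest!: spec[of _ "\<epsilon>/2"])
    obtain d where d: "d > 0" "d < min e (t - x)" "F (x + d) - F x \<ge> d * (k x - \<epsilon>/2)"
      using time_increment_ge[OF h pos x0, of "\<epsilon>/2" "min e (t - x)"] \<epsilon> e x unfolding F_def k_def by auto
    have kxd: "k integrable_on {x..x + d}" "k integrable_on {s..x + d}"
      using d x st by (auto intro!: integrable_continuous_real continuous_on_subset[OF kc])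
    have "integral {s..x + d} k = integral {s..x} k + integral {x..x + d} k"
      using x d kxd by (intro Henstock_Kurzweil_Integration.integral_combine[symmetric]) auto
    moreover have "integral {x..x + d} k \<le> integral {x..x + d} (\<lambda>u. k x + \<epsilon>/2)"
    proof (rule integral_le[OF kxd(1)])
      fix u assume "u \<in> {x..x + d}"
      then have "\<bar>k u - k x\<bar> < \<epsilon>/2" using d x0 by (intro e(2)) auto
      then show "k u \<le> k x + \<epsilon>/2" by linarith
    qed (rule integrable_const_ivl)
    moreover have "integral {x..x + d} (\<lambda>u. k x + \<epsilon>/2) = d * (k x + \<epsilon>/2)" using d by simp
    ultimately have "G (x + d) \<ge> G x - \<epsilon> * d" using d(3) unfolding G_def by (simp add: algebra_simps)
    then show "\<exists>d>0. x + d \<le> t \<and> G (x + d) \<ge> G x - \<epsilon> * d" using d by (intro exI[of _ d]) auto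
  qed
  moreover have "k = (\<lambda>u. \<integral>x. r u x * (HL h2 x / 4) \<partial>lborel)" by (rule ext) (rule k_def)
  ultimately show ?thesis unfolding Dyn_def F_def[symmetric] by (simp add: G_def)
qed

lemma Dyn_linear:
  assumes h: "hC2 h h1 h2" "bsupp h" and g: "hC2 g g1 g2" "bsupp g" and st: "0 < s" "s \<le> t"
  shows "Dyn s t (\<lambda>x. c * h x + g x) (\<lambda>v x. c * h2 v x + g2 v x) = c * Dyn s t h h2 + Dyn s t g g2"
proof -
  note hc = hC2_cont(1)[OF h(1)] hC2_cont(4)[OF h(1)]
  note gc = hC2_cont(1)[OF g(1)] hC2_cont(4)[OF g(1)]
  obtain Mh where Mh: "\<And>x. norm (h x) \<le> Mh" using bounded_bsupp[OF hc(1) h(2)] by metis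
  obtain Mg where Mg: "\<And>x. norm (g x) \<le> Mg" using bounded_bsupp[OF gc(1) g(2)] by metis
  obtain M where M: "\<And>x. \<bar>HL h2 x / 4\<bar> \<le> M" by (rule bounded_time_integrand[OF h], rule that)
  obtain M' where M': "\<And>x. \<bar>HL g2 x / 4\<bar> \<le> M'" by (rule bounded_time_integrand[OF g], rule that)
  have m: "h \<in> borel_measurable borel" "(\<lambda>x. HL h2 x / 4) \<in> borel_measurable borel"
    "g \<in> borel_measurable borel" "(\<lambda>x. HL g2 x / 4) \<in> borel_measurable borel"
    using hc gc by (auto intro!: continuous_imp_borel continuous_intros)
  have a: "(\<integral>x. r u x * (c * h x + g x) \<partial>lborel) = c * (\<integral>x. r u x * h x \<partial>lborel) + (\<integral>x. r u x * g x \<partial>lborel)" if "u > 0" for u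
  proof -
    have "integrable lborel (\<lambda>x. r u x * h x)" "integrable lborel (\<lambda>x. r u x * g x)"
      using integrable_r_mult[OF that m(1), of Mh] integrable_r_mult[OF that m(3), of Mg] Mh Mg by simp_all
    then show ?thesis by (simp add: distrib_left mult.left_commute[of _ c])
  qed
  have HLe: "HL (\<lambda>v x. c * h2 v x + g2 v x) x / 4 = c * (HL h2 x / 4) + HL g2 x / 4" for x
    by (simp add: HL_def sum.distrib sum_distrib_left add_divide_distrib)
  have b: "(\<integral>x. r u x * (HL (\<lambda>v x. c * h2 v x + g2 v x) x / 4) \<partial>lborel)
      = c * (\<integral>x. r u x * (HL h2 x / 4) \<partial>lborel) + (\<integral>x. r u x * (HL g2 x / 4) \<partial>lborel)" if "u > 0" for u
    unfolding HLe using integrable_r_mult[OF that m(2) M] integrable_r_mult[OF that m(4) M']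
    by (simp only: distrib_left mult.left_commute[of _ c] Bochner_Integration.integral_add integrable_mult_right integral_mult_right_zero)
  have sub: "{s..t} \<subseteq> {0<..}" using st by auto
  have i: "(\<lambda>u. \<integral>x. r u x * (HL h2 x / 4) \<partial>lborel) integrable_on {s..t}"
    "(\<lambda>u. \<integral>x. r u x * (HL g2 x / 4) \<partial>lborel) integrable_on {s..t}"
    by (intro integrable_continuous_real continuous_on_subset[OF continuous_on_integral_r_time[OF m(2) M] sub]
       continuous_on_subset[OF continuous_on_integral_r_time[OF m(4) M'] sub])+
  have "integral {s..t} (\<lambda>u. \<integral>x. r u x * (HL (\<lambda>v x. c * h2 v x + g2 v x) x / 4) \<partial>lborel)
     = integral {s..t} (\<lambda>u. c * (\<integral>x. r u x * (HL h2 x / 4) \<partial>lborel) + (\<integral>x. r u x * (HL g2 x / 4) \<partial>lborel))"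
    using b st by (intro Henstock_Kurzweil_Integration.integral_cong) auto
  also have "\<dots> = c * integral {s..t} (\<lambda>u. \<integral>x. r u x * (HL h2 x / 4) \<partial>lborel) + integral {s..t} (\<lambda>u. \<integral>x. r u x * (HL g2 x / 4) \<partial>lborel)"
    using i by (subst Henstock_Kurzweil_Integration.integral_add) (auto intro: integrable_on_mult_right)
  finally show ?thesis using a[of s] a[of t] st by (simp add: Dyn_def algebra_simps)
qed

end

lemma chi_lower:
  assumes R: "R \<ge> 0"
  obtains l0 where "l0 > 0" "\<And>lam x. 0 < lam \<Longrightarrow> lam < l0 \<Longrightarrow> norm x \<le> R \<Longrightarrow> chi lam x \<ge> 1/2"
\<comment> \<open>With this choice \<open>hq lam x\<close> is at most 1/8 on the ball, and (7/8)^3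
  exceeds 1/2.\<close>
proof (rule that[of "min 1 (1 / (8 * (R\<^sup>2 + 1)))"])
  show "min 1 (1 / (8 * (R\<^sup>2 + 1))) > 0" using zero_le_power2[of R] by (auto intro: add_nonneg_pos)
  fix lam and x :: H3 assume l: "0 < lam" "lam < min 1 (1 / (8 * (R\<^sup>2 + 1)))" and x: "norm x \<le> R"
  have "lam\<^sup>2 \<le> lam" using l by (simp add: power2_eq_square mult_left_le)
  then have "hq lam x \<le> lam * (fst x \<bullet> fst x + fst (snd x) \<bullet> fst (snd x)) + lam * (snd (snd x) \<bullet> snd (snd x))"
    unfolding hq_def by (intro add_left_mono mult_right_mono) auto
  also have "\<dots> = lam * (norm x)\<^sup>2" by (simp add: power2_norm_eq_inner inner_prod_def algebra_simps)
  also have "\<dots> \<le> lam * (R\<^sup>2 + 1)" using x l power_mono[OF x, of 2] by (intro mult_left_mono) auto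
  also have "\<dots> \<le> 1/8"
  proof -
    have "R\<^sup>2 + 1 > 0" using zero_le_power2[of R] by linarith
    then show ?thesis using l by (simp add: field_simps)
  qed
  finally have "7/8 \<le> max 0 (1 - hq lam x)" by simp
  then have "(7/8) ^ 3 \<le> chi lam x" unfolding chi_def by (rule power_mono) simp
  then show "chi lam x \<ge> 1/2" by (simp add: power_divide)
qed

definition lamn :: "nat \<Rightarrow> real" where "lamn n = 1 / (real n + 1)"

lemma lamn: "lamn n > 0" "lamn n \<le> 1" "lamn \<longlonglongrightarrow> 0" "(\<lambda>n. chi (lamn n) x) \<longlonglongrightarrow> 1"
proof -
  show 1: "lamn n > 0" "lamn n \<le> 1" for n by (auto simp: lamn_def)
  show 2: "lamn \<longlonglongrightarrow> 0"
    using LIMSEQ_ignore_initial_segment[OF lim_const_over_n[of "1::real"], of 1] by (simp add: lamn_def[abs_def] add.commute)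
  have "filterlim lamn (at 0) sequentially" by (simp add: filterlim_at 2 order_less_imp_not_eq2[OF 1(1)])
  then show "(\<lambda>n. chi (lamn n) x) \<longlonglongrightarrow> 1" by (rule filterlim_compose[OF chi_tendsto])
qed

lemma hC2_bsupp_bounds:
  assumes h: "hC2 h h1 h2" "bsupp h"
  obtains M where "M > 0" "\<And>x. \<bar>h x\<bar> \<le> M" "\<And>v x. v \<in> HD \<Longrightarrow> \<bar>h1 v x\<bar> \<le> M" "\<And>x. \<bar>HL h2 x\<bar> \<le> M"
proof -
  note c = hC2_cont[OF h(1)] and s = hC2_bsupp[OF h]
  obtain A where A: "A > 0" "\<And>x. norm (h x) \<le> A" by (rule bounded_bsupp[OF c(1) h(2)], rule that)
  obtain B where B: "B > 0" "\<And>x. norm (HL h2 x) \<le> B" by (rule bounded_bsupp[OF c(4) s(3)], rule that)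
  have "\<exists>M. M > 0 \<and> (\<forall>x. \<bar>h1 v x\<bar> \<le> M)" if v: "v \<in> HD" for v
  proof -
    obtain K where "K > 0" "\<And>x. norm (h1 v x) \<le> K" by (rule bounded_bsupp[OF c(2)[OF v] s(1)[OF v]], rule that)
    then show ?thesis by (intro exI[of _ K]) simp
  qed
  then obtain k where "\<forall>v\<in>HD. k v > 0 \<and> (\<forall>x. \<bar>h1 v x\<bar> \<le> k v)"
    using bchoice[of HD "\<lambda>v M. M > 0 \<and> (\<forall>x. \<bar>h1 v x\<bar> \<le> M)"] by blast
  then have k: "\<And>v. v \<in> HD \<Longrightarrow> k v > 0" "\<And>v x. v \<in> HD \<Longrightarrow> \<bar>h1 v x\<bar> \<le> k v" by blast+
  define M where "M = A + B + (\<Sum>v\<in>HD. k v)"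
  have kM: "k v \<le> (\<Sum>v\<in>HD. k v)" if "v \<in> HD" for v using that k(1) by (intro member_le_sum) (auto intro: less_imp_le)
  have k0: "0 \<le> (\<Sum>v\<in>HD. k v)" using k(1) by (intro sum_nonneg) (auto intro: less_imp_le)
  show ?thesis
  proof (rule that[of M])
    show "M > 0" using A B k0 by (simp add: M_def)
    show "\<bar>h x\<bar> \<le> M" "\<bar>HL h2 x\<bar> \<le> M" for x using A(1) A(2)[of x] B(1) B(2)[of x] k0 by (auto simp: M_def)
    show "\<bar>h1 v x\<bar> \<le> M" if "v \<in> HD" for v x using A(1) B(1) k(2)[OF that, of x] kM[OF that] by (auto simp: M_def)
  qed
qed

context heat_family
begin

text \<open>Conservation of mass: both means tend to 1, and the sub-Laplacian of the cut-off is
  O(lam).\<close>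

lemma Dyn_chi_tendsto:
  assumes st: "0 < s" "s \<le> t"
  shows "(\<lambda>n. Dyn s t (chi (lamn n)) (chi2 (lamn n))) \<longlonglongrightarrow> 0"
proof -
  have m: "chi lam \<in> borel_measurable borel" for lam using hC2_cont(1)[OF hC2_chi] by simp
  have 1: "(\<lambda>n. \<integral>x. r u x * chi (lamn n) x \<partial>lborel) \<longlonglongrightarrow> 1" if "u > 0" for u
  proof -
    have "(\<lambda>n. \<integral>x. r u x * chi (lamn n) x \<partial>lborel) \<longlonglongrightarrow> (\<integral>x. r u x * 1 \<partial>lborel)"
      using that lamn(4) chi_range[of "lamn _"] lamn(1)[THEN less_imp_le]
      by (intro r_L1_convergence[where M=1] m) auto
    then show ?thesis using r_integral[OF that] by simp
  qed
  have 2: "norm (integral {s..t} (\<lambda>u. \<integral>x. r u x * (HL (chi2 (lamn n)) x / 4) \<partial>lborel)) \<le> 912 * lamn n * (t - s)" for n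
  proof -
    have mm: "(\<lambda>x. HL (chi2 (lamn n)) x / 4) \<in> borel_measurable borel"
      using hC2_cont(4)[OF hC2_chi] by (intro continuous_imp_borel continuous_intros) auto
    have b: "\<bar>HL (chi2 (lamn n)) x / 4\<bar> \<le> 912 * lamn n" for x using HL_chi_bound[OF lamn(1), of n x] lamn(1)[of n] by simp
    have "norm (integral {s..t} (\<lambda>u. \<integral>x. r u x * (HL (chi2 (lamn n)) x / 4) \<partial>lborel)) \<le> integral {s..t} (\<lambda>u. 912 * lamn n)"
    proof (rule integral_norm_bound_integral)
      show "(\<lambda>u. \<integral>x. r u x * (HL (chi2 (lamn n)) x / 4) \<partial>lborel) integrable_on {s..t}"
        by (intro integrable_continuous_real continuous_on_subset[OF continuous_on_integral_r_time[OF mm b]]) (use st in auto)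
      show "(\<lambda>u. 912 * lamn n) integrable_on {s..t}" by (rule integrable_const_ivl)
      show "norm (\<integral>x. r u x * (HL (chi2 (lamn n)) x / 4) \<partial>lborel) \<le> 912 * lamn n" if "u \<in> {s..t}" for u
        using integral_r_abs_le[OF _ mm b, of u] that st by simp
    qed
    also have "integral {s..t} (\<lambda>u. 912 * lamn n) = 912 * lamn n * (t - s)"
      using st by (simp add: algebra_simps)
    finally show ?thesis .
  qed
  have "(\<lambda>n. 912 * lamn n * (t - s)) \<longlonglongrightarrow> 912 * 0 * (t - s)" by (intro tendsto_intros lamn)
  then have z3: "(\<lambda>n. 912 * lamn n * (t - s)) \<longlonglongrightarrow> 0" by simp
  have 3: "(\<lambda>n. integral {s..t} (\<lambda>u. \<integral>x. r u x * (HL (chi2 (lamn n)) x / 4) \<partial>lborel)) \<longlonglongrightarrow> 0"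
    by (rule Lim_null_comparison[OF always_eventually z3]) (use 2 in blast)
  have "(\<lambda>n. Dyn s t (chi (lamn n)) (chi2 (lamn n))) \<longlonglongrightarrow> 1 - 1 - 0"
    unfolding Dyn_def using st by (intro tendsto_diff 1 3) auto
  then show ?thesis by simp
qed

text \<open>On the support of \<open>h\<close> the cut-off is at least 1/2, so adding 2 M times it
  makes the test function nonnegative, and the defect of what was added tends to 0.\<close>

lemma Dyn_ge_0:
  assumes h: "hC2 h h1 h2" "bsupp h" and st: "0 < s" "s \<le> t"
  shows "Dyn s t h h2 \<ge> 0"
proof -
  obtain M where M: "M > 0" "\<And>x. norm (h x) \<le> M" using bounded_bsupp[OF hC2_cont(1)[OF h(1)] h(2)] by metis
  obtain R where R: "\<And>x. R < norm x \<Longrightarrow> h x = 0" using h(2) by (auto simp: bsupp_def)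
  obtain l0 where l0: "l0 > 0" "\<And>lam x. 0 < lam \<Longrightarrow> lam < l0 \<Longrightarrow> norm x \<le> \<bar>R\<bar> \<Longrightarrow> chi lam x \<ge> 1/2"
    by (rule chi_lower[of "\<bar>R\<bar>"], simp, rule that)
  have "\<forall>\<^sub>F n in sequentially. lamn n < l0" by (rule order_tendstoD(2)[OF lamn(3) l0(1)])
  then have "\<forall>\<^sub>F n in sequentially. - (2 * M) * Dyn s t (chi (lamn n)) (chi2 (lamn n)) \<le> Dyn s t h h2"
  proof eventually_elim
    fix n assume n: "lamn n < l0"
    have pos: "2 * M * chi (lamn n) x + h x \<ge> 0" for x
    proof (cases "R < norm x")
      case True then show ?thesis using R M(1) chi_range[of "lamn n" x] lamn(1)[of n] by simp
    next
      case False
      then have "chi (lamn n) x \<ge> 1/2" using l0(2)[OF lamn(1) n] by simp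
      then have "2 * M * chi (lamn n) x \<ge> 2 * M * (1/2)" using M(1) by (intro mult_left_mono) auto
      then show ?thesis using M(2)[of x] by simp
    qed
    note c = hC2_chi[of "lamn n"] bsupp_chi[OF lamn(1), of n]
    have "0 \<le> Dyn s t (\<lambda>x. 2 * M * chi (lamn n) x + h x) (\<lambda>v x. 2 * M * chi2 (lamn n) v x + h2 v x)"
    proof (rule Dyn_nonneg[OF hC2_add[OF hC2_cmult[OF c(1)] h(1)] _ pos st])
      show "bsupp (\<lambda>x. 2 * M * chi (lamn n) x + h x)" using c(2) h(2) by (intro bsupp_add bsupp_mult_right)
    qed
    also have "\<dots> = 2 * M * Dyn s t (chi (lamn n)) (chi2 (lamn n)) + Dyn s t h h2"
      by (rule Dyn_linear[OF c h st])
    finally show "- (2 * M) * Dyn s t (chi (lamn n)) (chi2 (lamn n)) \<le> Dyn s t h h2" by simp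
  qed
  moreover have "(\<lambda>n. - (2 * M) * Dyn s t (chi (lamn n)) (chi2 (lamn n))) \<longlonglongrightarrow> - (2 * M) * 0"
    by (intro tendsto_intros Dyn_chi_tendsto st)
  ultimately have "- (2 * M) * 0 \<le> Dyn s t h h2" by (intro tendsto_upperbound[rotated]) auto
  then show ?thesis by simp
qed

lemma Dyn_eq_0:
  assumes h: "hC2 h h1 h2" "bsupp h" and st: "0 < s" "s \<le> t"
  shows "Dyn s t h h2 = 0"
proof -
  have z: "hC2 (\<lambda>x. 0) (\<lambda>v x. 0) (\<lambda>v x. 0)" "bsupp (\<lambda>x::H3. 0::real)" by (auto simp: hC2_def bsupp_def hder_const)
  have "Dyn s t (\<lambda>x. 0) (\<lambda>v x. 0) = 0" by (simp add: Dyn_def HL_def)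
  then have "Dyn s t (\<lambda>x. -1 * h x + 0) (\<lambda>v x. -1 * h2 v x + 0) = - Dyn s t h h2"
    using Dyn_linear[OF h z st, of "-1"] by simp
  moreover have "bsupp (\<lambda>x. -1 * h x + 0)" using h(2) z(2) by (intro bsupp_add bsupp_mult_right)
  ultimately have "Dyn s t h h2 \<le> 0" using Dyn_ge_0[OF hC2_add[OF hC2_cmult[OF h(1)] z(1)] _ st, of "-1"] by simp
  then show ?thesis using Dyn_ge_0[OF h st] by simp
qed

text \<open>Compact support is traded for bounds on \<open>w\<close>, its horizontal gradient and
  its sub-Laplacian: after multiplication by the cut-off, the terms containing derivatives of the
  cut-off are O(lam) and O(sqrt lam).\<close>

lemma dynkin_bounded:
  assumes w: "hC2 w w1 w2" and b: "\<And>x. \<bar>w x\<bar> \<le> M" "\<And>v x. v \<in> HD \<Longrightarrow> \<bar>w1 v x\<bar> \<le> M" "\<And>x. \<bar>HL w2 x\<bar> \<le> M"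
    and st: "0 < s" "s \<le> t"
  shows "(\<integral>x. r t x * w x \<partial>lborel) - (\<integral>x. r s x * w x \<partial>lborel)
     = integral {s..t} (\<lambda>u. \<integral>x. r u x * (HL w2 x / 4) \<partial>lborel)"
proof -
  have M: "M \<ge> 0" using b(1)[of 0] by linarith
  define p2 where "p2 n v x = chi2 (lamn n) v x * w x + 2 * (chi1 (lamn n) v x * w1 v x) + chi (lamn n) x * w2 v x" for n v x
  have p: "hC2 (\<lambda>x. chi (lamn n) x * w x) (\<lambda>v x. chi1 (lamn n) v x * w x + chi (lamn n) x * w1 v x) (p2 n)" for n
    unfolding p2_def by (rule hC2_mult[OF hC2_chi w])
  have pb: "bsupp (\<lambda>x. chi (lamn n) x * w x)" for n by (rule bsupp_mult_left[OF bsupp_chi[OF lamn(1)]])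
  have D: "Dyn s t (\<lambda>x. chi (lamn n) x * w x) (p2 n) = 0" for n by (rule Dyn_eq_0[OF p pb st])
  have chr: "0 \<le> chi (lamn n) x" "chi (lamn n) x \<le> 1" for n x using chi_range[of "lamn n" x] lamn(1)[of n] by auto
  have L: "HL (p2 n) x = HL (chi2 (lamn n)) x * w x + 2 * (\<Sum>v\<in>HD. chi1 (lamn n) v x * w1 v x) + chi (lamn n) x * HL w2 x" for n x
    by (simp add: HL_def p2_def sum.distrib sum_distrib_left sum_distrib_right)
  have Ld: "\<bar>HL (p2 n) x - chi (lamn n) x * HL w2 x\<bar> \<le> (912 * lamn n + 144 * sqrt (lamn n)) * M" for n x
  proof -
    have "\<bar>HL (chi2 (lamn n)) x * w x\<bar> \<le> 912 * lamn n * M"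
      unfolding abs_mult using HL_chi_bound[OF lamn(1)] b(1) lamn(1)[of n] by (intro mult_mono) auto
    moreover have "\<bar>\<Sum>v\<in>HD. chi1 (lamn n) v x * w1 v x\<bar> \<le> (\<Sum>v\<in>HD. 18 * sqrt (lamn n) * M)"
      by (rule order.trans[OF sum_abs], rule sum_mono, unfold abs_mult, rule mult_mono) 
         (use chi_bounds(1)[OF lamn(1)] b(2) lamn(1)[of n] in auto)
    ultimately show ?thesis unfolding L by (simp add: card_HD algebra_simps)
  qed
  \<comment> \<open>1057 = 1 + 912 + 144, where 144 = 2 * 4 * 18 comes from the cross terms in the
    four directions.\<close>
  have Lb: "\<bar>HL (p2 n) x / 4\<bar> \<le> 1057 * M" for n x
  proof -
    have "\<bar>chi (lamn n) x * HL w2 x\<bar> \<le> 1 * M" unfolding abs_mult using chr[of n x] b(3)[of x] by (intro mult_mono) auto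
    moreover have "(912 * lamn n + 144 * sqrt (lamn n)) * M \<le> (912 * 1 + 144 * 1) * M"
      using lamn(2)[of n] M by (intro mult_right_mono add_mono) auto
    ultimately show ?thesis using Ld[of n x] M by (simp add: abs_le_iff)
  qed
  have Ll: "(\<lambda>n. HL (p2 n) x / 4) \<longlonglongrightarrow> HL w2 x / 4" for x
  proof -
    have "(\<lambda>n. (912 * lamn n + 144 * sqrt (lamn n)) * M) \<longlonglongrightarrow> (912 * 0 + 144 * sqrt 0) * M"
      by (intro tendsto_intros lamn)
    then have z: "(\<lambda>n. (912 * lamn n + 144 * sqrt (lamn n)) * M) \<longlonglongrightarrow> 0" by simp
    have "(\<lambda>n. HL (p2 n) x - chi (lamn n) x * HL w2 x) \<longlonglongrightarrow> 0"
      by (rule Lim_null_comparison[OF always_eventually z]) (use Ld in simp)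
    moreover have "(\<lambda>n. chi (lamn n) x * HL w2 x) \<longlonglongrightarrow> 1 * HL w2 x" by (intro tendsto_intros lamn)
    ultimately have "(\<lambda>n. (HL (p2 n) x - chi (lamn n) x * HL w2 x) + chi (lamn n) x * HL w2 x) \<longlonglongrightarrow> 0 + 1 * HL w2 x"
      by (rule tendsto_add)
    then show ?thesis by (intro tendsto_divide) auto
  qed
  have m: "(\<lambda>x. chi (lamn n) x * w x) \<in> borel_measurable borel" "(\<lambda>x. HL (p2 n) x / 4) \<in> borel_measurable borel"
    "w \<in> borel_measurable borel" "(\<lambda>x. HL w2 x / 4) \<in> borel_measurable borel" for n
    using hC2_cont(1)[OF p[of n]] hC2_cont(4)[OF p[of n]] hC2_cont(1,4)[OF w] by (auto intro!: continuous_imp_borel continuous_intros)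
  have cb: "\<bar>chi (lamn n) x * w x\<bar> \<le> M" for n x
    unfolding abs_mult using mult_mono[of "\<bar>chi (lamn n) x\<bar>" 1 "\<bar>w x\<bar>" M] chr[of n x] b(1)[of x] by simp
  have A: "(\<lambda>n. \<integral>x. r u x * (chi (lamn n) x * w x) \<partial>lborel) \<longlonglongrightarrow> (\<integral>x. r u x * w x \<partial>lborel)" if "u > 0" for u
  proof (rule r_L1_convergence[OF that that tendsto_const m(1) m(3) cb])
    fix x
    have "(\<lambda>n. chi (lamn n) x * w x) \<longlonglongrightarrow> 1 * w x" by (intro tendsto_intros lamn)
    then show "(\<lambda>n. chi (lamn n) x * w x) \<longlonglongrightarrow> w x" by simp
  qed
  have B: "(\<lambda>n. \<integral>x. r u x * (HL (p2 n) x / 4) \<partial>lborel) \<longlonglongrightarrow> (\<integral>x. r u x * (HL w2 x / 4) \<partial>lborel)" if "u > 0" for u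
    by (rule r_L1_convergence[OF that that tendsto_const m(2) m(4) Lb Ll])
  have "(\<lambda>n. integral {s..t} (\<lambda>u. \<integral>x. r u x * (HL (p2 n) x / 4) \<partial>lborel))
      \<longlonglongrightarrow> integral {s..t} (\<lambda>u. \<integral>x. r u x * (HL w2 x / 4) \<partial>lborel)"
  proof (rule dominated_convergence(2)[where h="\<lambda>u. 1057 * M"])
    show "(\<lambda>u. \<integral>x. r u x * (HL (p2 n) x / 4) \<partial>lborel) integrable_on {s..t}" for n
      by (intro integrable_continuous_real continuous_on_subset[OF continuous_on_integral_r_time[OF m(2) Lb]]) (use st in auto)
    show "(\<lambda>u. 1057 * M) integrable_on {s..t}" by (rule integrable_const_ivl)
    show "norm (\<integral>x. r u x * (HL (p2 n) x / 4) \<partial>lborel) \<le> 1057 * M" if "u \<in> {s..t}" for n u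
      using integral_r_abs_le[OF _ m(2) Lb, of u] that st by simp
    show "(\<lambda>n. \<integral>x. r u x * (HL (p2 n) x / 4) \<partial>lborel) \<longlonglongrightarrow> (\<integral>x. r u x * (HL w2 x / 4) \<partial>lborel)" if "u \<in> {s..t}" for u
      using B[of u] that st by simp
  qed
  then have "(\<lambda>n. Dyn s t (\<lambda>x. chi (lamn n) x * w x) (p2 n)) \<longlonglongrightarrow>
     (\<integral>x. r t x * w x \<partial>lborel) - (\<integral>x. r s x * w x \<partial>lborel) - integral {s..t} (\<lambda>u. \<integral>x. r u x * (HL w2 x / 4) \<partial>lborel)"
    unfolding Dyn_def using st by (intro tendsto_diff A) auto
  then show ?thesis unfolding D by (simp add: LIMSEQ_const_iff)
qed

lemma dynkin_deriv:
  assumes w: "hC2 w w1 w2" and b: "\<And>x. \<bar>w x\<bar> \<le> M" "\<And>v x. v \<in> HD \<Longrightarrow> \<bar>w1 v x\<bar> \<le> M" "\<And>x. \<bar>HL w2 x\<bar> \<le> M"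
    and t: "0 < t"
  shows "((\<lambda>t. \<integral>x. r t x * w x \<partial>lborel) has_real_derivative (\<integral>x. r t x * (HL w2 x / 4) \<partial>lborel)) (at t)"
proof -
  have m: "(\<lambda>x. HL w2 x / 4) \<in> borel_measurable borel"
    using hC2_cont[OF w] by (auto intro!: continuous_imp_borel continuous_intros)
  have b4: "\<bar>HL w2 x / 4\<bar> \<le> M" for x using b(3)[of x] by simp
  let ?s = "t/2"
  have c: "continuous_on {?s..2*t} (\<lambda>u. \<integral>x. r u x * (HL w2 x / 4) \<partial>lborel)"
    by (rule continuous_on_subset[OF continuous_on_integral_r_time[OF m b4]]) (use t in auto)
  have "((\<lambda>u. (\<integral>x. r ?s x * w x \<partial>lborel) + integral {?s..u} (\<lambda>u. \<integral>x. r u x * (HL w2 x / 4) \<partial>lborel))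
    has_real_derivative 0 + (\<integral>x. r t x * (HL w2 x / 4) \<partial>lborel)) (at t within {?s..2*t})"
    using t by (intro DERIV_add DERIV_const integral_has_real_derivative c) auto
  then have "((\<lambda>t. \<integral>x. r t x * w x \<partial>lborel) has_real_derivative 0 + (\<integral>x. r t x * (HL w2 x / 4) \<partial>lborel)) (at t within {?s..2*t})"
    unfolding has_field_derivative_def
  proof (rule has_derivative_transform[rotated 2])
    fix u assume "u \<in> {?s..2*t}"
    then show "(\<integral>x. r u x * w x \<partial>lborel) = (\<integral>x. r ?s x * w x \<partial>lborel) + integral {?s..u} (\<lambda>u. \<integral>x. r u x * (HL w2 x / 4) \<partial>lborel)"
      using dynkin_bounded[OF w b, of ?s u] t by simp
  qed (use t in auto)
  moreover have "at t within {?s..2*t} = at t" using t by (intro at_within_interior) auto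
  ultimately show ?thesis by simp
qed

end

section \<open>Left- and right-invariant Laplacians of the kernel\<close>

context heat
begin

sublocale heat_family \<rho> "\<lambda>t v. lvf v (\<rho> t)" "\<lambda>t v. lvf v (lvf v (\<rho> t))"
proof
  fix t :: real assume t: "t > 0"
  show "hC2 (\<rho> t) (\<lambda>v. lvf v (\<rho> t)) (\<lambda>v. lvf v (lvf v (\<rho> t)))" by (rule Ck_hC2[OF rho_Ck[OF t]])
  show "((\<lambda>s. \<rho> s x) has_real_derivative HL (\<lambda>v. lvf v (lvf v (\<rho> t))) x / 4) (at t)" for x
    unfolding HL_subLap by (rule rho_deriv[OF t])
  fix R :: real assume R: "R \<ge> 0"
  obtain C d0 where "C > 0" "d0 > 0" "\<And>x d. norm x \<le> R \<Longrightarrow> 0 < d \<Longrightarrow> d < d0 \<Longrightarrow> \<rho> (t + d) x - \<rho> t x \<ge> - C * d"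
    by (rule rho_increment_lower_bound[OF t R], rule that)
  then show "\<exists>C d0. C > 0 \<and> d0 > 0 \<and>
        (\<forall>x d. norm x \<le> R \<longrightarrow> 0 < d \<longrightarrow> d < d0 \<longrightarrow> \<rho> (t + d) x - \<rho> t x \<ge> - C * d)" by blast
qed

text \<open>Dynkin's formula between s and d with s tending to 0: the mean at time s tends to h(0),
  and for small times the rate stays above its limit at the identity minus \<epsilon>.\<close>

lemma rho_generator_ge:
  assumes h: "hC2 h h1 h2" "bsupp h" and \<epsilon>: "\<epsilon> > 0"
  obtains d0 where "d0 > 0" "\<And>d. 0 < d \<Longrightarrow> d < d0 \<Longrightarrow> (\<integral>x. \<rho> d x * h x \<partial>lborel) - h 0 \<ge> d * (HL h2 0 / 4 - \<epsilon>)"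
proof -
  obtain M where M: "M > 0" "\<And>x. \<bar>h x\<bar> \<le> M" "\<And>v x. v \<in> HD \<Longrightarrow> \<bar>h1 v x\<bar> \<le> M" "\<And>x. \<bar>HL h2 x\<bar> \<le> M"
    by (rule hC2_bsupp_bounds[OF h], rule that)
  note c = hC2_cont(1,4)[OF h(1)]
  have c4: "continuous_on UNIV (\<lambda>x. HL h2 x / 4)" using c by (intro continuous_intros) auto
  have b4: "\<bar>HL h2 x / 4\<bar> \<le> M" for x using M(4)[of x] by simp
  define k where "k u = (\<integral>x. \<rho> u x * (HL h2 x / 4) \<partial>lborel)" for u
  have "(k \<longlongrightarrow> HL h2 0 / 4) (at_right 0)" unfolding k_def by (rule rho_approx_bounded[OF c4 b4])
  then have "\<forall>\<^sub>F u in at_right 0. k u > HL h2 0 / 4 - \<epsilon>" by (rule order_tendstoD) (use \<epsilon> in simp)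
  then obtain d0 where d0: "d0 > 0" "\<And>u. 0 < u \<Longrightarrow> u < d0 \<Longrightarrow> k u > HL h2 0 / 4 - \<epsilon>"
    unfolding eventually_at_right_field by auto
  have "(\<integral>x. \<rho> d x * h x \<partial>lborel) - h 0 \<ge> d * (HL h2 0 / 4 - \<epsilon>)" if d: "0 < d" "d < d0" for d
  proof -
    have kc: "continuous_on {0<..} k" unfolding k_def
      by (rule continuous_on_integral_r_time[OF _ b4]) (use c4 in simp)
    have le: "(d - s) * (HL h2 0 / 4 - \<epsilon>) \<le> (\<integral>x. \<rho> d x * h x \<partial>lborel) - (\<integral>x. \<rho> s x * h x \<partial>lborel)" if s: "0 < s" "s \<le> d" for s
    proof -
      have "(\<integral>x. \<rho> d x * h x \<partial>lborel) - (\<integral>x. \<rho> s x * h x \<partial>lborel) = integral {s..d} k"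
        unfolding k_def[abs_def] by (rule dynkin_bounded[OF h(1) M(2,3,4) s])
      also have "integral {s..d} k \<ge> integral {s..d} (\<lambda>u. HL h2 0 / 4 - \<epsilon>)"
      proof (rule integral_le)
        show "k integrable_on {s..d}" using s by (intro integrable_continuous_real continuous_on_subset[OF kc]) auto
        show "HL h2 0 / 4 - \<epsilon> \<le> k u" if "u \<in> {s..d}" for u using d0(2)[of u] that s d by (auto intro: less_imp_le)
      qed (rule integrable_const_ivl)
      finally show ?thesis using s by simp
    qed
    have A: "((\<lambda>s. (d - s) * (HL h2 0 / 4 - \<epsilon>)) \<longlongrightarrow> (d - 0) * (HL h2 0 / 4 - \<epsilon>)) (at_right 0)"
      by (intro tendsto_intros)
    have B: "((\<lambda>s. (\<integral>x. \<rho> d x * h x \<partial>lborel) - (\<integral>x. \<rho> s x * h x \<partial>lborel)) \<longlongrightarrow> (\<integral>x. \<rho> d x * h x \<partial>lborel) - h 0) (at_right 0)"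
      by (intro tendsto_intros rho_approx[OF c(1) h(2)])
    have "(d - 0) * (HL h2 0 / 4 - \<epsilon>) \<le> (\<integral>x. \<rho> d x * h x \<partial>lborel) - h 0"
    proof (rule tendsto_le[OF trivial_limit_at_right_real B A])
      show "\<forall>\<^sub>F s in at_right 0. (d - s) * (HL h2 0 / 4 - \<epsilon>) \<le> (\<integral>x. \<rho> d x * h x \<partial>lborel) - (\<integral>x. \<rho> s x * h x \<partial>lborel)"
        unfolding eventually_at_right_field using le d(1) by (intro exI[of _ d]) auto
    qed
    then show ?thesis by simp
  qed
  then show ?thesis using that[OF d0(1)] by blast
qed

text \<open>The reflected kernel. Up to inversion and sign, left-invariant derivatives of it are
  right-invariant derivatives of \<rho>.\<close>

definition rr :: "real \<Rightarrow> H3 \<Rightarrow> real" where "rr t x = \<rho> t (- x)"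
abbreviation "rr1 t v \<equiv> lvf v (rr t)"
abbreviation "rr2 t v \<equiv> lvf v (lvf v (rr t))"
abbreviation "rho2 t v \<equiv> lvf v (lvf v (\<rho> t))"

lemma rr_hC2: "t > 0 \<Longrightarrow> hC2 (rr t) (rr1 t) (rr2 t)"
  unfolding rr_def[abs_def] by (intro Ck_hC2 Ck_uminus_arg rho_Ck)

text \<open>The function \<open>z \<mapsto> \<rho>\<^sub>t(z\<^sup>-\<^sup>1 x) \<chi>(z)\<close> lies below \<open>z \<mapsto> \<rho>\<^sub>t(z\<^sup>-\<^sup>1 x)\<close> and touches it at the identity, so the
  semigroup property bounds the time derivative of \<open>\<rho>\<^sub>t(x)\<close> from below by the right-invariant
  Laplacian. Both Laplacians have vanishing total integral, which forces equality.\<close>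

lemma lap_reflect_le:
  assumes t: "t > 0"
  shows "HL (rr2 t) (- x) \<le> HL (rho2 t) x"
proof (rule ccontr)
  define a where "a = HL (rr2 t) (- x) / 4"
  define b where "b = HL (rho2 t) x / 4"
  assume "\<not> ?thesis"
  then have ab: "b < a" by (simp add: a_def b_def)
  \<comment> \<open>The kernel as a function of the left factor is a left translate of
    \<open>rr t\<close>, so its sub-Laplacian at the identity is
    \<open>HL (rr2 t) (- x)\<close>.\<close>
  define G where "G z = rr t (hmul (- x) z)" for z
  define G1 where "G1 v z = rr1 t v (hmul (- x) z)" for v z
  define G2 where "G2 v z = rr2 t v (hmul (- x) z)" for v z
  have G: "hC2 G G1 G2" unfolding G_def G1_def G2_def by (rule hC2_left_translate[OF rr_hC2[OF t]])
  have Gr: "G z = \<rho> t (hmul (- z) x)" for z by (simp add: G_def rr_def minus_hmul)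
  have G0: "HL G2 0 / 4 = a" by (simp add: HL_def G2_def a_def)
  define p2 where "p2 lam v z = chi2 lam v z * G z + 2 * (chi1 lam v z * G1 v z) + chi lam z * G2 v z" for lam v z
  have p: "hC2 (\<lambda>z. chi lam z * G z) (\<lambda>v z. chi1 lam v z * G z + chi lam z * G1 v z) (p2 lam)" for lam
    unfolding p2_def by (rule hC2_mult[OF hC2_chi G])
  define S where "S = \<bar>G 0\<bar> + (\<Sum>v\<in>HD. \<bar>G1 v 0\<bar>)"
  have L: "\<bar>HL (p2 lam) 0 - HL G2 0\<bar> \<le> (912 * lam + 36 * sqrt lam) * S" if l: "lam > 0" for lam
  proof -
    have "HL (p2 lam) 0 - HL G2 0 = HL (chi2 lam) 0 * G 0 + 2 * (\<Sum>v\<in>HD. chi1 lam v 0 * G1 v 0)"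
      by (simp add: HL_def p2_def sum.distrib sum_distrib_left sum_distrib_right)
    moreover have "\<bar>HL (chi2 lam) 0 * G 0\<bar> \<le> 912 * lam * \<bar>G 0\<bar>"
      unfolding abs_mult using HL_chi_bound[OF l] by (intro mult_right_mono) auto
    moreover have "\<bar>\<Sum>v\<in>HD. chi1 lam v 0 * G1 v 0\<bar> \<le> (\<Sum>v\<in>HD. 18 * sqrt lam * \<bar>G1 v 0\<bar>)"
      by (rule order.trans[OF sum_abs], rule sum_mono, unfold abs_mult, rule mult_right_mono)
         (use chi_bounds(1)[OF l] in auto)
    moreover have "(\<Sum>v\<in>HD. 18 * sqrt lam * \<bar>G1 v 0\<bar>) = 18 * sqrt lam * (\<Sum>v\<in>HD. \<bar>G1 v 0\<bar>)" by (simp add: sum_distrib_left)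
    moreover have "0 \<le> lam * (\<Sum>v\<in>HD. \<bar>G1 v 0\<bar>)" "0 \<le> sqrt lam * \<bar>G 0\<bar>" using l by (auto intro!: mult_nonneg_nonneg sum_nonneg)
    ultimately show ?thesis unfolding S_def by (simp add: algebra_simps)
  qed
  \<comment> \<open>At the identity the product rule leaves cut-off errors of order sqrt lam; lam is
    chosen so that they stay below the gap a - b.\<close>
  have "(\<lambda>n. (912 * lamn n + 36 * sqrt (lamn n)) * S) \<longlonglongrightarrow> (912 * 0 + 36 * sqrt 0) * S" by (intro tendsto_intros lamn)
  then have "\<forall>\<^sub>F n in sequentially. (912 * lamn n + 36 * sqrt (lamn n)) * S < a - b"
    by (rule order_tendstoD) (use ab in simp)
  then obtain n where n: "(912 * lamn n + 36 * sqrt (lamn n)) * S < a - b" unfolding eventually_sequentially by auto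
  define l where "l = lamn n"
  have l: "l > 0" by (simp add: l_def lamn)
  have big: "HL (p2 l) 0 / 4 > b + (a - b)/2"
  proof -
    have "\<bar>HL (p2 l) 0 - HL G2 0\<bar> < a - b" by (rule order.strict_trans1[OF L[OF l]]) (use n in \<open>simp add: l_def\<close>)
    moreover have "HL G2 0 = 4 * a" using G0 by simp
    ultimately show ?thesis using ab by (auto simp: abs_less_iff field_simps)
  qed
  \<comment> \<open>Spends the surplus exactly: the increments below then have slope b + (a - b)/2,
    which exceeds the time derivative b.\<close>
  define \<epsilon> where "\<epsilon> = HL (p2 l) 0 / 4 - (b + (a - b)/2)"
  have \<epsilon>: "\<epsilon> > 0" using big by (simp add: \<epsilon>_def)
  obtain d0 where d0: "d0 > 0" "\<And>d. 0 < d \<Longrightarrow> d < d0 \<Longrightarrow> (\<integral>z. \<rho> d z * (chi l z * G z) \<partial>lborel) - chi l 0 * G 0 \<ge> d * (HL (p2 l) 0 / 4 - \<epsilon>)"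
    by (rule rho_generator_ge[OF p bsupp_mult_left[OF bsupp_chi[OF l]] \<epsilon>], rule that)
  have inc: "\<rho> (t + d) x - \<rho> t x \<ge> d * (b + (a - b)/2)" if d: "0 < d" "d < d0" for d
  proof -
    have "(\<integral>z. \<rho> d z * (chi l z * G z) \<partial>lborel) \<le> (\<integral>z. \<rho> d z * \<rho> t (hmul (- z) x) \<partial>lborel)"
    proof (rule integral_mono[OF _ rho_semigroup_integrable[OF d(1) t]])
      have cb: "continuous_on UNIV (\<lambda>z. chi l z * G z)" "bsupp (\<lambda>z. chi l z * G z)"
        using hC2_cont(1)[OF p] bsupp_mult_left[OF bsupp_chi[OF l]] by auto
      show "integrable lborel (\<lambda>z. \<rho> d z * (chi l z * G z))"
        using rho_cont[OF d(1)] cb by (intro integrable_bsupp continuous_on_mult[OF _ cb(1)] bsupp_mult_right[OF cb(2)])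
      show "\<rho> d z * (chi l z * G z) \<le> \<rho> d z * \<rho> t (hmul (- z) x)" for z
        unfolding Gr using chi_range[of l z] l by (intro mult_left_mono mult_left_le_one_le r_nonneg t d) auto
    qed
    also have "\<dots> = \<rho> (t + d) x" using rho_semigroup[OF d(1) t, of x] by (simp add: add.commute)
    finally have "(\<integral>z. \<rho> d z * (chi l z * G z) \<partial>lborel) \<le> \<rho> (t + d) x" .
    moreover have "chi l 0 * G 0 = \<rho> t x" by (simp add: Gr)
    ultimately show ?thesis using d0(2)[OF d] by (simp add: \<epsilon>_def)
  qed
  have "((\<lambda>d. (\<rho> (t + d) x - \<rho> t x) / d) \<longlongrightarrow> b) (at 0)"
    using r_heat[OF t, of x] by (simp add: DERIV_def b_def)
  then have lim: "((\<lambda>d. (\<rho> (t + d) x - \<rho> t x) / d) \<longlongrightarrow> b) (at_right 0)" by (rule filterlim_mono) (auto simp: at_le)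
  have "b + (a - b)/2 \<le> b"
  proof (rule tendsto_lowerbound[OF lim _ trivial_limit_at_right_real])
    show "\<forall>\<^sub>F d in at_right 0. b + (a - b)/2 \<le> (\<rho> (t + d) x - \<rho> t x) / d"
      unfolding eventually_at_right_field using inc d0(1) by (intro exI[of _ d0]) (auto simp: field_simps)
  qed
  then show False using ab by simp
qed

lemma lap_reflect:
  assumes t: "t > 0"
  shows "HL (rho2 t) x = HL (rr2 t) (- x)"
proof -
  define D where "D y = HL (rho2 t) y - HL (rr2 t) (- y)" for y
  have rc: "continuous_on UNIV (HL (rr2 t))" by (rule hC2_cont(4)[OF rr_hC2[OF t]])
  have rhc: "continuous_on UNIV (HL (rho2 t))" by (rule hC2_cont(4)[OF r_hC2[OF t]])
  have Dc: "continuous_on UNIV D" unfolding D_def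
    by (intro continuous_intros rhc continuous_on_compose2[OF rc]) auto
  have D0: "D y \<ge> 0" for y using lap_reflect_le[OF t, of y] by (simp add: D_def)
  \<comment> \<open>Integration by parts puts both Laplacians on the cut-off, and each side then
    contributes at most 912 l.\<close>
  have small: "(\<integral>y. D y * chi l y \<partial>lborel) \<le> 1824 * l" if l: "l > 0" for l
  proof -
    note c = hC2_chi[of l] bsupp_chi[OF l]
    have m: "HL (chi2 l) \<in> borel_measurable borel" using hC2_cont(4)[OF c(1)] by simp
    have i1: "integrable lborel (\<lambda>y. HL (rho2 t) y * chi l y)" "(\<integral>y. HL (rho2 t) y * chi l y \<partial>lborel) = (\<integral>y. \<rho> t y * HL (chi2 l) y \<partial>lborel)"
      using integral_HL_by_parts(1,2)[OF r_hC2[OF t] c(1)] c(2) by auto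
    have i2: "integrable lborel (\<lambda>y. HL (rr2 t) y * chi l y)" "(\<integral>y. HL (rr2 t) y * chi l y \<partial>lborel) = (\<integral>y. rr t y * HL (chi2 l) y \<partial>lborel)"
      using integral_HL_by_parts(1,2)[OF rr_hC2[OF t] c(1)] c(2) by auto
    have mm: "(\<lambda>y. HL (rr2 t) y * chi l y) \<in> borel_measurable borel" using rc hC2_cont(1)[OF c(1)]
      by (intro continuous_imp_borel continuous_intros)
    have i3: "integrable lborel (\<lambda>y. HL (rr2 t) (- y) * chi l y)"
      "(\<integral>y. HL (rr2 t) (- y) * chi l y \<partial>lborel) = (\<integral>y. HL (rr2 t) y * chi l y \<partial>lborel)"
      using integrable_uminus_H3[OF mm] integral_uminus_H3[OF mm] i2(1) by auto
    have "(\<integral>y. D y * chi l y \<partial>lborel) = (\<integral>y. \<rho> t y * HL (chi2 l) y \<partial>lborel) - (\<integral>y. rr t y * HL (chi2 l) y \<partial>lborel)"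
      unfolding D_def left_diff_distrib using i1 i2 i3 by simp
    also have "(\<integral>y. rr t y * HL (chi2 l) y \<partial>lborel) = (\<integral>y. \<rho> t y * HL (chi2 l) (- y) \<partial>lborel)"
    proof -
      have "(\<lambda>y. rr t y * HL (chi2 l) y) \<in> borel_measurable borel"
        using hC2_cont(1)[OF rr_hC2[OF t]] hC2_cont(4)[OF c(1)] by (intro continuous_imp_borel continuous_intros)
      from integral_uminus_H3[OF this] show ?thesis by (simp add: rr_def)
    qed
    finally have e: "(\<integral>y. D y * chi l y \<partial>lborel) = (\<integral>y. \<rho> t y * HL (chi2 l) y \<partial>lborel) - (\<integral>y. \<rho> t y * HL (chi2 l) (- y) \<partial>lborel)" .
    have "\<bar>\<integral>y. \<rho> t y * HL (chi2 l) y \<partial>lborel\<bar> \<le> 912 * l" by (rule integral_r_abs_le[OF t m]) (rule HL_chi_bound[OF l])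
    moreover have "\<bar>\<integral>y. \<rho> t y * HL (chi2 l) (- y) \<partial>lborel\<bar> \<le> 912 * l"
      by (rule integral_r_abs_le[OF t]) (use m HL_chi_bound[OF l] in auto)
    ultimately show ?thesis unfolding e by linarith
  qed
  obtain l0 where l0: "l0 > 0" "\<And>lam y. 0 < lam \<Longrightarrow> lam < l0 \<Longrightarrow> norm y \<le> norm x + 1 \<Longrightarrow> chi lam y \<ge> 1/2"
    by (rule chi_lower[of "norm x + 1"], simp, rule that)
  define l where "l = l0 / 2"
  have l: "l > 0" "l < l0" using l0 by (auto simp: l_def)
  have ic: "integrable lborel (\<lambda>y. D y * chi lam y)" if "lam > 0" for lam
    using Dc hC2_cont(1)[OF hC2_chi] bsupp_chi[OF that] by (intro integrable_bsupp continuous_intros bsupp_mult_right)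
  have "(\<integral>y. D y * chi l y \<partial>lborel) \<le> 0"
  proof (rule field_le_epsilon)
    fix e :: real assume e: "e > 0"
    \<comment> \<open>The cut-offs grow as the parameter shrinks and D is nonnegative, so the bound
      for the smaller parameter l' is inherited by l.\<close>
    define l' where "l' = min l (e / 1824)"
    have l': "l' > 0" "l' \<le> l" "1824 * l' \<le> e" using l e by (auto simp: l'_def min_def)
    have "(\<integral>y. D y * chi l y \<partial>lborel) \<le> (\<integral>y. D y * chi l' y \<partial>lborel)"
      using D0 l' l by (intro integral_mono ic mult_left_mono chi_antimono) auto
    also have "\<dots> \<le> e" using small[OF l'(1)] l'(3) by linarith
    finally show "(\<integral>y. D y * chi l y \<partial>lborel) \<le> 0 + e" by simp
  qed
  moreover have nn: "0 \<le> D y * chi l y" for y using D0[of y] chi_range[of l y] l by simp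
  ultimately have z: "(\<integral>y. D y * chi l y \<partial>lborel) = 0"
    using Bochner_Integration.integral_nonneg[of lborel "\<lambda>y. D y * chi l y", OF nn] by linarith
  have ae: "AE y in lborel. D y * chi l y = 0"
    using integral_nonneg_eq_0_iff_AE[OF ic[OF l(1)]] nn z by simp
  have Ec: "continuous_on UNIV (\<lambda>y. D y * chi l y)" using Dc hC2_cont(1)[OF hC2_chi] by (intro continuous_intros)
  \<comment> \<open>By continuity a nonzero value would produce a nonempty open null set.\<close>
  have "D x * chi l x = 0"
  proof (rule ccontr)
    assume ne: "D x * chi l x \<noteq> 0"
    have o: "open ((\<lambda>y. D y * chi l y) -` (- {0}))" by (rule open_vimage[OF _ Ec]) auto
    have eq: "{y. D y * chi l y \<noteq> 0} = (\<lambda>y. D y * chi l y) -` (- {0})" by auto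
    have "{y \<in> space lborel. \<not> D y * chi l y = 0} \<in> sets lborel" using o unfolding eq[symmetric] by simp
    from AE_iff_measurable[OF this refl] ae have "emeasure lborel {y. D y * chi l y \<noteq> 0} = 0" by simp
    then have "emeasure lborel ((\<lambda>y. D y * chi l y) -` (- {0})) = 0" by (simp only: eq)
    then have "(\<lambda>y. D y * chi l y) -` (- {0}) \<in> null_sets lborel" using o by (auto simp: null_sets_def)
    then have "negligible ((\<lambda>y. D y * chi l y) -` (- {0}))"
      by (simp add: negligible_iff_null_sets null_sets_completionI)
    with o open_not_negligible ne show False by blast
  qed
  moreover have "chi l x \<ge> 1/2" using l0(2)[OF l, of x] by simp
  ultimately have "D x = 0" by auto
  then show ?thesis by (simp add: D_def)
qed

text \<open>Equality of the two Laplacians is exactly the heat equation for the reflected kernel, so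
  Dynkin's formula becomes available for it too.\<close>

sublocale R: heat_family rr rr1 rr2
proof
  fix t :: real assume t: "t > 0"
  show "0 \<le> rr t x" for x using r_nonneg[OF t] by (simp add: rr_def)
  show "continuous_on UNIV (rr t)" by (rule hC2_cont(1)[OF rr_hC2[OF t]])
  show "integrable lborel (rr t)" "(\<integral>x. rr t x \<partial>lborel) = 1"
    unfolding rr_def using integrable_uminus_H3[OF r_measurable[OF t]] integral_uminus_H3[OF r_measurable[OF t]]
      r_integrable[OF t] r_integral[OF t] by auto
  show "isCont (\<lambda>t. rr t x) t" for x unfolding rr_def by (rule r_isCont[OF t])
  show "hC2 (rr t) (rr1 t) (rr2 t)" by (rule rr_hC2[OF t])
  show "((\<lambda>s. rr s x) has_real_derivative HL (rr2 t) x / 4) (at t)" for x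
    using r_heat[OF t, of "- x"] lap_reflect[OF t, of "- x"] by (simp add: rr_def)
  fix R :: real assume R: "R \<ge> 0"
  obtain C d0 where C: "C > 0" "d0 > 0" "\<And>x d. norm x \<le> R \<Longrightarrow> 0 < d \<Longrightarrow> d < d0 \<Longrightarrow> \<rho> (t + d) x - \<rho> t x \<ge> - C * d"
    by (rule rho_increment_lower_bound[OF t R], rule that)
  have "rr (t + d) x - rr t x \<ge> - C * d" if "norm x \<le> R" "0 < d" "d < d0" for x d
    unfolding rr_def using C(3)[of "- x" d] that by simp
  then show "\<exists>C d0. C > 0 \<and> d0 > 0 \<and>
        (\<forall>x d. norm x \<le> R \<longrightarrow> 0 < d \<longrightarrow> d < d0 \<longrightarrow> rr (t + d) x - rr t x \<ge> - C * d)" using C(1,2) by blast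
qed

end

subsection \<open>The heat semigroup\<close>

context heat
begin

definition Pt :: "real \<Rightarrow> (H3 \<Rightarrow> real) \<Rightarrow> H3 \<Rightarrow> real" where
  "Pt t p x = (\<integral>y. \<rho> t y * p (hmul x (- y)) \<partial>lborel)"

text \<open>In the convolution form of \<open>Pt\<close> the derivatives fall on the kernel, so
  \<open>p\<close> enters undifferentiated.\<close>

definition Pt1 :: "real \<Rightarrow> (H3 \<Rightarrow> real) \<Rightarrow> H3 \<Rightarrow> H3 \<Rightarrow> real" where
  "Pt1 t p v x = (\<integral>z. p z * lvf v (\<rho> t) (hmul (- z) x) \<partial>lborel)"

definition Pt2 :: "real \<Rightarrow> (H3 \<Rightarrow> real) \<Rightarrow> H3 \<Rightarrow> H3 \<Rightarrow> real" where
  "Pt2 t p v x = (\<integral>z. p z * lvf v (lvf v (\<rho> t)) (hmul (- z) x) \<partial>lborel)"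

lemma Pt_rr:
  assumes "t > 0" "p \<in> borel_measurable borel"
  shows "Pt t p x = (\<integral>y. rr t y * p (hmul x y) \<partial>lborel)"
proof -
  note [measurable] = assms(2) R.r_measurable[OF assms(1)]
  have "(\<lambda>y. rr t y * p (hmul x y)) \<in> borel_measurable borel" by measurable
  from integral_uminus_H3[OF this] show ?thesis by (simp add: Pt_def rr_def)
qed

lemma Pt_conv:
  assumes "t > 0" "p \<in> borel_measurable borel"
  shows "Pt t p x = (\<integral>z. p z * \<rho> t (hmul (- z) x) \<partial>lborel)"
proof -
  note [measurable] = assms(2) R.r_measurable[OF assms(1)]
  have "(\<lambda>y. rr t y * p (hmul x y)) \<in> borel_measurable borel" by measurable
  from integral_hmul_left[OF this, of "- x"]
  show ?thesis unfolding Pt_rr[OF assms] by (simp add: rr_def minus_hmul mult.commute)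
qed

lemma Pt_bounds:
  assumes t: "t > 0" and [measurable]: "p \<in> borel_measurable borel" and b: "\<And>x. \<bar>p x\<bar> \<le> M"
  shows "\<bar>Pt t p x\<bar> \<le> M" "(\<And>x. p x \<le> c) \<Longrightarrow> Pt t p x \<le> c" "(\<And>x. c \<le> p x) \<Longrightarrow> c \<le> Pt t p x"
proof -
  have m: "(\<lambda>y. p (hmul x (- y))) \<in> borel_measurable borel" by measurable
  show "\<bar>Pt t p x\<bar> \<le> M" "(\<And>x. p x \<le> c) \<Longrightarrow> Pt t p x \<le> c" "(\<And>x. c \<le> p x) \<Longrightarrow> c \<le> Pt t p x"
    unfolding Pt_def using integral_r_abs_le[OF t m b] integral_r_le[OF t m b, of c] integral_r_ge[OF t m b, of c] by auto
qed

lemma Pt_integrable: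
  assumes t: "t > 0" and [measurable]: "p \<in> borel_measurable borel" and b: "\<And>x. \<bar>p x\<bar> \<le> M"
  shows "integrable lborel (\<lambda>y. \<rho> t y * p (hmul x (- y)))"
  by (rule integrable_r_mult[OF t _ b]) measurable

lemma Pt_mono:
  assumes t: "t > 0" and [measurable]: "p \<in> borel_measurable borel" and b: "\<And>x. \<bar>p x\<bar> \<le> M"
    and [measurable]: "q \<in> borel_measurable borel" and c: "\<And>x. \<bar>q x\<bar> \<le> N" and le: "\<And>x. p x \<le> q x"
  shows "Pt t p x \<le> Pt t q x"
  unfolding Pt_def by (rule integral_r_mult_mono[OF t _ b _ c le]) measurable

lemma Pt_continuous:
  assumes t: "t > 0" and c: "continuous_on UNIV p" and b: "\<And>x. \<bar>p x\<bar> \<le> M"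
  shows "continuous_on UNIV (Pt t p)"
  unfolding Pt_def
proof (rule continuous_integral_r[OF t _ b])
  show "(\<lambda>y. p (hmul x (- y))) \<in> borel_measurable borel" for x
    by (intro continuous_imp_borel continuous_on_compose2[OF c] continuous_intros) auto
  show "continuous_on UNIV (\<lambda>x. p (hmul x (- y)))" for y
    by (intro continuous_on_compose2[OF c] continuous_intros) auto
qed

lemma Pt_hC2:
  assumes t: "t > 0" and c: "continuous_on UNIV p" and s: "bsupp p"
  shows "hC2 (Pt t p) (Pt1 t p) (Pt2 t p)"
proof -
  have "Pt t p = (\<lambda>x. \<integral>z. p z * \<rho> t (hmul (- z) x) \<partial>lborel)" using Pt_conv[OF t] c by (intro ext) simp
  then show ?thesis using hC2_convolution[OF c s r_hC2[OF t]] unfolding Pt1_def[abs_def] Pt2_def[abs_def] by simp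
qed

text \<open>The sub-Laplacian in \<open>x\<close> falls on \<rho>; \<open>lap_reflect\<close> turns
  it into the sub-Laplacian in \<open>z\<close> of a left translate of \<open>rr t\<close>, and
  integration by parts moves it to \<open>p\<close>.\<close>

lemma Pt_laplacian:
  assumes t: "t > 0" and p: "hC2 p p1 p2" "bsupp p"
  shows "HL (Pt2 t p) x = Pt t (HL p2) x"
proof -
  note pc = hC2_cont[OF p(1)]
  have i: "integrable lborel (\<lambda>z. p z * lvf v (lvf v (\<rho> t)) (hmul (- z) x))" if "v \<in> HD" for v
  proof -
    have "continuous_on UNIV (\<lambda>z. lvf v (lvf v (\<rho> t)) (hmul (- z) x))"
      by (rule continuous_on_compose2[OF hC2_cont(3)[OF r_hC2[OF t] that]]) (auto intro!: continuous_intros)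
    then show ?thesis using pc(1) p(2) by (intro integrable_bsupp continuous_on_mult bsupp_mult_left)
  qed
  have "HL (Pt2 t p) x = (\<integral>z. p z * HL (rho2 t) (hmul (- z) x) \<partial>lborel)"
    unfolding HL_def Pt2_def by (simp add: Bochner_Integration.integral_sum[OF i, symmetric] sum_distrib_left)
  also have "\<dots> = (\<integral>z. p z * HL (\<lambda>v z. rr2 t v (hmul (- x) z)) z \<partial>lborel)"
    by (simp add: lap_reflect[OF t] minus_hmul HL_def)
  also have "\<dots> = (\<integral>z. HL p2 z * rr t (hmul (- x) z) \<partial>lborel)"
    by (rule integral_HL_by_parts(1)[OF p(1) hC2_left_translate[OF rr_hC2[OF t]], symmetric]) (use p(2) in simp)
  also have "\<dots> = Pt t (HL p2) x"
    using Pt_conv[OF t, of "HL p2" x] pc(4) by (simp add: rr_def minus_hmul)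
  finally show ?thesis .
qed

text \<open>For fixed \<open>x\<close> this is Dynkin's formula for the reflected kernel, tested on
  the left translate of \<open>p\<close> by \<open>x\<close>.\<close>

lemma Pt_time_deriv:
  assumes t: "t > 0" and p: "hC2 p p1 p2" "bsupp p"
  shows "((\<lambda>t. Pt t p x) has_real_derivative Pt t (HL p2) x / 4) (at t)"
proof -
  note pc = hC2_cont[OF p(1)]
  have q: "hC2 (\<lambda>y. p (hmul x y)) (\<lambda>v y. p1 v (hmul x y)) (\<lambda>v y. p2 v (hmul x y))" "bsupp (\<lambda>y. p (hmul x y))"
    using hC2_left_translate[OF p(1)] bsupp_left_translate[OF p(2)] by auto
  obtain M where M: "M > 0" "\<And>y. \<bar>p (hmul x y)\<bar> \<le> M" "\<And>v y. v \<in> HD \<Longrightarrow> \<bar>p1 v (hmul x y)\<bar> \<le> M"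
      "\<And>y. \<bar>HL (\<lambda>v y. p2 v (hmul x y)) y\<bar> \<le> M"
    by (rule hC2_bsupp_bounds[OF q], rule that)
  have HLe: "HL (\<lambda>v y. p2 v (hmul x y)) y = HL p2 (hmul x y)" for y by (simp add: HL_def)
  have "((\<lambda>t. \<integral>y. rr t y * p (hmul x y) \<partial>lborel) has_real_derivative (\<integral>y. rr t y * (HL p2 (hmul x y) / 4) \<partial>lborel)) (at t)"
    using R.dynkin_deriv[OF q(1) M(2,3,4) t] unfolding HLe .
  moreover have "(\<integral>y. rr t y * (HL p2 (hmul x y) / 4) \<partial>lborel) = Pt t (HL p2) x / 4"
    using Pt_rr[OF t, of "HL p2" x] pc(4) by simp
  ultimately have "((\<lambda>t. \<integral>y. rr t y * p (hmul x y) \<partial>lborel) has_real_derivative Pt t (HL p2) x / 4) (at t)" by simp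
  then show ?thesis
    by (rule has_field_derivative_transform_within_open[of _ _ _ "{0<..}"]) (use t pc(1) in \<open>auto simp: Pt_rr\<close>)
qed

lemma Pt_lipschitz:
  assumes p: "hC2 p p1 p2" "bsupp p" and N: "\<And>x. \<bar>HL p2 x\<bar> \<le> N" and st: "s > 0" "t > 0"
  shows "\<bar>Pt t p x - Pt s p x\<bar> \<le> N * \<bar>t - s\<bar>"
proof -
  have main: "\<bar>Pt t p x - Pt s p x\<bar> \<le> N * \<bar>t - s\<bar>" if st: "0 < s" "s < t" for s t
  proof -
    have d: "((\<lambda>t. Pt t p x) has_real_derivative Pt y (HL p2) x / 4) (at y)" if "s \<le> y" for y
      by (rule Pt_time_deriv[OF _ p]) (use that st in simp)
    obtain z where z: "z > s" "z < t" "Pt t p x - Pt s p x = (t - s) * (Pt z (HL p2) x / 4)"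
      using MVT2[OF st(2), of "\<lambda>t. Pt t p x" "\<lambda>t. Pt t (HL p2) x / 4"] d by auto
    have "\<bar>Pt z (HL p2) x\<bar> \<le> N" using z st hC2_cont(4)[OF p(1)] by (intro Pt_bounds(1)[OF _ _ N]) auto
    then have "\<bar>Pt z (HL p2) x / 4\<bar> \<le> N" by simp
    then show ?thesis unfolding z(3) abs_mult using st by (simp add: mult.commute mult_left_mono)
  qed
  consider "s < t" | "t < s" | "s = t" by linarith
  then show ?thesis using main[of s t] main[of t s] st by cases (auto simp: abs_minus_commute)
qed

lemma Pt_small_time:
  assumes c: "continuous_on UNIV p" and b: "\<And>x. \<bar>p x\<bar> \<le> M"
  shows "((\<lambda>t. Pt t p x) \<longlongrightarrow> p x) (at_right 0)"
proof -
  have "continuous_on UNIV (\<lambda>y. p (hmul x (- y)))" by (intro continuous_on_compose2[OF c] continuous_intros) auto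
  from rho_approx_bounded[OF this b] show ?thesis by (simp add: Pt_def[abs_def])
qed

end

subsection \<open>Entropy along the heat flow\<close>

text \<open>The bound \<open>gradB\<close> makes \<phi>(u), which has no compact support, eligible
  for Dynkin's formula; the gradient hypothesis will supply it. Regularity of \<phi> is asked for on
  [0, M], which contains the values of the flow.\<close>

locale heat_flow = heat +
  fixes a B M :: real and p :: "H3 \<Rightarrow> real" and p1 p2 :: "H3 \<Rightarrow> H3 \<Rightarrow> real" and \<phi> \<phi>' \<phi>'' :: "real \<Rightarrow> real"
  assumes a: "a > 0" and p: "hC2 p p1 p2" and ps: "bsupp p" and p_range: "\<And>x. 0 \<le> p x" "\<And>x. p x \<le> M"
    and gradB: "\<And>t v x. 0 < t \<Longrightarrow> t < a \<Longrightarrow> v \<in> HD \<Longrightarrow> \<bar>Pt1 t p v x\<bar> \<le> B"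
    and phi: "\<And>u. u \<in> {0..M} \<Longrightarrow> (\<phi> has_real_derivative \<phi>' u) (at u)"
    and phi': "\<And>u. u \<in> {0..M} \<Longrightarrow> (\<phi>' has_real_derivative \<phi>'' u) (at u)"
    and phi''_cont: "continuous_on {0..M} \<phi>''"
begin

lemma p_abs: "\<bar>p x\<bar> \<le> M" using p_range[of x] by simp

lemma p_cont: "continuous_on UNIV p" and Lp_cont: "continuous_on UNIV (HL p2)" using hC2_cont[OF p] by auto

lemma p_meas [measurable]: "p \<in> borel_measurable borel" "HL p2 \<in> borel_measurable borel"
  using p_cont Lp_cont by auto

lemma u_range: "t > 0 \<Longrightarrow> Pt t p x \<in> {0..M}"
  using Pt_bounds(2,3)[OF _ p_meas(1) p_abs] p_range by auto

lemma phi_cont: "continuous_on {0..M} \<phi>" "continuous_on {0..M} \<phi>'"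
  by (intro continuous_at_imp_continuous_on ballI, erule DERIV_isCont[OF phi] DERIV_isCont[OF phi'])+

lemma phi_bounds: obtains K where "K > 0" "\<And>u. u \<in> {0..M} \<Longrightarrow> \<bar>\<phi> u\<bar> \<le> K" "\<And>u. u \<in> {0..M} \<Longrightarrow> \<bar>\<phi>' u\<bar> \<le> K"
   "\<And>u. u \<in> {0..M} \<Longrightarrow> \<bar>\<phi>'' u\<bar> \<le> K"
proof -
  have bd: "\<exists>k>0. \<forall>u\<in>{0..M}. \<bar>f u\<bar> \<le> k" if "continuous_on {0..M} f" for f :: "real \<Rightarrow> real"
    using compact_imp_bounded[OF compact_continuous_image[OF that compact_Icc]] unfolding bounded_pos by auto
  obtain k1 k2 k3 where k: "k1 > 0" "k2 > 0" "k3 > 0" "\<forall>u\<in>{0..M}. \<bar>\<phi> u\<bar> \<le> k1" "\<forall>u\<in>{0..M}. \<bar>\<phi>' u\<bar> \<le> k2" "\<forall>u\<in>{0..M}. \<bar>\<phi>'' u\<bar> \<le> k3"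
    using bd[OF phi_cont(1)] bd[OF phi_cont(2)] bd[OF phi''_cont] by auto
  show ?thesis by (rule that[of "k1 + k2 + k3"]) (use k in \<open>force+\<close>)
qed

lemma phi_lipschitz:
  assumes K: "\<And>u. u \<in> {0..M} \<Longrightarrow> \<bar>\<phi>' u\<bar> \<le> K" and uv: "u \<in> {0..M}" "v \<in> {0..M}"
  shows "\<bar>\<phi> u - \<phi> v\<bar> \<le> K * \<bar>u - v\<bar>"
proof -
  have main: "\<bar>\<phi> u - \<phi> v\<bar> \<le> K * \<bar>u - v\<bar>" if uv: "u \<in> {0..M}" "v \<in> {0..M}" "v < u" for u v
  proof -
    obtain z where z: "z > v" "z < u" "\<phi> u - \<phi> v = (u - v) * \<phi>' z"
      using MVT2[OF uv(3), of \<phi> \<phi>'] phi uv by auto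
    have "\<bar>\<phi>' z\<bar> \<le> K" using z uv by (intro K) auto
    then show ?thesis unfolding z(3) abs_mult using uv by (simp add: mult.commute mult_left_mono)
  qed
  consider "u < v" | "v < u" | "u = v" by linarith
  then show ?thesis using main[of u v] main[of v u] uv by cases (auto simp: abs_minus_commute)
qed

definition Phi :: "real \<Rightarrow> real" where
  "Phi s = (\<integral>x. \<rho> s x * \<phi> (Pt (a - s) p x) \<partial>lborel)"

text \<open>The second-order term of the chain rule, \<phi>''(u) |\<nabla>u|^2 / 4: the part of a
  quarter of the sub-Laplacian of \<phi>(u) that the time derivative of u does not cancel.\<close>

definition Gam :: "real \<Rightarrow> H3 \<Rightarrow> real" where
  "Gam s x = \<phi>'' (Pt (a - s) p x) * (\<Sum>v\<in>HD. (Pt1 (a - s) p v x)\<^sup>2) / 4"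

lemma phiu_meas [measurable]: "t > 0 \<Longrightarrow> (\<lambda>x. \<phi> (Pt t p x)) \<in> borel_measurable borel"
  using u_range by (intro continuous_imp_borel continuous_on_compose2[OF phi_cont(1) Pt_continuous[OF _ p_cont p_abs]]) auto

lemma Gam_cont:
  assumes s: "0 < s" "s < a" shows "continuous_on UNIV (Gam s)"
proof -
  have t: "a - s > 0" using s by simp
  show ?thesis unfolding Gam_def[abs_def]
    using u_range[OF t] hC2_cont(2)[OF Pt_hC2[OF t p_cont ps]]
    by (intro continuous_intros continuous_on_compose2[OF phi''_cont Pt_continuous[OF t p_cont p_abs]]) auto
qed

lemma Gam_bounded: obtains K where "\<And>s x. 0 < s \<Longrightarrow> s < a \<Longrightarrow> \<bar>Gam s x\<bar> \<le> K"
proof -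
  obtain K where K: "K > 0" "\<And>u. u \<in> {0..M} \<Longrightarrow> \<bar>\<phi>'' u\<bar> \<le> K" by (rule phi_bounds, rule that)
  have "\<bar>Gam s x\<bar> \<le> K * (4 * B\<^sup>2)" if s: "0 < s" "s < a" for s x
  proof -
    have "(\<Sum>v\<in>HD. (Pt1 (a - s) p v x)\<^sup>2) \<le> (\<Sum>v\<in>HD. B\<^sup>2)"
      using gradB[of "a - s" _ x] s
      by (intro sum_mono) (simp add: abs_le_square_iff[symmetric] order.trans[OF _ abs_ge_self])
    then have S: "0 \<le> (\<Sum>v\<in>HD. (Pt1 (a - s) p v x)\<^sup>2)" "(\<Sum>v\<in>HD. (Pt1 (a - s) p v x)\<^sup>2) \<le> 4 * B\<^sup>2"
      by (auto simp: card_HD intro!: sum_nonneg)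
    have "\<bar>\<phi>'' (Pt (a - s) p x)\<bar> * \<bar>\<Sum>v\<in>HD. (Pt1 (a - s) p v x)\<^sup>2\<bar> \<le> K * (4 * B\<^sup>2)"
      using S K(2)[OF u_range[of "a - s" x]] s K(1) by (intro mult_mono) auto
    moreover have "\<bar>Gam s x\<bar> = \<bar>\<phi>'' (Pt (a - s) p x)\<bar> * \<bar>\<Sum>v\<in>HD. (Pt1 (a - s) p v x)\<^sup>2\<bar> / 4"
      unfolding Gam_def by (simp add: abs_mult)
    ultimately show ?thesis by linarith
  qed
  then show ?thesis using that by blast
qed

text \<open>Product rule with two moving factors. With the integrand frozen at time
  \<open>s\<close>, Dynkin's formula gives the mean of \<open>Gam s + q\<close>, where
  \<open>q\<close> is \<phi>'(u) times a quarter of the sub-Laplacian of u. The rest,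
  \<open>Bf\<close>, contributes the mean of \<open>- q\<close>, because u solves the heat equation
  in reversed time.\<close>

lemma Phi_deriv:
  assumes s: "0 < s" "s < a"
  shows "(Phi has_real_derivative (\<integral>x. \<rho> s x * Gam s x \<partial>lborel)) (at s)"
proof -
  define t where "t = a - s"
  have t: "t > 0" "t < a" using s by (auto simp: t_def)
  obtain K where K: "K > 0" "\<And>u. u \<in> {0..M} \<Longrightarrow> \<bar>\<phi> u\<bar> \<le> K" "\<And>u. u \<in> {0..M} \<Longrightarrow> \<bar>\<phi>' u\<bar> \<le> K"
   "\<And>u. u \<in> {0..M} \<Longrightarrow> \<bar>\<phi>'' u\<bar> \<le> K" by (rule phi_bounds, rule that)
  obtain N0 where N0: "N0 > 0" "\<And>x. norm (HL p2 x) \<le> N0" by (rule bounded_bsupp[OF Lp_cont hC2_bsupp(3)[OF p ps]], rule that)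
  have N: "\<bar>HL p2 x\<bar> \<le> N0" for x using N0(2)[of x] by simp
  obtain G0 where G0: "\<And>s x. 0 < s \<Longrightarrow> s < a \<Longrightarrow> \<bar>Gam s x\<bar> \<le> G0" by (rule Gam_bounded, rule that)
  define w where "w x = \<phi> (Pt t p x)" for x
  define w1 where "w1 v x = \<phi>' (Pt t p x) * Pt1 t p v x" for v x
  define w2 where "w2 v x = \<phi>'' (Pt t p x) * (Pt1 t p v x)\<^sup>2 + \<phi>' (Pt t p x) * Pt2 t p v x" for v x
  have w: "hC2 w w1 w2" unfolding w_def w1_def w2_def
    by (rule hC2_chain[OF Pt_hC2[OF t(1) p_cont ps] u_range[OF t(1)] phi phi' phi''_cont])
  define q where "q x = \<phi>' (Pt t p x) * (Pt t (HL p2) x / 4)" for x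
  have HLw: "HL w2 x / 4 = Gam s x + q x" for x
    unfolding q_def Gam_def Pt_laplacian[OF t(1) p ps, symmetric]
    by (simp add: HL_def w2_def t_def sum.distrib sum_distrib_left field_simps)
  have Lu: "\<bar>Pt t (HL p2) x\<bar> \<le> N0" for x by (rule Pt_bounds(1)[OF t(1) p_meas(2) N])
  have qb: "\<bar>q x\<bar> \<le> K * N0" for x
  proof -
    have "\<bar>\<phi>' (Pt t p x)\<bar> * \<bar>Pt t (HL p2) x / 4\<bar> \<le> K * N0"
      using K(3)[OF u_range[OF t(1)]] Lu[of x] K(1) by (intro mult_mono) auto
    then show ?thesis by (simp add: q_def abs_mult)
  qed
  define KB KN GG where "KB = K * \<bar>B\<bar>" and "KN = K * N0" and "GG = \<bar>G0\<bar>"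
  define W where "W = K + KB + 4 * (GG + KN)"
  have WA: "0 \<le> KB" "0 \<le> KN" "0 \<le> GG" using K N0 by (auto simp: KB_def KN_def GG_def)
  have Gs: "\<bar>Gam s x\<bar> \<le> GG" for x using G0[OF s, of x] by (simp add: GG_def)
  have KW: "K \<le> W" "KB \<le> W" "4 * (GG + KN) \<le> W" using WA K(1) by (auto simp: W_def)
  have b1: "\<bar>w x\<bar> \<le> W" for x
    unfolding w_def by (rule order.trans[OF K(2)[OF u_range[OF t(1)]] KW(1)])
  have b2: "\<bar>w1 v x\<bar> \<le> W" if "v \<in> HD" for v x
  proof -
    have "\<bar>\<phi>' (Pt t p x)\<bar> * \<bar>Pt1 t p v x\<bar> \<le> K * \<bar>B\<bar>"
      using K(3)[OF u_range[OF t(1)]] gradB[OF t that, of x] K(1) by (intro mult_mono) auto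
    then show ?thesis unfolding w1_def abs_mult using KW(2) by (simp add: KB_def)
  qed
  have b3: "\<bar>HL w2 x\<bar> \<le> W" for x
  proof -
    have "HL w2 x = 4 * (Gam s x + q x)" using HLw[of x] by simp
    then have "\<bar>HL w2 x\<bar> = 4 * \<bar>Gam s x + q x\<bar>" by (simp only: abs_mult abs_numeral)
    also have "\<dots> \<le> 4 * (GG + KN)"
      using abs_triangle_ineq[of "Gam s x" "q x"] Gs[of x] qb[of x] by (simp add: KN_def)
    finally show ?thesis using KW(3) by (rule order.trans)
  qed
  have dA: "((\<lambda>s. \<integral>x. \<rho> s x * w x \<partial>lborel) has_real_derivative (\<integral>x. \<rho> s x * (HL w2 x / 4) \<partial>lborel)) (at s)"
    by (rule dynkin_deriv[OF w b1 b2 b3 s(1)])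
  have wm [measurable]: "w \<in> borel_measurable borel" unfolding w_def by (rule phiu_meas[OF t(1)])
  define Bf where "Bf s' = (\<integral>x. \<rho> s' x * (\<phi> (Pt (a - s') p x) - w x) \<partial>lborel)" for s'
  have qc: "continuous_on UNIV q" unfolding q_def using u_range[OF t(1)]
    by (intro continuous_intros continuous_on_compose2[OF phi_cont(2) Pt_continuous[OF t(1) p_cont p_abs]] Pt_continuous[OF t(1) Lp_cont N]) auto
  have qm [measurable]: "q \<in> borel_measurable borel" using qc by simp
  \<comment> \<open>Lipschitz bounds for \<phi> and for the flow in time dominate the difference
    quotients, so they may vary together with the density.\<close>
  have dB: "(Bf has_real_derivative (\<integral>x. \<rho> s x * - q x \<partial>lborel)) (at s)"
  proof -
    have "((\<lambda>y. (Bf y - Bf s) / (y - s)) \<longlongrightarrow> (\<integral>x. \<rho> s x * - q x \<partial>lborel)) (at s within {0<..<a})"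
      unfolding tendsto_at_iff_sequentially comp_def
    proof (intro allI impI)
      fix X :: "nat \<Rightarrow> real" assume X: "\<forall>i. X i \<in> {0<..<a} - {s}" and Xl: "X \<longlonglongrightarrow> s"
      have X0: "X n > 0" "X n < a" "X n \<noteq> s" "a - X n > 0" for n using X by auto
      define k where "k n x = (\<phi> (Pt (a - X n) p x) - w x) / (X n - s)" for n x
      have "(\<lambda>n. \<integral>x. \<rho> (X n) x * k n x \<partial>lborel) \<longlonglongrightarrow> (\<integral>x. \<rho> s x * - q x \<partial>lborel)"
      proof (rule r_L1_convergence[OF s(1) X0(1) Xl, where M="K * N0"])
        show "k n \<in> borel_measurable borel" for n unfolding k_def using phiu_meas[OF X0(4)] by measurable
        show "(\<lambda>x. - q x) \<in> borel_measurable borel" by measurable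
        show "\<bar>k n x\<bar> \<le> K * N0" for n x
        proof -
          have "\<bar>\<phi> (Pt (a - X n) p x) - w x\<bar> \<le> K * \<bar>Pt (a - X n) p x - Pt t p x\<bar>"
            unfolding w_def by (rule phi_lipschitz[OF K(3) u_range[OF X0(4)] u_range[OF t(1)]])
          also have "\<dots> \<le> K * (N0 * \<bar>(a - X n) - t\<bar>)"
            using Pt_lipschitz[OF p ps N t(1) X0(4)] K(1) by (intro mult_left_mono) auto
          also have "\<dots> = K * N0 * \<bar>X n - s\<bar>" by (simp add: t_def abs_minus_commute)
          finally show ?thesis unfolding k_def abs_divide using X0(3)[of n] by (simp add: field_simps)
        qed
        show "(\<lambda>n. k n x) \<longlonglongrightarrow> - q x" for x
        proof -
          have d1: "((\<lambda>s. a - s) has_real_derivative -1) (at s)" by (auto intro!: derivative_eq_intros)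
          have d2: "((\<lambda>t. Pt t p x) has_real_derivative Pt t (HL p2) x / 4) (at (a - s))"
            using Pt_time_deriv[OF t(1) p ps] by (simp add: t_def)
          have d3: "(\<phi> has_real_derivative \<phi>' (Pt t p x)) (at (Pt (a - s) p x))"
            using phi[OF u_range[OF t(1), of x]] by (simp add: t_def)
          have "((\<lambda>s. \<phi> (Pt (a - s) p x)) has_real_derivative \<phi>' (Pt t p x) * (Pt t (HL p2) x / 4 * -1)) (at s)"
            by (rule DERIV_chain2[OF d3 DERIV_chain2[OF d2 d1]])
          then have "((\<lambda>y. (\<phi> (Pt (a - y) p x) - \<phi> (Pt (a - s) p x)) / (y - s)) \<longlongrightarrow> - q x) (at s)"
            by (simp add: has_field_derivative_iff q_def)
          moreover have "filterlim X (at s) sequentially" using X0(3) Xl by (simp add: filterlim_at)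
          ultimately have "(\<lambda>n. (\<phi> (Pt (a - X n) p x) - \<phi> (Pt (a - s) p x)) / (X n - s)) \<longlonglongrightarrow> - q x"
            by (rule filterlim_compose)
          then show ?thesis by (simp add: k_def w_def t_def)
        qed
      qed
      moreover have "(\<integral>x. \<rho> (X n) x * k n x \<partial>lborel) = (Bf (X n) - Bf s) / (X n - s)" for n
        by (simp add: Bf_def k_def w_def t_def)
      ultimately show "(\<lambda>n. (Bf (X n) - Bf s) / (X n - s)) \<longlonglongrightarrow> (\<integral>x. \<rho> s x * - q x \<partial>lborel)" by simp
    qed
    moreover have "at s within {0<..<a} = at s" using s by (intro at_within_open) auto
    ultimately show ?thesis by (simp add: has_field_derivative_iff)
  qed
  have "((\<lambda>s. (\<integral>x. \<rho> s x * w x \<partial>lborel) + Bf s) has_real_derivative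
     (\<integral>x. \<rho> s x * (HL w2 x / 4) \<partial>lborel) + (\<integral>x. \<rho> s x * - q x \<partial>lborel)) (at s)"
    by (rule DERIV_add[OF dA dB])
  then have "(Phi has_real_derivative (\<integral>x. \<rho> s x * (HL w2 x / 4) \<partial>lborel) + (\<integral>x. \<rho> s x * - q x \<partial>lborel)) (at s)"
  proof (rule has_field_derivative_transform_within_open[of _ _ _ "{0<..<a}"])
    fix y assume y: "y \<in> {0<..<a}"
    then have y0: "y > 0" "a - y > 0" by auto
    have i: "integrable lborel (\<lambda>x. \<rho> y x * w x)" "integrable lborel (\<lambda>x. \<rho> y x * \<phi> (Pt (a - y) p x))"
      using integrable_r_mult[OF y0(1) wm b1] integrable_r_mult[OF y0(1) phiu_meas[OF y0(2)] K(2)[OF u_range[OF y0(2)]]] by auto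
    then show "(\<integral>x. \<rho> y x * w x \<partial>lborel) + Bf y = Phi y"
      by (simp add: Bf_def Phi_def right_diff_distrib)
  qed (use s in auto)
  moreover have "(\<integral>x. \<rho> s x * (HL w2 x / 4) \<partial>lborel) + (\<integral>x. \<rho> s x * - q x \<partial>lborel) = (\<integral>x. \<rho> s x * Gam s x \<partial>lborel)"
  proof -
    have "integrable lborel (\<lambda>x. \<rho> s x * Gam s x)" "integrable lborel (\<lambda>x. \<rho> s x * q x)"
      using integrable_r_mult[OF s(1) _ G0[OF s]] Gam_cont[OF s] integrable_r_mult[OF s(1) qm qb] by auto
    then show ?thesis unfolding HLw by (simp add: distrib_left)
  qed
  ultimately show ?thesis by simp
qed

lemma Phi_end:
  shows "(\<lambda>n. Phi (a - a / (real n + 2))) \<longlonglongrightarrow> (\<integral>x. \<rho> a x * \<phi> (p x) \<partial>lborel)"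
proof -
  define d where "d n = a / (real n + 2)" for n
  have d: "d n > 0" "d n < a" for n
    using a divide_strict_left_mono[of 1 "real n + 2" a] by (auto simp: d_def)
  have d0: "d \<longlonglongrightarrow> 0"
    using LIMSEQ_ignore_initial_segment[OF lim_const_over_n[of a], of 2] by (simp add: d_def[abs_def] add.commute)
  have fd: "filterlim d (at_right 0) sequentially" using d0 by (simp add: filterlim_at d(1) order_less_imp_not_eq2[OF d(1)])
  obtain K where K: "\<And>u. u \<in> {0..M} \<Longrightarrow> \<bar>\<phi> u\<bar> \<le> K" by (rule phi_bounds, rule that)
  have "(\<lambda>n. \<integral>x. \<rho> (a - d n) x * \<phi> (Pt (d n) p x) \<partial>lborel) \<longlonglongrightarrow> (\<integral>x. \<rho> a x * \<phi> (p x) \<partial>lborel)"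
  proof (rule r_L1_convergence[OF a])
    show "a - d n > 0" for n using d(2)[of n] by simp
    have "(\<lambda>n. a - d n) \<longlonglongrightarrow> a - 0" by (intro tendsto_intros d0)
    then show "(\<lambda>n. a - d n) \<longlonglongrightarrow> a" by simp
    show "(\<lambda>x. \<phi> (Pt (d n) p x)) \<in> borel_measurable borel" for n by (rule phiu_meas[OF d(1)])
    show "(\<lambda>x. \<phi> (p x)) \<in> borel_measurable borel"
      using p_range by (intro continuous_imp_borel continuous_on_compose2[OF phi_cont(1) p_cont]) auto
    show "\<bar>\<phi> (Pt (d n) p x)\<bar> \<le> K" for n x by (rule K[OF u_range[OF d(1)]])
    show "(\<lambda>n. \<phi> (Pt (d n) p x)) \<longlonglongrightarrow> \<phi> (p x)" for x
    proof (rule continuous_on_tendsto_compose[OF phi_cont(1)])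
      show "(\<lambda>n. Pt (d n) p x) \<longlonglongrightarrow> p x" by (rule filterlim_compose[OF Pt_small_time[OF p_cont p_abs] fd])
      show "p x \<in> {0..M}" using p_range by simp
      show "\<forall>\<^sub>F n in sequentially. Pt (d n) p x \<in> {0..M}" using u_range[OF d(1)] by (intro always_eventually) blast
    qed
  qed
  then show ?thesis by (simp add: Phi_def d_def)
qed

text \<open>The density concentrates at the identity while the integrand converges uniformly, by its
  Lipschitz bound in time.\<close>

lemma Phi_start: "(Phi \<longlongrightarrow> \<phi> (Pt a p 0)) (at_right 0)"
  unfolding tendsto_iff
proof (intro allI impI)
  fix e :: real assume e: "e > 0"
  obtain K where K: "K > 0" "\<And>u. u \<in> {0..M} \<Longrightarrow> \<bar>\<phi> u\<bar> \<le> K" "\<And>u. u \<in> {0..M} \<Longrightarrow> \<bar>\<phi>' u\<bar> \<le> K" by (rule phi_bounds, rule that)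
  obtain N0 where N0: "N0 > 0" "\<And>x. norm (HL p2 x) \<le> N0" by (rule bounded_bsupp[OF Lp_cont hC2_bsupp(3)[OF p ps]], rule that)
  have N: "\<bar>HL p2 x\<bar> \<le> N0" for x using N0(2)[of x] by simp
  define c where "c = \<phi> (Pt a p 0)"
  have "continuous_on UNIV (\<lambda>y. \<phi> (Pt a p y))"
    using u_range[OF a] by (intro continuous_on_compose2[OF phi_cont(1) Pt_continuous[OF a p_cont p_abs]]) auto
  then obtain r where r: "r > 0" "\<And>y. norm y < r \<Longrightarrow> \<bar>\<phi> (Pt a p y) - c\<bar> < e / 4"
    using e unfolding continuous_on_iff c_def by (metis UNIV_I dist_real_def dist_0_norm dist_commute divide_pos_pos zero_less_numeral)
  obtain s0 where s0: "s0 > 0" "\<And>s k \<eta>. 0 < s \<Longrightarrow> s < s0 \<Longrightarrow> k \<in> borel_measurable borel \<Longrightarrow> (\<And>y. \<bar>k y\<bar> \<le> K)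
    \<Longrightarrow> (\<And>y. norm y \<le> r/2 \<Longrightarrow> \<bar>k y - c\<bar> \<le> \<eta>) \<Longrightarrow> \<bar>(\<integral>y. \<rho> s y * k y \<partial>lborel) - c\<bar> \<le> \<eta> + e/4"
    by (rule rho_small_time[of "e/4" K "r/2" c], use e K r in simp_all)
  \<comment> \<open>The third bound limits the cost of the time shift to e/4; the modulus of
    continuity and the tail take another e/4 each.\<close>
  define s1 where "s1 = min (min s0 a) (e / (4 * (K * N0)))"
  have s1: "s1 > 0" using s0 a e K N0 by (auto simp: s1_def)
  have "dist (Phi s) c < e" if s: "0 < s" "s < s1" for s
  proof -
    have sa: "a - s > 0" "s < s0" using s by (auto simp: s1_def)
    have "K * N0 * s \<le> K * N0 * (e / (4 * (K * N0)))" using s K N0 by (intro mult_left_mono) (auto simp: s1_def)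
    also have "\<dots> = e / 4" using K N0 by simp
    finally have sm: "K * N0 * s \<le> e / 4" .
    have "\<bar>(\<integral>y. \<rho> s y * \<phi> (Pt (a - s) p y) \<partial>lborel) - c\<bar> \<le> (e/4 + e/4) + e/4"
    proof (rule s0(2)[OF s(1) sa(2) phiu_meas[OF sa(1)] K(2)[OF u_range[OF sa(1)]]])
      fix y :: H3 assume y: "norm y \<le> r/2"
      have "\<bar>\<phi> (Pt (a - s) p y) - \<phi> (Pt a p y)\<bar> \<le> K * \<bar>Pt (a - s) p y - Pt a p y\<bar>"
        by (rule phi_lipschitz[OF K(3) u_range[OF sa(1)] u_range[OF a]])
      also have "\<dots> \<le> K * (N0 * \<bar>(a - s) - a\<bar>)" using Pt_lipschitz[OF p ps N a sa(1)] K(1) by (intro mult_left_mono) auto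
      also have "\<dots> \<le> e / 4" using sm s by (simp add: mult.assoc)
      finally have "\<bar>\<phi> (Pt (a - s) p y) - \<phi> (Pt a p y)\<bar> \<le> e / 4" .
      moreover have "\<bar>\<phi> (Pt a p y) - c\<bar> < e / 4" using y r by (intro r(2)) simp
      ultimately show "\<bar>\<phi> (Pt (a - s) p y) - c\<bar> \<le> e/4 + e/4" by linarith
    qed
    then show ?thesis using e by (simp add: Phi_def dist_real_def)
  qed
  then show "\<forall>\<^sub>F s in at_right 0. dist (Phi s) (\<phi> (Pt a p 0)) < e"
    unfolding eventually_at_right_field c_def[symmetric] using s1 by blast
qed

lemma Phi_le:
  assumes C: "\<And>s. 0 < s \<Longrightarrow> s < a \<Longrightarrow> (\<integral>x. \<rho> s x * Gam s x \<partial>lborel) \<le> C"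
  shows "0 < s \<Longrightarrow> s < a \<Longrightarrow> (\<integral>x. \<rho> a x * \<phi> (p x) \<partial>lborel) - Phi s \<le> C * (a - s)"
    and "(\<integral>x. \<rho> a x * \<phi> (p x) \<partial>lborel) - \<phi> (Pt a p 0) \<le> C * a"
proof -
  have step: "Phi s2 - Phi s1 \<le> C * (s2 - s1)" if s: "0 < s1" "s1 < s2" "s2 < a" for s1 s2
  proof -
    have "(Phi has_real_derivative (\<integral>x. \<rho> y x * Gam y x \<partial>lborel)) (at y)" if "s1 \<le> y" "y \<le> s2" for y
      using that s by (intro Phi_deriv) auto
    then obtain z where z: "z > s1" "z < s2" "Phi s2 - Phi s1 = (s2 - s1) * (\<integral>x. \<rho> z x * Gam z x \<partial>lborel)"
      using MVT2[OF s(2), of Phi "\<lambda>y. \<integral>x. \<rho> y x * Gam y x \<partial>lborel"] by auto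
    show ?thesis unfolding z(3) using C[of z] z s by (simp add: mult.commute mult_left_mono)
  qed
  show 1: "(\<integral>x. \<rho> a x * \<phi> (p x) \<partial>lborel) - Phi s \<le> C * (a - s)" if s: "0 < s" "s < a" for s
  proof -
    define d where "d n = a / (real n + 2)" for n
    have d: "d n > 0" "d n < a" for n
    using a divide_strict_left_mono[of 1 "real n + 2" a] by (auto simp: d_def)
    have d0: "d \<longlonglongrightarrow> 0"
      using LIMSEQ_ignore_initial_segment[OF lim_const_over_n[of a], of 2] by (simp add: d_def[abs_def] add.commute)
    have A: "(\<lambda>n. Phi (a - d n) - Phi s) \<longlonglongrightarrow> (\<integral>x. \<rho> a x * \<phi> (p x) \<partial>lborel) - Phi s"
      using Phi_end by (intro tendsto_intros) (simp add: d_def)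
    have "(\<lambda>n. C * (a - d n - s)) \<longlonglongrightarrow> C * (a - 0 - s)" by (intro tendsto_intros d0)
    then have B: "(\<lambda>n. C * (a - d n - s)) \<longlonglongrightarrow> C * (a - s)" by simp
    have "\<forall>\<^sub>F n in sequentially. d n < a - s" using s by (intro order_tendstoD(2)[OF d0]) simp
    then have "\<forall>\<^sub>F n in sequentially. Phi (a - d n) - Phi s \<le> C * (a - d n - s)"
      by eventually_elim (rule step, use s d in auto)
    then show ?thesis by (rule tendsto_le[OF trivial_limit_sequentially B A])
  qed
  have A: "((\<lambda>s. (\<integral>x. \<rho> a x * \<phi> (p x) \<partial>lborel) - Phi s) \<longlongrightarrow> (\<integral>x. \<rho> a x * \<phi> (p x) \<partial>lborel) - \<phi> (Pt a p 0)) (at_right 0)"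
    by (intro tendsto_intros Phi_start)
  have "((\<lambda>s. C * (a - s)) \<longlongrightarrow> C * (a - 0)) (at_right 0)" by (intro tendsto_intros)
  then have B: "((\<lambda>s. C * (a - s)) \<longlongrightarrow> C * a) (at_right 0)" by simp
  have "\<forall>\<^sub>F s in at_right 0. (\<integral>x. \<rho> a x * \<phi> (p x) \<partial>lborel) - Phi s \<le> C * (a - s)"
    unfolding eventually_at_right_field using 1 a by (intro exI[of _ a]) auto
  then show "(\<integral>x. \<rho> a x * \<phi> (p x) \<partial>lborel) - \<phi> (Pt a p 0) \<le> C * a"
    by (rule tendsto_le[OF trivial_limit_at_right_real B A])
qed

end

text \<open>For linear \<phi> the dissipation \<open>Gam\<close> vanishes. The comparison
  \<open>Phi_le\<close> is one-sided, hence it is used for u and for -u.\<close>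

lemma (in heat) heat_flow_invariant:
  assumes a: "a > 0" and p: "hC2 p p1 p2" "bsupp p" "\<And>x. 0 \<le> p x" "\<And>x. p x \<le> M"
    and g: "\<And>t v x. 0 < t \<Longrightarrow> t < a \<Longrightarrow> v \<in> HD \<Longrightarrow> \<bar>Pt1 t p v x\<bar> \<le> B"
  shows "0 < s \<Longrightarrow> s < a \<Longrightarrow> (\<integral>x. \<rho> s x * Pt (a - s) p x \<partial>lborel) = (\<integral>x. \<rho> a x * p x \<partial>lborel)"
    and "Pt a p 0 = (\<integral>x. \<rho> a x * p x \<partial>lborel)"
proof -
  interpret I: heat_flow \<rho> a B M p p1 p2 "\<lambda>u. u" "\<lambda>u. 1" "\<lambda>u. 0"
    by unfold_locales (use a p g in auto)
  interpret J: heat_flow \<rho> a B M p p1 p2 "\<lambda>u. - u" "\<lambda>u. -1" "\<lambda>u. 0"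
    by unfold_locales (use a p g in \<open>auto intro!: derivative_eq_intros\<close>)
  have "(\<integral>x. \<rho> s x * I.Gam s x \<partial>lborel) \<le> 0" "(\<integral>x. \<rho> s x * J.Gam s x \<partial>lborel) \<le> 0" for s
    by (simp_all add: I.Gam_def J.Gam_def)
  note i = I.Phi_le[OF this(1)] and j = J.Phi_le[OF this(2)]
  show "0 < s \<Longrightarrow> s < a \<Longrightarrow> (\<integral>x. \<rho> s x * Pt (a - s) p x \<partial>lborel) = (\<integral>x. \<rho> a x * p x \<partial>lborel)"
    using i(1)[of s] j(1)[of s] by (simp add: I.Phi_def J.Phi_def)
  show "Pt a p 0 = (\<integral>x. \<rho> a x * p x \<partial>lborel)" using i(2) j(2) by simp
qed

section \<open>The gradient hypothesis on real test functions\<close>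

definition rgrad :: "(H3 \<Rightarrow> real) \<Rightarrow> H3 \<Rightarrow> real" where
  "rgrad q x = sqrt (\<Sum>v\<in>HD. (lvf v q x)\<^sup>2)"

lemma C1c_of_real:
  assumes q: "Ck 2 q" "bsupp q"
  shows "C1c (\<lambda>x. complex_of_real (q x))"
proof -
  obtain q' where q': "\<And>x. (q has_derivative q' x) (at x)" "\<And>u. Ck 1 (\<lambda>x. q' x u)"
    using q(1) unfolding numeral_2_eq_2 One_nat_def Ck.simps(2)[of "Suc 0"] by blast
  have d: "((\<lambda>x. complex_of_real (q x)) has_derivative (\<lambda>u. complex_of_real (q' x u))) (at x)" for x
    by (rule bounded_linear.has_derivative[OF bounded_linear_of_real q'(1)])
  have f: "frechet_derivative (\<lambda>x. complex_of_real (q x)) (at x) = (\<lambda>u. complex_of_real (q' x u))" for x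
    using frechet_derivative_at[OF d] by simp
  have "bsupp (\<lambda>x. complex_of_real (q x))" using q(2) by (auto simp: bsupp_def)
  then show ?thesis unfolding C1c_def f compact_supp_bsupp using d Ck_continuous[OF q'(2)]
    by (intro conjI allI continuous_on_of_real) (auto simp: differentiable_def intro!: exI)
qed

lemma rgrad_cont: assumes "Ck 2 q" shows "continuous_on UNIV (rgrad q)"
  unfolding rgrad_def[abs_def] using hC2_cont(2)[OF Ck_hC2[OF assms]]
  by (intro continuous_on_real_sqrt continuous_on_sum continuous_on_power) auto

lemma rgrad_bsupp: assumes "Ck 2 q" "bsupp q" shows "bsupp (rgrad q)"
proof -
  have "bsupp (\<lambda>x. \<Sum>v\<in>HD. (lvf v q x)\<^sup>2)" unfolding power2_eq_square
    using hC2_bsupp(1)[OF Ck_hC2[OF assms(1)] assms(2)] by (intro bsupp_sum bsupp_mult_left) auto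
  then obtain R where "\<And>x. R < norm x \<Longrightarrow> (\<Sum>v\<in>HD. (lvf v q x)\<^sup>2) = 0" by (auto simp: bsupp_def)
  then show ?thesis unfolding bsupp_def rgrad_def by (intro exI[of _ R]) simp
qed

locale heat_gradient = heat +
  fixes K :: real
  assumes grad_bound: "\<forall>t\<ge>0. \<forall>g::H3 \<Rightarrow> complex. C1c g \<longrightarrow>
           (\<forall>x. gradnorm (heatsg \<rho> t g) x \<le> K * heatsg \<rho> t (gradnorm g) x)"
begin

lemma gradient_bound_real:
  assumes q: "Ck 2 q" "bsupp q" and t: "t > 0"
  shows "sqrt (\<Sum>v\<in>HD. (Pt1 t q v x)\<^sup>2) \<le> K * Pt t (rgrad q) x"
proof -
  have qc: "continuous_on UNIV q" by (rule Ck_continuous[OF q(1)])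
  have hs: "heatsg \<rho> t (\<lambda>x. complex_of_real (q x)) x = complex_of_real (Pt t q x)" for x
  proof -
    have "continuous_on UNIV (\<lambda>y. \<rho> t y * q (hmul x (- y)))"
      by (intro continuous_intros rho_cont[OF t] continuous_on_compose2[OF qc]) auto
    then have "continuous_on UNIV (\<lambda>y. complex_of_real (\<rho> t y * q (hmul x (- y))))" by (rule continuous_on_of_real)
    then have m: "(\<lambda>y. complex_of_real (\<rho> t y * q (hmul x (- y)))) \<in> borel_measurable lborel"
      using continuous_imp_borel by (simp only: measurable_lborel2 measurable_lborel1)
    have "heatsg \<rho> t (\<lambda>x. complex_of_real (q x)) x = (\<integral>y. complex_of_real (\<rho> t y * q (hmul x (- y))) \<partial>lebesgue)"
      using t by (simp add: heatsg_def hinv_def scaleR_conv_of_real)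
    also have "\<dots> = (\<integral>y. complex_of_real (\<rho> t y * q (hmul x (- y))) \<partial>lborel)" by (rule integral_completion[OF m])
    also have "\<dots> = complex_of_real (Pt t q x)" unfolding Pt_def by (rule integral_complex_of_real)
    finally show ?thesis .
  qed
  have l: "lvf v (\<lambda>x. complex_of_real (Pt t q x)) = (\<lambda>x. complex_of_real (Pt1 t q v x))" if "v \<in> HD" for v
    by (rule lvf_eq_hder[OF hder_linear[OF bounded_linear_of_real hC2D(1)[OF Pt_hC2[OF t qc q(2)] that]]])
  have lq: "lvf v (\<lambda>x. complex_of_real (q x)) = (\<lambda>x. complex_of_real (lvf v q x))" if "v \<in> HD" for v
    by (rule lvf_eq_hder[OF hder_linear[OF bounded_linear_of_real hC2D(1)[OF Ck_hC2[OF q(1)] that]]])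
  have g1: "gradnorm (heatsg \<rho> t (\<lambda>x. complex_of_real (q x))) x = sqrt (\<Sum>v\<in>HD. (Pt1 t q v x)\<^sup>2)"
    unfolding gradnorm_def sum_list_hdirs hs[abs_def] by (simp add: l cong: sum.cong)
  have g2: "gradnorm (\<lambda>x. complex_of_real (q x)) = rgrad q"
    unfolding gradnorm_def sum_list_hdirs rgrad_def by (rule ext) (simp add: lq cong: sum.cong)
  have g3: "heatsg \<rho> t (rgrad q) x = Pt t (rgrad q) x"
  proof -
    have "continuous_on UNIV (\<lambda>y. \<rho> t y * rgrad q (hmul x (- y)))"
      by (intro continuous_intros rho_cont[OF t] continuous_on_compose2[OF rgrad_cont[OF q(1)]]) auto
    then have "(\<lambda>y. \<rho> t y * rgrad q (hmul x (- y))) \<in> borel_measurable lborel" by simp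
    from integral_completion[OF this] show ?thesis using t by (simp add: heatsg_def hinv_def Pt_def)
  qed
  have "gradnorm (heatsg \<rho> t (\<lambda>x. complex_of_real (q x))) x \<le> K * heatsg \<rho> t (gradnorm (\<lambda>x. complex_of_real (q x))) x"
    using grad_bound C1c_of_real[OF q] t by auto
  then show ?thesis unfolding g1 g2 g3 .
qed

text \<open>The source of \<open>gradB\<close>: averaging does not increase the supremum of
  |\<nabla>q|, so the gradient estimate is uniform in time.\<close>

lemma gradient_uniform:
  assumes q: "Ck 2 q" "bsupp q"
  obtains B where "\<And>t v x. 0 < t \<Longrightarrow> v \<in> HD \<Longrightarrow> \<bar>Pt1 t q v x\<bar> \<le> B"
proof -
  obtain G where G: "G > 0" "\<And>x. norm (rgrad q x) \<le> G"
    by (rule bounded_bsupp[OF rgrad_cont[OF q(1)] rgrad_bsupp[OF q]], rule that)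
  have G': "\<bar>rgrad q x\<bar> \<le> G" for x using G(2)[of x] by simp
  have "\<bar>Pt1 t q v x\<bar> \<le> \<bar>K\<bar> * G" if t: "0 < t" and v: "v \<in> HD" for t v x
  proof -
    have "\<bar>Pt1 t q v x\<bar> = sqrt ((Pt1 t q v x)\<^sup>2)" by simp
    also have "\<dots> \<le> sqrt (\<Sum>v\<in>HD. (Pt1 t q v x)\<^sup>2)" using v by (intro real_sqrt_le_mono member_le_sum) auto
    also have "\<dots> \<le> K * Pt t (rgrad q) x" by (rule gradient_bound_real[OF q t])
    also have "\<dots> \<le> \<bar>K\<bar> * \<bar>Pt t (rgrad q) x\<bar>" using abs_ge_self[of "K * Pt t (rgrad q) x"] by (simp add: abs_mult)
    also have "\<dots> \<le> \<bar>K\<bar> * G" using rgrad_cont[OF q(1)] by (intro mult_left_mono Pt_bounds(1)[OF t _ G']) auto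
    finally show ?thesis .
  qed
  then show ?thesis using that by blast
qed

end

section \<open>The inequality for test functions\<close>

text \<open>The delicate point is 0, where the product is 0 and |y ln y| is squeezed by 2 sqrt
  y.\<close>

lemma xlnx_cont: "continuous_on {0..} (\<lambda>x::real. x * ln x)"
  unfolding continuous_on_eq_continuous_within
proof
  fix x :: real assume "x \<in> {0..}"
  then consider "x > 0" | "x = 0" by fastforce
  then show "continuous (at x within {0..}) (\<lambda>x::real. x * ln x)"
  proof cases
    case 1
    then have "isCont (\<lambda>x::real. x * ln x) x" by (intro continuous_intros) auto
    then show ?thesis by (rule continuous_at_imp_continuous_at_within)
  next
    case 2
    have b: "\<bar>y * ln y\<bar> \<le> 2 * sqrt y" if y: "0 \<le> y" "y \<le> 1" for y :: real
    proof (cases "y = 0")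
      case False
      then have y0: "y > 0" using y by simp
      have s: "sqrt y > 0" "sqrt y * sqrt y = y" using y0 by auto
      have "ln (1 / sqrt y) \<le> 1 / sqrt y - 1" using s by (intro ln_le_minus_one) auto
      then have "- ln y \<le> 2 * (1 / sqrt y)" using y0 by (simp add: ln_div ln_sqrt)
      then have "y * - ln y \<le> y * (2 * (1 / sqrt y))" using y0 by (intro mult_left_mono) auto
      also have "\<dots> = 2 * sqrt y" using s by (simp add: field_simps)
      finally show ?thesis using y y0 by (simp add: abs_mult)
    qed simp
    have "((\<lambda>y. 2 * sqrt y) \<longlongrightarrow> 2 * sqrt 0) (at 0 within {0..})" by (intro tendsto_intros)
    then have z: "((\<lambda>y. 2 * sqrt y) \<longlongrightarrow> 0) (at 0 within {0..})" by simp
    have "((\<lambda>y::real. y * ln y) \<longlongrightarrow> 0) (at 0 within {0..})"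
    proof (rule Lim_null_comparison[OF _ z])
      show "\<forall>\<^sub>F y in at 0 within {0..}. norm (y * ln y) \<le> 2 * sqrt y"
        unfolding eventually_at by (rule exI[of _ 1]) (use b in \<open>auto simp: dist_real_def\<close>)
    qed
    then show ?thesis using 2 by (simp add: continuous_within)
  qed
qed

text \<open>The infimum of \<alpha> A + D/\<alpha> over \<alpha> > 0 is 2 sqrt (A D), not attained
  when D = 0. In this form the Cauchy-Schwarz inequality for an average needs only linearity and
  monotonicity of the average.\<close>

lemma quadratic_from_linear_family:
  fixes x A D :: real
  assumes h: "\<And>\<alpha>. \<alpha> > 0 \<Longrightarrow> x \<le> \<alpha> * A + D / \<alpha>" and A: "A > 0" and D: "D \<ge> 0" and x: "x \<ge> 0"
  shows "x\<^sup>2 \<le> 4 * A * D"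
proof (cases "D = 0")
  case True
  have "x \<le> 0"
  proof (rule field_le_epsilon)
    fix e :: real assume "e > 0"
    then show "x \<le> 0 + e" using h[of "e / A"] A True by simp
  qed
  then show ?thesis using x True by simp
next
  case False
  define r where "r = sqrt (D / A)"
  have r: "r > 0" "r\<^sup>2 = D / A" using A D False by (auto simp: r_def)
  have "r * A + D / r = 2 * r * A"
  proof -
    have "D = r * r * A" using r A by (simp add: power2_eq_square field_simps)
    then show ?thesis using r(1) by (simp add: field_simps)
  qed
  then have "x \<le> 2 * r * A" using h[OF r(1)] by linarith
  then have "x\<^sup>2 \<le> (2 * r * A)\<^sup>2" using x by (intro power_mono)
  also have "\<dots> = 4 * A * D" using r A by (simp add: power_mult_distrib power2_eq_square field_simps)
  finally show ?thesis .
qed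

text \<open>The square of \<open>gradnorm\<close>: without the root it keeps the regularity of the
  derivatives of \<open>f\<close>, so it can itself be transported by the heat flow.\<close>

definition hnrg :: "(H3 \<Rightarrow> complex) \<Rightarrow> H3 \<Rightarrow> real" where
  "hnrg f x = (\<Sum>v\<in>HD. (cmod (lvf v f x))\<^sup>2)"

lemma Ck_cmod2:
  fixes f :: "H3 \<Rightarrow> complex"
  assumes "Ck n f" shows "Ck n (\<lambda>x. (cmod (f x))\<^sup>2)"
proof -
  have "Ck n (\<lambda>x. Re (f x) * Re (f x) + Im (f x) * Im (f x))"
    by (intro Ck_add Ck_bilinear[OF bounded_bilinear_mult] Ck_linear[OF bounded_linear_Re] Ck_linear[OF bounded_linear_Im] assms)
  then show ?thesis unfolding cmod_power2 unfolding power2_eq_square .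
qed

lemma Ck_hnrg:
  assumes "Ck (Suc n) f" shows "Ck n (hnrg f)"
  unfolding hnrg_def[abs_def] by (intro Ck_sum Ck_cmod2 Ck_lvf(2)[OF assms]) auto

lemma bsupp_lvf: "Ck (Suc n) f \<Longrightarrow> bsupp f \<Longrightarrow> bsupp (lvf v f)"
  by (rule hder_bsupp[OF Ck_lvf(1)])

lemma bsupp_cmod2:
  fixes f :: "H3 \<Rightarrow> complex"
  shows "bsupp f \<Longrightarrow> bsupp (\<lambda>x. (cmod (f x))\<^sup>2)"
  unfolding bsupp_def by auto

lemma bsupp_hnrg: "Ck (Suc n) f \<Longrightarrow> bsupp f \<Longrightarrow> bsupp (hnrg f)"
  unfolding hnrg_def[abs_def] by (intro bsupp_sum bsupp_cmod2 bsupp_lvf) auto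

lemma lvf_cmod2:
  assumes "Ck (Suc n) f"
  shows "\<bar>lvf v (\<lambda>x. (cmod (f x))\<^sup>2) x\<bar> \<le> 2 * cmod (f x) * cmod (lvf v f x)"
proof -
  note f = Ck_lvf(1)[OF assms, of v]
  have "hder v (\<lambda>x. f x \<bullet> f x) (\<lambda>x. lvf v f x \<bullet> f x + f x \<bullet> lvf v f x)"
    by (rule hder_bilinear[OF bounded_bilinear_inner f f])
  then have "lvf v (\<lambda>x. f x \<bullet> f x) = (\<lambda>x. lvf v f x \<bullet> f x + f x \<bullet> lvf v f x)" by (rule lvf_eq_hder)
  then have "lvf v (\<lambda>x. (cmod (f x))\<^sup>2) x = 2 * (f x \<bullet> lvf v f x)"
    by (simp add: dot_square_norm inner_commute)
  then show ?thesis using Cauchy_Schwarz_ineq2[of "f x" "lvf v f x"] by (simp add: abs_mult)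
qed

lemma rgrad_cmod2:
  assumes "Ck (Suc n) f"
  shows "rgrad (\<lambda>x. (cmod (f x))\<^sup>2) x \<le> 2 * cmod (f x) * sqrt (hnrg f x)"
proof -
  have "(\<Sum>v\<in>HD. (lvf v (\<lambda>x. (cmod (f x))\<^sup>2) x)\<^sup>2) \<le> (\<Sum>v\<in>HD. (2 * cmod (f x) * cmod (lvf v f x))\<^sup>2)"
  proof (rule sum_mono)
    fix v
    show "(lvf v (\<lambda>x. (cmod (f x))\<^sup>2) x)\<^sup>2 \<le> (2 * cmod (f x) * cmod (lvf v f x))\<^sup>2"
      using lvf_cmod2[OF assms, of v x] by (simp add: abs_le_square_iff[symmetric])
  qed
  also have "\<dots> = (2 * cmod (f x))\<^sup>2 * hnrg f x" by (simp add: hnrg_def sum_distrib_left power_mult_distrib)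
  finally show ?thesis unfolding rgrad_def
    using real_sqrt_le_mono by (fastforce simp: real_sqrt_mult real_sqrt_abs)
qed

context heat_gradient
begin

text \<open>The shift \<epsilon> keeps \<phi>''(u) = 1/(u + \<epsilon>) continuous up to u = 0.
  Three derivatives of \<open>f\<close> are asked for because \<open>hnrg f\<close> is also carried
  along the flow and must be C^2.\<close>

lemma lsi_regularised:
  fixes f :: "H3 \<Rightarrow> complex"
  assumes f: "Ck 3 f" "bsupp f" and a: "a > 0" and \<epsilon>: "\<epsilon> > 0"
  defines "q \<equiv> \<lambda>x. (cmod (f x))\<^sup>2"
  defines "N \<equiv> \<integral>x. \<rho> a x * q x \<partial>lborel"
  shows "(\<integral>x. \<rho> a x * ((q x + \<epsilon>) * ln (q x + \<epsilon>)) \<partial>lborel) - (N + \<epsilon>) * ln (N + \<epsilon>)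
     \<le> K\<^sup>2 * (\<integral>x. \<rho> a x * hnrg f x \<partial>lborel) * a"
proof -
  have f3: "Ck (Suc 2) f" using f(1) by (simp add: numeral_3_eq_3)
  have f2: "Ck 2 f" by (rule Ck_Suc_imp[OF f3])
  have q: "Ck 2 q" "bsupp q" unfolding q_def using Ck_cmod2[OF f2] bsupp_cmod2[OF f(2)] by auto
  have k: "Ck 2 (hnrg f)" "bsupp (hnrg f)" using Ck_hnrg[OF f3] bsupp_hnrg[OF f3 f(2)] by auto
  have qc: "continuous_on UNIV q" "continuous_on UNIV (hnrg f)" using q k Ck_continuous by auto
  have qm [measurable]: "q \<in> borel_measurable borel" "hnrg f \<in> borel_measurable borel" using qc by auto
  have q0: "0 \<le> q x" "0 \<le> hnrg f x" for x by (auto simp: q_def hnrg_def intro!: sum_nonneg)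
  obtain M where M: "M > 0" "\<And>x. norm (q x) \<le> M" by (rule bounded_bsupp[OF qc(1) q(2)], rule that)
  obtain Mk where Mk: "Mk > 0" "\<And>x. norm (hnrg f x) \<le> Mk" by (rule bounded_bsupp[OF qc(2) k(2)], rule that)
  have qM: "\<bar>q x\<bar> \<le> M" "q x \<le> M" for x using M(2)[of x] q0(1)[of x] by auto
  have kM: "\<bar>hnrg f x\<bar> \<le> Mk" "hnrg f x \<le> Mk" for x using Mk(2)[of x] q0(2)[of x] by auto
  obtain B where B: "\<And>t v x. 0 < t \<Longrightarrow> v \<in> HD \<Longrightarrow> \<bar>Pt1 t q v x\<bar> \<le> B" by (rule gradient_uniform[OF q], rule that)
  obtain Bk where Bk: "\<And>t v x. 0 < t \<Longrightarrow> v \<in> HD \<Longrightarrow> \<bar>Pt1 t (hnrg f) v x\<bar> \<le> Bk" by (rule gradient_uniform[OF k], rule that)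
  interpret I: heat_flow \<rho> a B M q "\<lambda>v. lvf v q" "\<lambda>v. lvf v (lvf v q)" "\<lambda>u. (u + \<epsilon>) * ln (u + \<epsilon>)" "\<lambda>u. ln (u + \<epsilon>) + 1" "\<lambda>u. 1 / (u + \<epsilon>)"
  proof
    show "hC2 q (\<lambda>v. lvf v q) (\<lambda>v. lvf v (lvf v q))" by (rule Ck_hC2[OF q(1)])
    show "((\<lambda>u. (u + \<epsilon>) * ln (u + \<epsilon>)) has_real_derivative ln (u + \<epsilon>) + 1) (at u)" if "u \<in> {0..M}" for u
      using that \<epsilon> by (auto intro!: derivative_eq_intros)
    show "((\<lambda>u. ln (u + \<epsilon>) + 1) has_real_derivative 1 / (u + \<epsilon>)) (at u)" if "u \<in> {0..M}" for u
      using that \<epsilon> by (auto intro!: derivative_eq_intros)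
    show "continuous_on {0..M} (\<lambda>u. 1 / (u + \<epsilon>))" using \<epsilon> by (auto intro!: continuous_intros)
  qed (use a q q0 qM B in auto)
  have inv_q: "Pt a q 0 = N" unfolding N_def
    by (rule heat_flow_invariant(2)[OF a Ck_hC2[OF q(1)] q(2) q0(1) qM(2) B])
  have inv_k: "(\<integral>x. \<rho> s x * Pt (a - s) (hnrg f) x \<partial>lborel) = (\<integral>x. \<rho> a x * hnrg f x \<partial>lborel)" if "0 < s" "s < a" for s
    by (rule heat_flow_invariant(1)[OF a Ck_hC2[OF k(1)] k(2) q0(2) kM(2) Bk that])
  \<comment> \<open>Cauchy-Schwarz in linear form: |\<nabla>q| \<le> 2 |f| |\<nabla>f| \<le>
    \<alpha> q + |\<nabla>f|^2/\<alpha> for every \<alpha>, averaged by \<open>Pt\<close> and then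
    optimised separately at each point.\<close>
  have Gam: "I.Gam s x \<le> K\<^sup>2 * Pt (a - s) (hnrg f) x" if s: "0 < s" "s < a" for s x
  proof -
    define t where "t = a - s"
    have t: "t > 0" using s by (simp add: t_def)
    define S where "S = (\<Sum>v\<in>HD. (Pt1 t q v x)\<^sup>2)"
    have S0: "S \<ge> 0" by (auto simp: S_def intro!: sum_nonneg)
    \<comment> \<open>Adding \<epsilon> makes A positive and equal to the denominator of
      \<phi>''.\<close>
    define A where "A = Pt t q x + \<epsilon>"
    have A: "A > 0" using I.u_range[OF t, of x] \<epsilon> by (simp add: A_def)
    define D where "D = Pt t (hnrg f) x"
    have D: "D \<ge> 0" unfolding D_def by (rule Pt_bounds(3)[OF t qm(2) kM(1) q0(2)])
    have fam: "sqrt S \<le> \<alpha> * (\<bar>K\<bar> * A) + (\<bar>K\<bar> * D) / \<alpha>" if al: "\<alpha> > 0" for \<alpha>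
    proof -
      have le: "rgrad q y \<le> \<alpha> * q y + hnrg f y / \<alpha>" for y
      proof -
        have "rgrad q y \<le> 2 * cmod (f y) * sqrt (hnrg f y)" unfolding q_def by (rule rgrad_cmod2[OF f3])
        also have "\<dots> \<le> \<alpha> * q y + hnrg f y / \<alpha>"
        proof -
          have "0 \<le> (\<alpha> * cmod (f y) - sqrt (hnrg f y))\<^sup>2 / \<alpha>" using al by simp
          also have "\<dots> = \<alpha> * q y + hnrg f y / \<alpha> - 2 * cmod (f y) * sqrt (hnrg f y)"
          proof -
            have "(\<alpha> * cmod (f y) - sqrt (hnrg f y))\<^sup>2 = \<alpha>\<^sup>2 * q y + hnrg f y - 2 * \<alpha> * cmod (f y) * sqrt (hnrg f y)"
              using q0(2)[of y] by (simp add: power2_diff power_mult_distrib q_def)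
            then show ?thesis using al by (simp add: field_simps power2_eq_square)
          qed
          finally show ?thesis by simp
        qed
        finally show ?thesis .
      qed
      have r0: "0 \<le> rgrad q y" for y by (auto simp: rgrad_def intro!: real_sqrt_ge_zero sum_nonneg)
      have cb: "\<bar>\<alpha> * q y + hnrg f y / \<alpha>\<bar> \<le> \<alpha> * M + Mk / \<alpha>" for y
      proof -
        have "0 \<le> \<alpha> * q y + hnrg f y / \<alpha>" using al q0[of y] by simp
        moreover have "\<alpha> * q y + hnrg f y / \<alpha> \<le> \<alpha> * M + Mk / \<alpha>"
          using al qM(2)[of y] kM(2)[of y] by (intro add_mono mult_left_mono divide_right_mono) auto
        ultimately show ?thesis by simp
      qed
      have rb: "\<bar>rgrad q y\<bar> \<le> \<alpha> * M + Mk / \<alpha>" for y using le[of y] cb[of y] r0[of y] by simp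
      have "Pt t (rgrad q) x \<le> Pt t (\<lambda>y. \<alpha> * q y + hnrg f y / \<alpha>) x"
        by (rule Pt_mono[OF t _ rb _ cb le]) (use rgrad_cont[OF q(1)] in simp_all)
      also have "\<dots> = \<alpha> * Pt t q x + D / \<alpha>"
      proof -
        have "\<rho> t y * (\<alpha> * q (hmul x (- y)) + hnrg f (hmul x (- y)) / \<alpha>)
          = \<alpha> * (\<rho> t y * q (hmul x (- y))) + \<rho> t y * hnrg f (hmul x (- y)) / \<alpha>" for y by (simp add: algebra_simps)
        then show ?thesis unfolding Pt_def D_def
          using Pt_integrable[OF t qm(1) qM(1), of x] Pt_integrable[OF t qm(2) kM(1), of x] by simp
      qed
      finally have P: "Pt t (rgrad q) x \<le> \<alpha> * Pt t q x + D / \<alpha>" .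
      have P0: "0 \<le> Pt t (rgrad q) x" by (rule Pt_bounds(3)[OF t _ rb r0]) (use rgrad_cont[OF q(1)] in simp)
      have "sqrt S \<le> K * Pt t (rgrad q) x" unfolding S_def by (rule gradient_bound_real[OF q t])
      also have "\<dots> \<le> \<bar>K\<bar> * Pt t (rgrad q) x" using P0 by (intro mult_right_mono) auto
      also have "\<dots> \<le> \<bar>K\<bar> * (\<alpha> * A + D / \<alpha>)"
      proof (intro mult_left_mono)
        have "\<alpha> * Pt t q x \<le> \<alpha> * A" using al \<epsilon> by (intro mult_left_mono) (auto simp: A_def)
        then show "Pt t (rgrad q) x \<le> \<alpha> * A + D / \<alpha>" using P by linarith
      qed simp
      finally show ?thesis by (simp add: algebra_simps)
    qed
    have "S \<le> 4 * K\<^sup>2 * A * D"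
    proof (cases "K = 0")
      case True
      then have "sqrt S \<le> 0" using fam[of 1] by simp
      then show ?thesis using S0 True by simp
    next
      case False
      have "(sqrt S)\<^sup>2 \<le> 4 * (\<bar>K\<bar> * A) * (\<bar>K\<bar> * D)"
        by (rule quadratic_from_linear_family[OF fam]) (use False A D S0 in auto)
      then show ?thesis using S0 by (simp add: power2_eq_square mult_ac)
    qed
    \<comment> \<open>The factor 4 from squaring 2 sqrt (A D) cancels the 1/4 in
      \<open>Gam\<close>.\<close>
    then have "S / A / 4 \<le> K\<^sup>2 * D" using A by (simp add: field_simps)
    then show ?thesis unfolding I.Gam_def t_def[symmetric] S_def[symmetric] D_def[symmetric] A_def[symmetric] by simp
  qed
  obtain G0 where G0: "\<And>s x. 0 < s \<Longrightarrow> s < a \<Longrightarrow> \<bar>I.Gam s x\<bar> \<le> G0" by (rule I.Gam_bounded, rule that)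
  have C: "(\<integral>x. \<rho> s x * I.Gam s x \<partial>lborel) \<le> K\<^sup>2 * (\<integral>x. \<rho> a x * hnrg f x \<partial>lborel)" if s: "0 < s" "s < a" for s
  proof -
    have t: "a - s > 0" using s by simp
    have Pb: "\<bar>K\<^sup>2 * Pt (a - s) (hnrg f) x\<bar> \<le> K\<^sup>2 * Mk" for x
      unfolding abs_mult using Pt_bounds(1)[OF t qm(2) kM(1), of x] by (simp add: mult_left_mono)
    have "(\<integral>x. \<rho> s x * I.Gam s x \<partial>lborel) \<le> (\<integral>x. \<rho> s x * (K\<^sup>2 * Pt (a - s) (hnrg f) x) \<partial>lborel)"
    proof (rule integral_r_mult_mono[OF s(1) _ G0[OF s] _ Pb Gam[OF s]])
      show "I.Gam s \<in> borel_measurable borel" using I.Gam_cont[OF s] by simp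
      show "(\<lambda>x. K\<^sup>2 * Pt (a - s) (hnrg f) x) \<in> borel_measurable borel"
        using Pt_continuous[OF t qc(2) kM(1)] by (intro continuous_imp_borel continuous_intros)
    qed
    also have "\<dots> = K\<^sup>2 * (\<integral>x. \<rho> s x * Pt (a - s) (hnrg f) x \<partial>lborel)"
      by (simp only: mult.left_commute[of _ "K\<^sup>2"] integral_mult_right_zero)
    finally show ?thesis unfolding inv_k[OF s] .
  qed
  show ?thesis using I.Phi_le(2)[OF C] unfolding inv_q .
qed

text \<open>Let \<epsilon> tend to 0, using continuity of x ln x up to 0. As |f|^2 ln |f|^2 is twice
  |f|^2 ln |f|, the constant K^2 a is halved.\<close>

lemma lsi_test:
  fixes f :: "H3 \<Rightarrow> complex"
  assumes f: "Ck 3 f" "bsupp f" and a: "a > 0"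
  defines "N \<equiv> \<integral>x. \<rho> a x * (cmod (f x))\<^sup>2 \<partial>lborel"
  shows "(\<integral>x. \<rho> a x * ((cmod (f x))\<^sup>2 * ln (cmod (f x))) \<partial>lborel)
     \<le> K\<^sup>2 * a / 2 * (\<integral>x. \<rho> a x * hnrg f x \<partial>lborel) + N * ln (sqrt N)"
proof -
  define q where "q x = (cmod (f x))\<^sup>2" for x
  have qc: "continuous_on UNIV q" unfolding q_def using Ck_continuous[OF f(1)] by (intro continuous_intros)
  have q0: "0 \<le> q x" for x by (simp add: q_def)
  have qs: "bsupp q" unfolding q_def by (rule bsupp_cmod2[OF f(2)])
  obtain M where M: "M > 0" "\<And>x. norm (q x) \<le> M" by (rule bounded_bsupp[OF qc qs], rule that)
  have qM: "q x \<le> M" for x using M(2)[of x] q0[of x] by auto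
  have qm [measurable]: "q \<in> borel_measurable borel" using qc by simp
  have N: "N = (\<integral>x. \<rho> a x * q x \<partial>lborel)" by (simp add: N_def q_def)
  have N0: "N \<ge> 0" unfolding N using q0 r_nonneg[OF a] by (simp add: Bochner_Integration.integral_nonneg)
  let ?t = "\<lambda>x::real. x * ln x"
  have "compact (?t ` {0..M+1})" by (intro compact_continuous_image continuous_on_subset[OF xlnx_cont]) auto
  from compact_imp_bounded[OF this] obtain T where "\<forall>y\<in>?t ` {0..M+1}. norm y \<le> T"
    unfolding bounded_iff by blast
  then have T: "\<bar>?t x\<bar> \<le> T" if "x \<in> {0..M+1}" for x using that by simp
  define e where "e n = 1 / (real n + 1)" for n :: nat
  have e: "e n > 0" "e n \<le> 1" for n by (auto simp: e_def)
  have e0: "e \<longlonglongrightarrow> 0"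
    using LIMSEQ_ignore_initial_segment[OF lim_const_over_n[of "1::real"], of 1] by (simp add: e_def[abs_def] add.commute)
  have lim: "(\<lambda>n. ?t (c + e n)) \<longlonglongrightarrow> ?t c" if c: "c \<ge> 0" for c
  proof (rule continuous_on_tendsto_compose[OF xlnx_cont])
    have "(\<lambda>n. c + e n) \<longlonglongrightarrow> c + 0" by (intro tendsto_intros e0)
    then show "(\<lambda>n. c + e n) \<longlonglongrightarrow> c" by simp
    show "\<forall>\<^sub>F n in sequentially. c + e n \<in> {0..}" using c e(1) by (intro always_eventually allI) (simp add: less_imp_le add_nonneg_nonneg)
  qed (use c in simp)
  have A: "(\<lambda>n. \<integral>x. \<rho> a x * ?t (q x + e n) \<partial>lborel) \<longlonglongrightarrow> (\<integral>x. \<rho> a x * ?t (q x) \<partial>lborel)"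
  proof (rule r_L1_convergence[OF a a tendsto_const])
    show "\<bar>?t (q x + e n)\<bar> \<le> T" for n x using q0[of x] qM[of x] e[of n] by (intro T) auto
  qed (use lim[OF q0] in auto)
  have le: "(\<integral>x. \<rho> a x * ?t (q x + e n) \<partial>lborel) - ?t (N + e n) \<le> K\<^sup>2 * (\<integral>x. \<rho> a x * hnrg f x \<partial>lborel) * a" for n
    using lsi_regularised[OF f a e(1)[of n]] unfolding N q_def .
  have "(\<integral>x. \<rho> a x * ?t (q x) \<partial>lborel) - ?t N \<le> K\<^sup>2 * (\<integral>x. \<rho> a x * hnrg f x \<partial>lborel) * a"
    by (rule LIMSEQ_le_const2[OF tendsto_diff[OF A lim[OF N0]]]) (use le in auto)
  moreover have "?t (q x) = 2 * ((cmod (f x))\<^sup>2 * ln (cmod (f x)))" for x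
    by (cases "f x = 0") (simp_all add: q_def ln_realpow)
  then have "(\<integral>x. \<rho> a x * ?t (q x) \<partial>lborel) = 2 * (\<integral>x. \<rho> a x * ((cmod (f x))\<^sup>2 * ln (cmod (f x))) \<partial>lborel)"
    by (simp add: mult.left_commute[of _ 2])
  moreover have "?t N = 2 * (N * ln (sqrt N))" using N0 by (cases "N = 0") (simp_all add: ln_sqrt)
  ultimately show ?thesis by (simp add: algebra_simps)
qed

end

subsection \<open>Closability of the Dirichlet form\<close>

lemma lvf_diff:
  assumes "Ck (Suc n) f" "Ck (Suc n) g"
  shows "lvf v (\<lambda>x. f x - g x) = (\<lambda>x. lvf v f x - lvf v g x)"
  by (rule lvf_eq_hder[OF hder_diff[OF Ck_lvf(1)[OF assms(1)] Ck_lvf(1)[OF assms(2)]]])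

lemma Ck_diff: "Ck n f \<Longrightarrow> Ck n g \<Longrightarrow> Ck n (\<lambda>x. f x - g x)"
  using Ck_add[of n f "\<lambda>x. - g x"] Ck_linear[OF bounded_linear_minus[OF bounded_linear_ident], of n g] by simp

lemma bsupp_imp: "bsupp f \<Longrightarrow> (\<And>x. f x = 0 \<Longrightarrow> g x = 0) \<Longrightarrow> bsupp g"
  unfolding bsupp_def by blast

lemma bsupp_diff:
  fixes f g :: "H3 \<Rightarrow> complex"
  assumes "bsupp f" "bsupp g" shows "bsupp (\<lambda>x. f x - g x)"
proof -
  have "bsupp (\<lambda>x. - g x)" using assms(2) by (auto simp: bsupp_def)
  from bsupp_add[OF assms(1) this] show ?thesis by simp
qed

text \<open>Young's inequality with weight \<alpha>: a triangle inequality for squares whose main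
  coefficient is close to 1 for small \<alpha>.\<close>

lemma cmod2_split:
  fixes x y :: complex
  assumes "\<alpha> > 0"
  shows "(cmod x)\<^sup>2 \<le> (1 + \<alpha>) * (cmod y)\<^sup>2 + (1 + 1/\<alpha>) * (cmod (x - y))\<^sup>2"
proof -
  let ?b = "cmod y" and ?c = "cmod (x - y)"
  have "cmod x \<le> ?b + ?c" using norm_triangle_ineq[of y "x - y"] by simp
  then have "(cmod x)\<^sup>2 \<le> (?b + ?c)\<^sup>2" by (intro power_mono) auto
  moreover have "0 \<le> (\<alpha> * ?b - ?c)\<^sup>2 / \<alpha>" using assms by simp
  moreover have "(\<alpha> * ?b - ?c)\<^sup>2 / \<alpha> = \<alpha> * ?b\<^sup>2 + ?c\<^sup>2 / \<alpha> - 2 * ?b * ?c"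
    using assms by (simp add: power2_diff power_mult_distrib field_simps power2_eq_square)
  ultimately show ?thesis by (simp add: power2_sum distrib_right)
qed

lemma cmod2_diff: "(cmod (x - y))\<^sup>2 \<le> 2 * (cmod x)\<^sup>2 + 2 * (cmod y)\<^sup>2"
  using cmod2_split[of 1 "x - y" x] by (simp add: norm_minus_commute)

text \<open>Squared seminorms satisfy only the weighted triangle inequality. Convergence still
  follows by fixing a small \<alpha> first and letting the error tend to 0 afterwards.\<close>

lemma quasi_norm_limit:
  fixes N e :: "nat \<Rightarrow> real"
  assumes 1: "\<And>\<alpha> n. \<alpha> > 0 \<Longrightarrow> N n \<le> (1 + \<alpha>) * L + (1 + 1/\<alpha>) * e n"
    and 2: "\<And>\<alpha> n. \<alpha> > 0 \<Longrightarrow> L \<le> (1 + \<alpha>) * N n + (1 + 1/\<alpha>) * e n"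
    and e: "e \<longlonglongrightarrow> 0" and L: "L \<ge> 0"
  shows "N \<longlonglongrightarrow> L"
  unfolding tendsto_iff
proof (intro allI impI)
  fix \<epsilon> :: real assume \<epsilon>: "\<epsilon> > 0"
  \<comment> \<open>Bounds L and eventually also N n: weight \<alpha> = 1 and an error below 1 give
    2 L + 2.\<close>
  define c where "c = 2 * L + 2"
  have c: "c > 0" "L \<le> c" using L by (auto simp: c_def)
  define \<alpha> where "\<alpha> = \<epsilon> / (2 * c)"
  have \<alpha>: "\<alpha> > 0" "\<alpha> * c = \<epsilon> / 2" using \<epsilon> c by (auto simp: \<alpha>_def)
  have "(\<lambda>n. (1 + 1/\<alpha>) * e n) \<longlonglongrightarrow> (1 + 1/\<alpha>) * 0" by (intro tendsto_intros e)
  then have z: "(\<lambda>n. (1 + 1/\<alpha>) * e n) \<longlonglongrightarrow> 0" by simp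
  have "\<forall>\<^sub>F n in sequentially. e n < 1" by (rule order_tendstoD(2)[OF e]) simp
  moreover have "\<forall>\<^sub>F n in sequentially. (1 + 1/\<alpha>) * e n < \<epsilon> / 2" by (rule order_tendstoD(2)[OF z]) (use \<epsilon> in simp)
  ultimately show "\<forall>\<^sub>F n in sequentially. dist (N n) L < \<epsilon>"
  proof eventually_elim
    fix n assume n: "e n < 1" "(1 + 1/\<alpha>) * e n < \<epsilon> / 2"
    have "N n \<le> c" using 1[of 1 n] n by (simp add: c_def)
    then have "\<alpha> * N n \<le> \<alpha> * c" using \<alpha> by (intro mult_left_mono) auto
    moreover have "\<alpha> * L \<le> \<alpha> * c" using \<alpha> c by (intro mult_left_mono) auto
    moreover note \<alpha>(2)
    ultimately show "dist (N n) L < \<epsilon>"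
      using 1[OF \<alpha>(1), of n] 2[OF \<alpha>(1), of n] n unfolding dist_real_def distrib_right by linarith
  qed
qed

lemma quasi_norm_Cauchy:
  fixes E :: "nat \<Rightarrow> real" and e :: "nat \<Rightarrow> nat \<Rightarrow> real"
  assumes 1: "\<And>\<alpha> m n. \<alpha> > 0 \<Longrightarrow> E n \<le> (1 + \<alpha>) * E m + (1 + 1/\<alpha>) * e m n"
    and e: "\<And>\<epsilon>. \<epsilon> > 0 \<Longrightarrow> \<exists>N. \<forall>m\<ge>N. \<forall>n\<ge>N. e m n < \<epsilon>" and E: "\<And>n. E n \<ge> 0"
  shows "convergent E"
  unfolding Cauchy_convergent_iff[symmetric] Cauchy_def
proof (intro allI impI)
  fix \<epsilon> :: real assume \<epsilon>: "\<epsilon> > 0"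
  obtain N1 where N1: "\<And>m n. m \<ge> N1 \<Longrightarrow> n \<ge> N1 \<Longrightarrow> e m n < 1" using e[of 1] by auto
  define C where "C = 2 * E N1 + 2"
  have C0: "C > 0" using E[of N1] by (simp add: C_def)
  have C: "E n \<le> C" if "n \<ge> N1" for n using 1[of 1 n N1] N1[OF order.refl that] by (simp add: C_def)
  define \<alpha> where "\<alpha> = \<epsilon> / (2 * C)"
  have \<alpha>: "\<alpha> > 0" "\<alpha> * C = \<epsilon> / 2" using \<epsilon> C0 by (auto simp: \<alpha>_def)
  have i: "1 + 1/\<alpha> > 0" using \<alpha>(1) by (intro add_pos_pos) auto
  then obtain N2 where N2: "\<And>m n. m \<ge> N2 \<Longrightarrow> n \<ge> N2 \<Longrightarrow> e m n < \<epsilon> / 2 / (1 + 1/\<alpha>)"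
    using e[of "\<epsilon> / 2 / (1 + 1/\<alpha>)"] \<epsilon> by auto
  have "E n - E m < \<epsilon>" if "m \<ge> max N1 N2" "n \<ge> max N1 N2" for m n
  proof -
    have "e m n < \<epsilon> / 2 / (1 + 1/\<alpha>)" using that by (intro N2) auto
    then have "(1 + 1/\<alpha>) * e m n < \<epsilon> / 2" unfolding pos_less_divide_eq[OF i] by (simp only: mult.commute)
    moreover have "\<alpha> * E m \<le> \<alpha> * C" using C[of m] that \<alpha> by (intro mult_left_mono) auto
    moreover note \<alpha>(2)
    ultimately show ?thesis using 1[OF \<alpha>(1), of n m] unfolding distrib_right by linarith
  qed
  then have "dist (E m) (E n) < \<epsilon>" if "m \<ge> max N1 N2" "n \<ge> max N1 N2" for m n
    using that unfolding dist_real_def abs_less_iff by (metis minus_diff_eq)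
  then show "\<exists>M. \<forall>m\<ge>M. \<forall>n\<ge>M. dist (E m) (E n) < \<epsilon>" by blast
qed

lemma Ccinf_Ck: "Ccinf f \<Longrightarrow> Ck n f"
  by (simp add: Ccinf_def smooth_fun_Ck)

lemma Ccinf_bsupp: "Ccinf f \<Longrightarrow> bsupp f"
  by (simp add: Ccinf_def compact_supp_bsupp)

text \<open>A class containing \<open>Ccinf\<close> whose closure under differences follows from the
  algebra of \<open>Ck\<close>.\<close>

definition tfun :: "(H3 \<Rightarrow> complex) \<Rightarrow> bool" where
  "tfun f \<longleftrightarrow> Ck 2 f \<and> bsupp f"

lemma tfun_diff: "tfun f \<Longrightarrow> tfun g \<Longrightarrow> tfun (\<lambda>x. f x - g x)"
  by (simp add: tfun_def Ck_diff bsupp_diff)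

lemma tfun_Ccinf: "Ccinf f \<Longrightarrow> tfun f"
  by (simp add: tfun_def Ccinf_Ck Ccinf_bsupp)

lemma tfun_cont: "tfun f \<Longrightarrow> continuous_on UNIV f"
  by (auto simp: tfun_def intro: Ck_continuous)

lemma tfun_hnrg: assumes "tfun f" shows "continuous_on UNIV (hnrg f)" "bsupp (hnrg f)"
proof -
  have c: "Ck (Suc 1) f" "bsupp f" using assms unfolding tfun_def numeral_2_eq_2 One_nat_def by blast+
  show "continuous_on UNIV (hnrg f)" "bsupp (hnrg f)" using Ck_continuous[OF Ck_hnrg[OF c(1)]] bsupp_hnrg[OF c] by auto
qed

lemma hnrg_nonneg: "0 \<le> hnrg f x" by (auto simp: hnrg_def intro!: sum_nonneg)

lemma hnrg_diff: "tfun f \<Longrightarrow> tfun g \<Longrightarrow> hnrg (\<lambda>x. f x - g x) x = (\<Sum>v\<in>HD. (cmod (lvf v f x - lvf v g x))\<^sup>2)"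
  using lvf_diff[of 1 f g] unfolding hnrg_def tfun_def Suc_1 by simp

context heat
begin

definition En :: "real \<Rightarrow> (H3 \<Rightarrow> complex) \<Rightarrow> real" where
  "En a f = (\<integral>x. \<rho> a x * hnrg f x \<partial>lborel)"

definition NN :: "real \<Rightarrow> (H3 \<Rightarrow> complex) \<Rightarrow> real" where
  "NN a f = (\<integral>x. \<rho> a x * (cmod (f x))\<^sup>2 \<partial>lborel)"

lemma En_integrable: assumes "a > 0" "tfun f" shows "integrable lborel (\<lambda>x. \<rho> a x * hnrg f x)"
  using rho_cont[OF assms(1)] tfun_hnrg[OF assms(2)] by (intro integrable_bsupp continuous_intros bsupp_mult_right)

lemma NN_integrable: assumes "a > 0" "tfun f" shows "integrable lborel (\<lambda>x. \<rho> a x * (cmod (f x))\<^sup>2)"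
  using rho_cont[OF assms(1)] tfun_cont[OF assms(2)] assms(2)
  by (intro integrable_bsupp continuous_intros bsupp_mult_right bsupp_cmod2) (auto simp: tfun_def)

lemma En_nonneg: "a > 0 \<Longrightarrow> 0 \<le> En a f" and NN_nonneg: "a > 0 \<Longrightarrow> 0 \<le> NN a f"
  using r_nonneg[of a] hnrg_nonneg by (simp_all add: En_def NN_def Bochner_Integration.integral_nonneg)

lemma En_mono:
  assumes a: "a > 0" and t: "tfun f" "tfun g" "tfun h" and le: "\<And>x. hnrg f x \<le> c * hnrg g x + d * hnrg h x"
  shows "En a f \<le> c * En a g + d * En a h"
proof -
  note i = En_integrable[OF a t(1)] En_integrable[OF a t(2)] En_integrable[OF a t(3)]
  have "En a f \<le> (\<integral>x. c * (\<rho> a x * hnrg g x) + d * (\<rho> a x * hnrg h x) \<partial>lborel)"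
    unfolding En_def
  proof (rule integral_mono[OF i(1)])
    show "integrable lborel (\<lambda>x. c * (\<rho> a x * hnrg g x) + d * (\<rho> a x * hnrg h x))" using i by simp
    show "\<rho> a x * hnrg f x \<le> c * (\<rho> a x * hnrg g x) + d * (\<rho> a x * hnrg h x)" for x
      using mult_left_mono[OF le[of x] r_nonneg[OF a, of x]] by (simp add: algebra_simps)
  qed
  also have "\<dots> = c * En a g + d * En a h" using i by (simp add: En_def)
  finally show ?thesis .
qed

lemma En_split:
  assumes a: "a > 0" and t: "tfun f" "tfun g" and al: "\<alpha> > 0"
  shows "En a f \<le> (1 + \<alpha>) * En a g + (1 + 1/\<alpha>) * En a (\<lambda>x. f x - g x)"
proof (rule En_mono[OF a t tfun_diff[OF t]])
  show "hnrg f x \<le> (1 + \<alpha>) * hnrg g x + (1 + 1/\<alpha>) * hnrg (\<lambda>x. f x - g x) x" for x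
    unfolding hnrg_diff[OF t] unfolding hnrg_def sum_distrib_left sum.distrib[symmetric]
    by (intro sum_mono cmod2_split al)
qed

lemma En_diff_diff:
  assumes a: "a > 0" and t: "tfun f1" "tfun g1" "tfun f2" "tfun g2"
  shows "En a (\<lambda>x. (f1 x - g1 x) - (f2 x - g2 x)) \<le> 2 * En a (\<lambda>x. f1 x - f2 x) + 2 * En a (\<lambda>x. g1 x - g2 x)"
proof -
  have e: "(\<lambda>x. (f1 x - g1 x) - (f2 x - g2 x)) = (\<lambda>x. (f1 x - f2 x) - (g1 x - g2 x))" by auto
  note d = tfun_diff[OF t(1) t(3)] tfun_diff[OF t(2) t(4)]
  show ?thesis unfolding e
  proof (rule En_mono[OF a tfun_diff[OF d] d])
    show "hnrg (\<lambda>x. (f1 x - f2 x) - (g1 x - g2 x)) x \<le> 2 * hnrg (\<lambda>x. f1 x - f2 x) x + 2 * hnrg (\<lambda>x. g1 x - g2 x) x" for x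
      unfolding hnrg_diff[OF d] unfolding hnrg_def sum_distrib_left sum.distrib[symmetric]
      by (intro sum_mono cmod2_diff)
  qed
qed

lemma Q0_En:
  assumes a: "a > 0" and t: "tfun f"
  shows "Re (Q0 \<rho> a f f) = En a f"
proof -
  have c: "continuous_on UNIV (\<lambda>x. complex_of_real (\<rho> a x * hnrg f x))"
    using rho_cont[OF a] tfun_hnrg[OF t] by (intro continuous_on_of_real continuous_on_mult)
  have m: "(\<lambda>x. complex_of_real (\<rho> a x * hnrg f x)) \<in> borel_measurable lborel"
    using continuous_imp_borel[OF c] by (simp only: measurable_lborel2 measurable_lborel1)
  have "(\<Sum>v\<leftarrow>hdirs. lvf v f x * cnj (lvf v f x)) * complex_of_real (\<rho> a x) = complex_of_real (\<rho> a x * hnrg f x)" for x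
    unfolding sum_list_hdirs hnrg_def by (simp add: complex_norm_square[symmetric] mult.commute)
  then have "Q0 \<rho> a f f = (\<integral>x. complex_of_real (\<rho> a x * hnrg f x) \<partial>lebesgue)" by (simp only: Q0_def)
  also have "\<dots> = (\<integral>x. complex_of_real (\<rho> a x * hnrg f x) \<partial>lborel)" by (rule integral_completion[OF m])
  also have "\<dots> = complex_of_real (En a f)" unfolding En_def by (rule integral_complex_of_real)
  finally show ?thesis by simp
qed

text \<open>Integration by parts moves the derivative from \<open>h\<close> to the fixed field
  \<rho> \<nabla>g. The divergence of this field divided by \<rho> is bounded, since \<rho> is
  positive and continuous and the support compact; Young's inequality then leaves only the L^2 norm
  of \<open>h\<close>.\<close>

lemma cross_energy_bound:
  assumes a: "a > 0" and g: "tfun g"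
  obtains C where "C \<ge> 0" "\<And>h \<beta>. tfun h \<Longrightarrow> \<beta> > 0 \<Longrightarrow>
    (\<integral>x. \<rho> a x * (\<Sum>v\<in>HD. lvf v h x \<bullet> lvf v g x) \<partial>lborel) \<le> NN a h / \<beta> + \<beta> * C"
proof -
  have g2: "Ck (Suc (Suc 0)) g" "bsupp g" using g by (auto simp: tfun_def numeral_2_eq_2)
  have r2: "Ck (Suc 0) (\<rho> a)" by (rule rho_Ck[OF a])
  have gd: "hder v g (lvf v g)" "hder v (lvf v g) (lvf v (lvf v g))" for v
    using Ck_lvf(1)[OF g2(1)] Ck_lvf(1)[OF Ck_lvf(2)[OF g2(1)]] by auto
  have rd: "hder v (\<rho> a) (lvf v (\<rho> a))" for v by (rule Ck_lvf(1)[OF r2])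
  define V where "V v x = \<rho> a x *\<^sub>R lvf v g x" for v x
  define V' where "V' v x = lvf v (\<rho> a) x *\<^sub>R lvf v g x + \<rho> a x *\<^sub>R lvf v (lvf v g) x" for v x
  have V: "hder v (V v) (V' v)" for v
    unfolding V_def V'_def by (rule hder_bilinear[OF bounded_bilinear_scaleR rd gd(2)])
  have Vs: "bsupp (V v)" for v by (rule bsupp_imp[OF bsupp_lvf[OF g2(1) g2(2), of v]]) (simp add: V_def)
  define W where "W x = inverse (\<rho> a x) *\<^sub>R (\<Sum>v\<in>HD. V' v x)" for x
  have Wc: "continuous_on UNIV W" unfolding W_def
    using hder_contD(2)[OF V] rho_cont[OF a] rho_pos[OF a]
    by (intro continuous_intros) (auto simp: less_imp_neq[symmetric])
  have "bsupp (\<lambda>x. \<Sum>v\<in>HD. V' v x)" by (intro bsupp_sum hder_bsupp[OF V Vs]) auto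
  then have Ws: "bsupp W" by (rule bsupp_imp) (simp add: W_def)
  obtain B where B: "B > 0" "\<And>x. norm (W x) \<le> B" by (rule bounded_bsupp[OF Wc Ws], rule that)
  have "(\<integral>x. \<rho> a x * (\<Sum>v\<in>HD. lvf v h x \<bullet> lvf v g x) \<partial>lborel) \<le> NN a h / \<beta> + \<beta> * B\<^sup>2"
    if h: "tfun h" and b: "\<beta> > 0" for h \<beta>
  proof -
    have h2: "Ck (Suc (Suc 0)) h" "bsupp h" using h by (auto simp: tfun_def numeral_2_eq_2)
    have hd: "hder v h (lvf v h)" for v by (rule Ck_lvf(1)[OF h2(1)])
    have hc: "continuous_on UNIV h" by (rule tfun_cont[OF h])
    have i1: "integrable lborel (\<lambda>x. lvf v h x \<bullet> V v x)" and i2: "integrable lborel (\<lambda>x. h x \<bullet> V' v x)" for v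
    proof -
      have "bsupp (\<lambda>x. lvf v h x \<bullet> V v x)" by (rule bsupp_imp[OF Vs[of v]]) simp
      then show "integrable lborel (\<lambda>x. lvf v h x \<bullet> V v x)"
        by (intro integrable_bsupp continuous_on_inner hder_contD(2)[OF hd] hder_contD(1)[OF V])
      have "bsupp (\<lambda>x. h x \<bullet> V' v x)" by (rule bsupp_imp[OF h2(2)]) simp
      then show "integrable lborel (\<lambda>x. h x \<bullet> V' v x)"
        by (intro integrable_bsupp continuous_on_inner hc hder_contD(2)[OF V])
    qed
    have ibp: "(\<integral>x. lvf v h x \<bullet> V v x \<partial>lborel) = - (\<integral>x. h x \<bullet> V' v x \<partial>lborel)" for v
    proof -
      have "bsupp (\<lambda>x. h x \<bullet> V v x)" by (rule bsupp_imp[OF h2(2)]) simp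
      from integral_hder_eq_0[OF hder_bilinear[OF bounded_bilinear_inner hd V] this]
      have "(\<integral>x. lvf v h x \<bullet> V v x + h x \<bullet> V' v x \<partial>lborel) = 0" .
      then show ?thesis using i1 i2 by (simp add: add_eq_0_iff2)
    qed
    have "(\<integral>x. \<rho> a x * (\<Sum>v\<in>HD. lvf v h x \<bullet> lvf v g x) \<partial>lborel) = (\<integral>x. (\<Sum>v\<in>HD. lvf v h x \<bullet> V v x) \<partial>lborel)"
      by (simp add: V_def sum_distrib_left)
    also have "\<dots> = (\<Sum>v\<in>HD. - (\<integral>x. h x \<bullet> V' v x \<partial>lborel))"
      by (simp add: Bochner_Integration.integral_sum[OF i1] ibp)
    also have "\<dots> = - (\<integral>x. (\<Sum>v\<in>HD. h x \<bullet> V' v x) \<partial>lborel)"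
      by (simp add: Bochner_Integration.integral_sum[OF i2] sum_negf)
    also have "(\<lambda>x. \<Sum>v\<in>HD. h x \<bullet> V' v x) = (\<lambda>x. \<rho> a x * (h x \<bullet> W x))"
    proof
      fix x
      have "\<rho> a x \<noteq> 0" using rho_pos[OF a, of x] by simp
      then show "(\<Sum>v\<in>HD. h x \<bullet> V' v x) = \<rho> a x * (h x \<bullet> W x)" by (simp add: W_def inner_sum_right)
    qed
    also have "- (\<integral>x. \<rho> a x * (h x \<bullet> W x) \<partial>lborel) = (\<integral>x. \<rho> a x * - (h x \<bullet> W x) \<partial>lborel)" by simp
    also have "\<dots> \<le> (\<integral>x. (\<rho> a x * (cmod (h x))\<^sup>2) / \<beta> + \<rho> a x * (\<beta> * B\<^sup>2) \<partial>lborel)"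
    proof (rule integral_mono)
      have "bsupp (\<lambda>x. \<rho> a x * - (h x \<bullet> W x))" by (rule bsupp_imp[OF h2(2)]) simp
      then show "integrable lborel (\<lambda>x. \<rho> a x * - (h x \<bullet> W x))"
        using rho_cont[OF a] hc Wc by (intro integrable_bsupp continuous_intros)
      show "integrable lborel (\<lambda>x. (\<rho> a x * (cmod (h x))\<^sup>2) / \<beta> + \<rho> a x * (\<beta> * B\<^sup>2))"
        using NN_integrable[OF a h] r_integrable[OF a] by simp
      fix x
      have "- (h x \<bullet> W x) \<le> cmod (h x) * norm (W x)" using Cauchy_Schwarz_ineq2[of "h x" "W x"] by linarith
      also have "\<dots> \<le> cmod (h x) * B" using B by (intro mult_left_mono) auto
      also have "\<dots> \<le> (cmod (h x))\<^sup>2 / \<beta> + \<beta> * B\<^sup>2"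
      proof -
        have "0 \<le> (cmod (h x) - \<beta> * B)\<^sup>2 / \<beta>" using b by simp
        also have "\<dots> = (cmod (h x))\<^sup>2 / \<beta> + \<beta> * B\<^sup>2 - 2 * (cmod (h x) * B)"
          using b by (simp add: power2_diff power_mult_distrib field_simps power2_eq_square)
        finally have "2 * (cmod (h x) * B) \<le> (cmod (h x))\<^sup>2 / \<beta> + \<beta> * B\<^sup>2" by simp
        moreover have "0 \<le> cmod (h x) * B" using B(1) by simp
        ultimately show ?thesis by linarith
      qed
      finally have "- (h x \<bullet> W x) \<le> (cmod (h x))\<^sup>2 / \<beta> + \<beta> * B\<^sup>2" .
      from mult_left_mono[OF this r_nonneg[OF a, of x]]
      show "\<rho> a x * - (h x \<bullet> W x) \<le> (\<rho> a x * (cmod (h x))\<^sup>2) / \<beta> + \<rho> a x * (\<beta> * B\<^sup>2)" by (simp add: distrib_left)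
    qed
    also have "\<dots> = NN a h / \<beta> + \<beta> * B\<^sup>2"
      using NN_integrable[OF a h] r_integrable[OF a] r_integral[OF a] by (simp add: NN_def)
    finally show ?thesis .
  qed
  then show ?thesis using that[of "B\<^sup>2"] by simp
qed

text \<open>Integration by parts against the fixed element \<open>h m\<close> of the sequence shows that the mixed energy of
  \<open>h n\<close> and \<open>h m\<close> vanishes as \<open>n \<rightarrow> \<infinity>\<close>; the Cauchy property does the rest.\<close>

lemma energy_closable:
  assumes a: "a > 0" and h: "\<And>n. tfun (h n)" and N: "(\<lambda>n. NN a (h n)) \<longlonglongrightarrow> 0"
    and C: "\<And>\<epsilon>. \<epsilon> > 0 \<Longrightarrow> \<exists>N. \<forall>m\<ge>N. \<forall>n\<ge>N. En a (\<lambda>x. h m x - h n x) < \<epsilon>"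
  shows "(\<lambda>n. En a (h n)) \<longlonglongrightarrow> 0"
  unfolding tendsto_iff
proof (intro allI impI)
  fix \<epsilon> :: real assume \<epsilon>: "\<epsilon> > 0"
  obtain m where m: "\<And>k n. k \<ge> m \<Longrightarrow> n \<ge> m \<Longrightarrow> En a (\<lambda>x. h k x - h n x) < \<epsilon> / 4" using C[of "\<epsilon>/4"] \<epsilon> by auto
  obtain B where B: "B \<ge> 0" "\<And>k \<beta>. tfun k \<Longrightarrow> \<beta> > 0 \<Longrightarrow>
    (\<integral>x. \<rho> a x * (\<Sum>v\<in>HD. lvf v k x \<bullet> lvf v (h m) x) \<partial>lborel) \<le> NN a k / \<beta> + \<beta> * B"
    by (rule cross_energy_bound[OF a h[of m]], rule that)
  define c where "c = B + 1"
  have c: "c > 0" "B \<le> c" using B(1) by (auto simp: c_def)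
  \<comment> \<open>Both \<beta> B and, for large n, \<open>NN a (h n) / \<beta>\<close> are at most
    \<epsilon>/8, and \<epsilon>/4 + 2 * (\<epsilon>/8 + \<epsilon>/8) is below \<epsilon>.\<close>
  define \<beta> where "\<beta> = \<epsilon> / (8 * c)"
  have \<beta>: "\<beta> > 0" "\<beta> * c = \<epsilon> / 8" using \<epsilon> c by (auto simp: \<beta>_def)
  have \<beta>B: "\<beta> * B \<le> \<epsilon> / 8" using mult_left_mono[OF c(2), of \<beta>] \<beta> by linarith
  have "\<forall>\<^sub>F n in sequentially. NN a (h n) < \<beta> * (\<epsilon> / 8)" by (rule order_tendstoD(2)[OF N]) (use \<beta> \<epsilon> in simp)
  then show "\<forall>\<^sub>F n in sequentially. dist (En a (h n)) 0 < \<epsilon>"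
    using eventually_ge_at_top[of m]
  proof eventually_elim
    fix n assume n: "NN a (h n) < \<beta> * (\<epsilon> / 8)" "m \<le> n"
    have NNb: "NN a (h n) / \<beta> \<le> \<epsilon> / 8" using n(1) \<beta> by (simp add: field_simps)
    define X where "X = (\<integral>x. \<rho> a x * (\<Sum>v\<in>HD. lvf v (h n) x \<bullet> lvf v (h m) x) \<partial>lborel)"
    have X: "X \<le> \<epsilon> / 8 + \<epsilon> / 8" using B(2)[OF h \<beta>(1), of n] NNb \<beta>B unfolding X_def by linarith
    have ck: "Ck (Suc 1) (h n)" for n using h[of n] by (simp add: tfun_def numeral_2_eq_2)
    have iX: "integrable lborel (\<lambda>x. \<rho> a x * (\<Sum>v\<in>HD. lvf v (h n) x \<bullet> lvf v (h m) x))"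
    proof (rule integrable_bsupp)
      have "continuous_on UNIV (lvf v (h n))" for v n using Ck_continuous[OF Ck_lvf(2)[OF ck]] .
      then show "continuous_on UNIV (\<lambda>x. \<rho> a x * (\<Sum>v\<in>HD. lvf v (h n) x \<bullet> lvf v (h m) x))"
        using rho_cont[OF a] by (intro continuous_intros)
      have "bsupp (\<lambda>x. lvf v (h n) x \<bullet> lvf v (h m) x)" for v
        by (rule bsupp_imp[OF bsupp_lvf[OF ck[of n], of v]]) (use h[of n] in \<open>simp_all add: tfun_def\<close>)
      then show "bsupp (\<lambda>x. \<rho> a x * (\<Sum>v\<in>HD. lvf v (h n) x \<bullet> lvf v (h m) x))"
        by (intro bsupp_mult_right bsupp_sum) auto
    qed
    have "En a (h n) \<le> (\<integral>x. \<rho> a x * hnrg (\<lambda>x. h n x - h m x) x + 2 * (\<rho> a x * (\<Sum>v\<in>HD. lvf v (h n) x \<bullet> lvf v (h m) x)) \<partial>lborel)"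
      unfolding En_def
    proof (rule integral_mono[OF En_integrable[OF a h]])
      show "integrable lborel (\<lambda>x. \<rho> a x * hnrg (\<lambda>x. h n x - h m x) x + 2 * (\<rho> a x * (\<Sum>v\<in>HD. lvf v (h n) x \<bullet> lvf v (h m) x)))"
        using En_integrable[OF a tfun_diff[OF h h]] iX by simp
      fix x
      \<comment> \<open>From |x|^2 = |x - y|^2 + 2 x.y - |y|^2 in each direction, with the last term
        dropped.\<close>
      have "hnrg (h n) x \<le> hnrg (\<lambda>x. h n x - h m x) x + 2 * (\<Sum>v\<in>HD. lvf v (h n) x \<bullet> lvf v (h m) x)"
        unfolding hnrg_diff[OF h h] unfolding hnrg_def sum_distrib_left sum.distrib[symmetric]
      proof (rule sum_mono)
        fix v
        have "(cmod (lvf v (h n) x - lvf v (h m) x))\<^sup>2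
          = (cmod (lvf v (h n) x))\<^sup>2 + (cmod (lvf v (h m) x))\<^sup>2 - 2 * (lvf v (h n) x \<bullet> lvf v (h m) x)"
          unfolding power2_norm_eq_inner by (simp add: inner_diff_left inner_diff_right inner_commute)
        then show "(cmod (lvf v (h n) x))\<^sup>2 \<le> (cmod (lvf v (h n) x - lvf v (h m) x))\<^sup>2 + 2 * (lvf v (h n) x \<bullet> lvf v (h m) x)"
          using zero_le_power2[of "cmod (lvf v (h m) x)"] by linarith
      qed
      from mult_left_mono[OF this r_nonneg[OF a, of x]]
      show "\<rho> a x * hnrg (h n) x \<le> \<rho> a x * hnrg (\<lambda>x. h n x - h m x) x + 2 * (\<rho> a x * (\<Sum>v\<in>HD. lvf v (h n) x \<bullet> lvf v (h m) x))"
        by (simp add: algebra_simps)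
    qed
    also have "\<dots> = En a (\<lambda>x. h n x - h m x) + 2 * X"
      using En_integrable[OF a tfun_diff[OF h h], of n m] iX by (simp add: En_def X_def)
    also have "\<dots> < \<epsilon>" using X m[of n m] n(2) \<epsilon> by linarith
    finally show "dist (En a (h n)) 0 < \<epsilon>" using En_nonneg[OF a, of "h n"] by simp
  qed
qed

end

section \<open>Extension to the domain of the closed form\<close>

lemma sq_ln_cont: "continuous_on {0..} (\<lambda>x::real. x\<^sup>2 * ln x)"
proof -
  have "continuous_on {0..} (\<lambda>x::real. x * (x * ln x))" by (intro continuous_on_mult continuous_on_id xlnx_cont)
  then show ?thesis by (simp add: power2_eq_square mult.assoc)
qed

text \<open>Supplies the constant that makes the entropy integrand nonnegative for Fatou's lemma. By
  ln x \<ge> 1 - 1/x the expression is at least x^2 - x.\<close>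

lemma sq_ln_ge: "x\<^sup>2 * ln x \<ge> -1" if "x \<ge> 0" for x :: real
proof (cases "x = 0")
  case False
  then have x: "x > 0" using that by simp
  have "ln (1 / x) \<le> 1 / x - 1" using x by (intro ln_le_minus_one) auto
  then have "ln x \<ge> 1 - 1 / x" using x by (simp add: ln_div)
  then have "x\<^sup>2 * ln x \<ge> x\<^sup>2 * (1 - 1 / x)" by (intro mult_left_mono) auto
  moreover have "x\<^sup>2 * (1 - 1 / x) = (x - 1/2)\<^sup>2 - 1/4" using x by (simp add: power2_eq_square field_simps)
  moreover have "(x - 1/2)\<^sup>2 \<ge> 0" by simp
  ultimately show ?thesis by linarith
qed simp

lemma tfun_leb: "tfun f \<Longrightarrow> f \<in> borel_measurable lebesgue"
  using continuous_imp_borel[OF tfun_cont[of f]] by (intro measurable_completion) simp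

context heat
begin

lemma rho_leb [measurable]: "a > 0 \<Longrightarrow> \<rho> a \<in> borel_measurable lebesgue"
  using r_measurable[of a] by (intro measurable_completion) simp

lemma L2sq_mono:
  assumes a: "a > 0" and [measurable]: "g \<in> borel_measurable lebesgue" "h \<in> borel_measurable lebesgue"
    and cd: "c \<ge> 0" "d \<ge> 0" and le: "\<And>x. (cmod (f x))\<^sup>2 \<le> c * (cmod (g x))\<^sup>2 + d * (cmod (h x))\<^sup>2"
  shows "L2sq \<rho> a f \<le> ennreal c * L2sq \<rho> a g + ennreal d * L2sq \<rho> a h"
proof -
  note [measurable] = rho_leb[OF a]
  have "L2sq \<rho> a f \<le> (\<integral>\<^sup>+x. ennreal c * ennreal ((cmod (g x))\<^sup>2 * \<rho> a x) + ennreal d * ennreal ((cmod (h x))\<^sup>2 * \<rho> a x) \<partial>lebesgue)"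
    unfolding L2sq_def
  proof (rule nn_integral_mono)
    fix x
    have "(cmod (f x))\<^sup>2 * \<rho> a x \<le> c * ((cmod (g x))\<^sup>2 * \<rho> a x) + d * ((cmod (h x))\<^sup>2 * \<rho> a x)"
      using mult_right_mono[OF le[of x] r_nonneg[OF a, of x]] by (simp add: algebra_simps)
    then have "ennreal ((cmod (f x))\<^sup>2 * \<rho> a x) \<le> ennreal (c * ((cmod (g x))\<^sup>2 * \<rho> a x) + d * ((cmod (h x))\<^sup>2 * \<rho> a x))"
      by (rule ennreal_leI)
    then show "ennreal ((cmod (f x))\<^sup>2 * \<rho> a x) \<le> ennreal c * ennreal ((cmod (g x))\<^sup>2 * \<rho> a x) + ennreal d * ennreal ((cmod (h x))\<^sup>2 * \<rho> a x)"
      using cd r_nonneg[OF a, of x] by (simp add: ennreal_plus ennreal_mult)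
  qed
  also have "\<dots> = ennreal c * L2sq \<rho> a g + ennreal d * L2sq \<rho> a h"
    unfolding L2sq_def by (subst nn_integral_add) (auto simp: nn_integral_cmult)
  finally show ?thesis .
qed

lemma L2sq_tfun:
  assumes a: "a > 0" and f: "tfun f"
  shows "L2sq \<rho> a f = ennreal (NN a f)"
proof -
  have "L2sq \<rho> a f = (\<integral>\<^sup>+x. ennreal (\<rho> a x * (cmod (f x))\<^sup>2) \<partial>lborel)"
    by (simp add: L2sq_def nn_integral_completion mult.commute)
  also have "\<dots> = ennreal (NN a f)" unfolding NN_def using r_nonneg[OF a] NN_integrable[OF a f]
    by (intro nn_integral_eq_integral) auto
  finally show ?thesis .
qed

lemma Q_approx_tfun: "Q_approx \<rho> a f fs \<Longrightarrow> tfun (fs n)"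
  by (auto simp: Q_approx_def intro: tfun_Ccinf)

lemma Q_approx_Cauchy:
  assumes a: "a > 0" and q: "Q_approx \<rho> a f fs" and \<epsilon>: "\<epsilon> > 0"
  shows "\<exists>N. \<forall>m\<ge>N. \<forall>n\<ge>N. En a (\<lambda>x. fs m x - fs n x) < \<epsilon>"
proof -
  note t = Q_approx_tfun[OF q]
  have "\<exists>N. \<forall>m\<ge>N. \<forall>n\<ge>N. Re (Q0 \<rho> a (\<lambda>x. fs m x - fs n x) (\<lambda>x. fs m x - fs n x)) < \<epsilon>"
    using q \<epsilon> unfolding Q_approx_def by blast
  then show ?thesis unfolding Q0_En[OF a tfun_diff[OF t t]] .
qed

lemma Q_approx_energy_limit:
  assumes a: "a > 0" and q: "Q_approx \<rho> a f fs"
  obtains l where "(\<lambda>n. En a (fs n)) \<longlonglongrightarrow> l" "l \<ge> 0"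
proof -
  note t = Q_approx_tfun[OF q]
  have "convergent (\<lambda>n. En a (fs n))"
  proof (rule quasi_norm_Cauchy[where e="\<lambda>m n. En a (\<lambda>x. fs n x - fs m x)"])
    show "En a (fs n) \<le> (1 + \<alpha>) * En a (fs m) + (1 + 1/\<alpha>) * En a (\<lambda>x. fs n x - fs m x)" if "\<alpha> > 0" for \<alpha> m n
      by (rule En_split[OF a t t that])
    show "\<exists>N. \<forall>m\<ge>N. \<forall>n\<ge>N. En a (\<lambda>x. fs n x - fs m x) < \<epsilon>" if "\<epsilon> > 0" for \<epsilon>
      using Q_approx_Cauchy[OF a q that] by blast
    show "0 \<le> En a (fs n)" for n by (rule En_nonneg[OF a])
  qed
  then obtain l where l: "(\<lambda>n. En a (fs n)) \<longlonglongrightarrow> l" by (auto simp: convergent_def)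
  have "l \<ge> 0" by (rule LIMSEQ_le_const[OF l]) (use En_nonneg[OF a] in auto)
  with l show ?thesis by (rule that)
qed

text \<open>The difference of two approximating sequences tends to 0 in L^2 and is Cauchy in energy,
  so closability makes its energy vanish; the weighted triangle inequality with \<alpha> tending to
  0 compares the two limits.\<close>

lemma Q_approx_unique_le:
  assumes a: "a > 0" and f: "f \<in> borel_measurable lebesgue" and q: "Q_approx \<rho> a f fs" "Q_approx \<rho> a f gs"
    and l: "(\<lambda>n. En a (fs n)) \<longlonglongrightarrow> l" "(\<lambda>n. En a (gs n)) \<longlonglongrightarrow> l'"
  shows "l \<le> l'"
proof -
  note t = Q_approx_tfun[OF q(1)] Q_approx_tfun[OF q(2)]
  define h where "h n x = fs n x - gs n x" for n x
  have h: "tfun (h n)" for n unfolding h_def by (rule tfun_diff[OF t])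
  have "(\<lambda>n. L2sq \<rho> a (\<lambda>x. fs n x - f x)) \<longlonglongrightarrow> 0" "(\<lambda>n. L2sq \<rho> a (\<lambda>x. gs n x - f x)) \<longlonglongrightarrow> 0"
    using q by (auto simp: Q_approx_def)
  then have z: "(\<lambda>n. 2 * L2sq \<rho> a (\<lambda>x. fs n x - f x) + 2 * L2sq \<rho> a (\<lambda>x. gs n x - f x)) \<longlonglongrightarrow> 2 * 0 + 2 * 0"
    by (intro tendsto_add ennreal_tendsto_cmult) auto
  have "L2sq \<rho> a (h n) \<le> 2 * L2sq \<rho> a (\<lambda>x. fs n x - f x) + 2 * L2sq \<rho> a (\<lambda>x. gs n x - f x)" for n
  proof -
    note [measurable] = f tfun_leb[OF t(1)] tfun_leb[OF t(2)]
    have "L2sq \<rho> a (h n) \<le> ennreal 2 * L2sq \<rho> a (\<lambda>x. fs n x - f x) + ennreal 2 * L2sq \<rho> a (\<lambda>x. gs n x - f x)"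
    proof (rule L2sq_mono[OF a])
      show "(cmod (h n x))\<^sup>2 \<le> 2 * (cmod (fs n x - f x))\<^sup>2 + 2 * (cmod (gs n x - f x))\<^sup>2" for x
        using cmod2_diff[of "fs n x - f x" "gs n x - f x"] by (simp add: h_def)
    qed auto
    then show ?thesis by simp
  qed
  then have "(\<lambda>n. L2sq \<rho> a (h n)) \<longlonglongrightarrow> 0"
    by (intro tendsto_sandwich[OF _ _ tendsto_const z[simplified]]) auto
  then have N0: "(\<lambda>n. NN a (h n)) \<longlonglongrightarrow> 0"
    unfolding L2sq_tfun[OF a h] using NN_nonneg[OF a] by (simp add: ennreal_tendsto_0_iff)
  have C: "\<exists>N. \<forall>m\<ge>N. \<forall>n\<ge>N. En a (\<lambda>x. h m x - h n x) < \<epsilon>" if \<epsilon>: "\<epsilon> > 0" for \<epsilon>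
  proof -
    obtain A where A: "\<And>m n. m \<ge> A \<Longrightarrow> n \<ge> A \<Longrightarrow> En a (\<lambda>x. fs m x - fs n x) < \<epsilon> / 4" using Q_approx_Cauchy[OF a q(1), of "\<epsilon>/4"] \<epsilon> by auto
    obtain B where B: "\<And>m n. m \<ge> B \<Longrightarrow> n \<ge> B \<Longrightarrow> En a (\<lambda>x. gs m x - gs n x) < \<epsilon> / 4" using Q_approx_Cauchy[OF a q(2), of "\<epsilon>/4"] \<epsilon> by auto
    have "En a (\<lambda>x. h m x - h n x) < \<epsilon>" if "m \<ge> max A B" "n \<ge> max A B" for m n
    proof -
      have "En a (\<lambda>x. h m x - h n x) \<le> 2 * En a (\<lambda>x. fs m x - fs n x) + 2 * En a (\<lambda>x. gs m x - gs n x)"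
        unfolding h_def by (rule En_diff_diff[OF a t(1) t(2) t(1) t(2)])
      also have "\<dots> < \<epsilon>" using A[of m n] B[of m n] that by simp
      finally show ?thesis .
    qed
    then show ?thesis by blast
  qed
  have E0: "(\<lambda>n. En a (h n)) \<longlonglongrightarrow> 0" by (rule energy_closable[OF a h N0 C])
  have al: "l \<le> (1 + \<alpha>) * l'" if al: "\<alpha> > 0" for \<alpha>
  proof -
    have "(\<lambda>n. (1 + \<alpha>) * En a (gs n) + (1 + 1/\<alpha>) * En a (h n)) \<longlonglongrightarrow> (1 + \<alpha>) * l' + (1 + 1/\<alpha>) * 0"
      by (intro tendsto_intros l E0)
    then have r: "(\<lambda>n. (1 + \<alpha>) * En a (gs n) + (1 + 1/\<alpha>) * En a (h n)) \<longlonglongrightarrow> (1 + \<alpha>) * l'" by simp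
    show ?thesis
    proof (rule LIMSEQ_le[OF l(1) r], intro exI allI impI)
      fix n :: nat
      show "En a (fs n) \<le> (1 + \<alpha>) * En a (gs n) + (1 + 1/\<alpha>) * En a (h n)"
        unfolding h_def by (rule En_split[OF a t al])
    qed
  qed
  have l'0: "l' \<ge> 0" by (rule LIMSEQ_le_const[OF l(2)]) (use En_nonneg[OF a] in auto)
  show ?thesis
  proof (rule field_le_epsilon)
    fix e :: real assume e: "e > 0"
    \<comment> \<open>The weight e/(l' + 1) keeps the surplus below e, also when l' = 0.\<close>
    have "l \<le> (1 + e / (l' + 1)) * l'" using e l'0 by (intro al) auto
    also have "\<dots> = l' + e * (l' / (l' + 1))" by (simp add: algebra_simps)
    also have "\<dots> \<le> l' + e" using e l'0 by (intro add_left_mono mult_left_le) auto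
    finally show "l \<le> l' + e" .
  qed
qed

text \<open>Uniqueness of the energy limit is what gives the definite description in
  \<open>Qform\<close> a value.\<close>

lemma Qform_eq:
  assumes a: "a > 0" and f: "Q_dom \<rho> a f" and q: "Q_approx \<rho> a f fs" and l: "(\<lambda>n. En a (fs n)) \<longlonglongrightarrow> l"
  shows "Qform \<rho> a f = ennreal l"
proof -
  have m: "f \<in> borel_measurable lebesgue" using f by (simp add: Q_dom_def)
  have "(THE q. \<exists>fs. Q_approx \<rho> a f fs \<and> (\<lambda>n. Re (Q0 \<rho> a (fs n) (fs n))) \<longlonglongrightarrow> q) = l"
  proof (rule the_equality)
    show "\<exists>fs. Q_approx \<rho> a f fs \<and> (\<lambda>n. Re (Q0 \<rho> a (fs n) (fs n))) \<longlonglongrightarrow> l"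
      using q l Q0_En[OF a Q_approx_tfun[OF q]] by auto
    fix l' assume "\<exists>fs. Q_approx \<rho> a f fs \<and> (\<lambda>n. Re (Q0 \<rho> a (fs n) (fs n))) \<longlonglongrightarrow> l'"
    then obtain gs where gs: "Q_approx \<rho> a f gs" "(\<lambda>n. Re (Q0 \<rho> a (gs n) (gs n))) \<longlonglongrightarrow> l'" by blast
    then have l': "(\<lambda>n. En a (gs n)) \<longlonglongrightarrow> l'" using Q0_En[OF a Q_approx_tfun[OF gs(1)]] by simp
    show "l' = l" using Q_approx_unique_le[OF a m gs(1) q l' l] Q_approx_unique_le[OF a m q gs(1) l l'] by simp
  qed
  then show ?thesis using f by (simp add: Qform_def)
qed

end

context heat_gradient
begin

text \<open>Fatou's lemma along a subsequence converging almost everywhere. The entropy is raised by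
  1 to make the integrand nonnegative, which adds exactly 1 to both sides because \<rho> has mass
  one; finiteness of the raised integral also yields integrability.\<close>

lemma lsi:
  assumes a: "a > 0" and Q: "Qform \<rho> a f < \<infinity>"
  shows "integrable lebesgue (\<lambda>x. (cmod (f x))\<^sup>2 * ln (cmod (f x)) * \<rho> a x)"
    and "(\<integral>x. (cmod (f x))\<^sup>2 * ln (cmod (f x)) * \<rho> a x \<partial>lebesgue)
      \<le> K\<^sup>2 * a / 2 * enn2real (Qform \<rho> a f) + (L2norm \<rho> a f)\<^sup>2 * ln (L2norm \<rho> a f)"
proof -
  have dom: "Q_dom \<rho> a f" using Q by (auto simp: Qform_def split: if_splits)
  have fm [measurable]: "f \<in> borel_measurable lebesgue" and L2: "L2sq \<rho> a f < \<infinity>" using dom by (auto simp: Q_dom_def)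
  obtain fs where fs: "Q_approx \<rho> a f fs" using dom by (auto simp: Q_dom_def)
  note t = Q_approx_tfun[OF fs]
  note [measurable] = rho_leb[OF a] tfun_leb[OF t]
  obtain l where l: "(\<lambda>n. En a (fs n)) \<longlonglongrightarrow> l" "l \<ge> 0" by (rule Q_approx_energy_limit[OF a fs], rule that)
  have Qf: "enn2real (Qform \<rho> a f) = l" using Qform_eq[OF a dom fs l(1)] l(2) by simp
  define N where "N = enn2real (L2sq \<rho> a f)"
  have N0: "N \<ge> 0" by (simp add: N_def)
  have LN: "L2sq \<rho> a f = ennreal N" using L2 by (simp add: N_def)
  have nrm: "L2norm \<rho> a f = sqrt N" by (simp add: L2norm_def N_def)
  define e where "e n = enn2real (L2sq \<rho> a (\<lambda>x. fs n x - f x))" for n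
  have efin: "L2sq \<rho> a (\<lambda>x. fs n x - f x) < \<infinity>" for n
  proof -
    have "L2sq \<rho> a (\<lambda>x. fs n x - f x) \<le> ennreal 2 * L2sq \<rho> a (fs n) + ennreal 2 * L2sq \<rho> a f"
      by (rule L2sq_mono[OF a]) (auto intro: cmod2_diff)
    also have "\<dots> < \<infinity>" unfolding LN L2sq_tfun[OF a t] by (simp add: ennreal_mult_less_top)
    finally show ?thesis .
  qed
  have Le: "L2sq \<rho> a (\<lambda>x. fs n x - f x) = ennreal (e n)" for n using efin[of n] by (simp add: e_def)
  have e0: "0 \<le> e n" for n by (simp add: e_def)
  have "(\<lambda>n. L2sq \<rho> a (\<lambda>x. fs n x - f x)) \<longlonglongrightarrow> 0" using fs by (simp add: Q_approx_def)
  then have elim: "e \<longlonglongrightarrow> 0" unfolding Le using e0 by (simp add: ennreal_tendsto_0_iff)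
  have NNlim: "(\<lambda>n. NN a (fs n)) \<longlonglongrightarrow> N"
  proof (rule quasi_norm_limit[OF _ _ elim N0])
    fix \<alpha> :: real and n assume al: "\<alpha> > 0"
    have al': "1 + 1/\<alpha> \<ge> 0" "1 + \<alpha> \<ge> 0" using al by (auto intro: add_nonneg_nonneg)
    have "L2sq \<rho> a (fs n) \<le> ennreal (1 + \<alpha>) * L2sq \<rho> a f + ennreal (1 + 1/\<alpha>) * L2sq \<rho> a (\<lambda>x. fs n x - f x)"
      by (rule L2sq_mono[OF a]) (use al' cmod2_split[OF al] in auto)
    then have "ennreal (NN a (fs n)) \<le> ennreal ((1 + \<alpha>) * N + (1 + 1/\<alpha>) * e n)"
      unfolding LN Le L2sq_tfun[OF a t] using al' N0 e0[of n] by (simp add: ennreal_mult ennreal_plus)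
    then show "NN a (fs n) \<le> (1 + \<alpha>) * N + (1 + 1/\<alpha>) * e n"
      using al' N0 e0[of n] by (subst (asm) ennreal_le_iff) (auto intro!: add_nonneg_nonneg mult_nonneg_nonneg)
    have "L2sq \<rho> a f \<le> ennreal (1 + \<alpha>) * L2sq \<rho> a (fs n) + ennreal (1 + 1/\<alpha>) * L2sq \<rho> a (\<lambda>x. fs n x - f x)"
      by (rule L2sq_mono[OF a]) (use al' cmod2_split[OF al] in \<open>auto simp: norm_minus_commute\<close>)
    then have "ennreal N \<le> ennreal ((1 + \<alpha>) * NN a (fs n) + (1 + 1/\<alpha>) * e n)"
      unfolding LN Le L2sq_tfun[OF a t] using al' NN_nonneg[OF a] e0[of n] by (simp add: ennreal_mult ennreal_plus)
    then show "N \<le> (1 + \<alpha>) * NN a (fs n) + (1 + 1/\<alpha>) * e n"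
      using al' NN_nonneg[OF a] e0[of n] by (subst (asm) ennreal_le_iff) (auto intro!: add_nonneg_nonneg mult_nonneg_nonneg)
  qed
  define u where "u n x = (cmod (fs n x - f x))\<^sup>2 * \<rho> a x" for n x
  have u0: "0 \<le> u n x" for n x using r_nonneg[OF a, of x] by (simp add: u_def)
  have um [measurable]: "u n \<in> borel_measurable lebesgue" for n unfolding u_def by measurable
  have ui: "integrable lebesgue (u n)" for n
    by (rule integrableI_nonneg) (use u0 efin[of n] in \<open>auto simp: L2sq_def u_def\<close>)
  have "(\<integral>x. norm (u n x) \<partial>lebesgue) = e n" for n
  proof -
    have "ennreal (\<integral>x. u n x \<partial>lebesgue) = ennreal (e n)"
      using nn_integral_eq_integral[OF ui[of n]] u0 Le[of n] unfolding L2sq_def u_def[symmetric] by simp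
    then have "(\<integral>x. u n x \<partial>lebesgue) = e n" using e0 u0 by (subst (asm) ennreal_inj) (auto intro!: Bochner_Integration.integral_nonneg)
    then show ?thesis using u0 by simp
  qed
  then have "(\<lambda>n. \<integral>x. norm (u n x) \<partial>lebesgue) \<longlonglongrightarrow> 0" using elim by simp
  from tendsto_L1_AE_subseq[OF ui this] obtain k where k: "strict_mono k" "AE x in lebesgue. (\<lambda>n. u (k n) x) \<longlonglongrightarrow> 0" by auto
  define \<psi> where "\<psi> v = v\<^sup>2 * ln v" for v :: real
  have \<psi>1: "\<psi> v + 1 \<ge> 0" if "v \<ge> 0" for v using sq_ln_ge[OF that] by (simp add: \<psi>_def)
  have \<psi>m [measurable]: "\<psi> \<in> borel_measurable borel" unfolding \<psi>_def by measurable
  define \<Psi> where "\<Psi> g x = (\<psi> (cmod (g x)) + 1) * \<rho> a x" for g :: "H3 \<Rightarrow> complex" and x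
  have \<Psi>0: "0 \<le> \<Psi> g x" for g x using \<psi>1[of "cmod (g x)"] r_nonneg[OF a, of x] by (simp add: \<Psi>_def)
  have \<Psi>lim: "AE x in lebesgue. (\<lambda>n. \<Psi> (fs (k n)) x) \<longlonglongrightarrow> \<Psi> f x"
    using k(2)
  proof eventually_elim
    fix x assume x: "(\<lambda>n. u (k n) x) \<longlonglongrightarrow> 0"
    have r: "\<rho> a x > 0" by (rule rho_pos[OF a])
    have "(\<lambda>n. sqrt (u (k n) x / \<rho> a x)) \<longlonglongrightarrow> sqrt (0 / \<rho> a x)" using r by (intro tendsto_intros x) auto
    then have "(\<lambda>n. norm (fs (k n) x - f x)) \<longlonglongrightarrow> 0" using r by (simp add: u_def)
    then have "(\<lambda>n. fs (k n) x) \<longlonglongrightarrow> f x" by (metis LIM_zero_cancel tendsto_norm_zero_iff)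
    then have c: "(\<lambda>n. cmod (fs (k n) x)) \<longlonglongrightarrow> cmod (f x)" by (rule tendsto_norm)
    have "(\<lambda>n. \<psi> (cmod (fs (k n) x))) \<longlonglongrightarrow> \<psi> (cmod (f x))" unfolding \<psi>_def
      by (rule continuous_on_tendsto_compose[OF sq_ln_cont c]) auto
    then show "(\<lambda>n. \<Psi> (fs (k n)) x) \<longlonglongrightarrow> \<Psi> f x" unfolding \<Psi>_def by (intro tendsto_intros)
  qed
  define R where "R n = K\<^sup>2 * a / 2 * En a (fs n) + NN a (fs n) * ln (sqrt (NN a (fs n))) + 1" for n
  define R0 where "R0 = K\<^sup>2 * a / 2 * l + N * ln (sqrt N)"
  \<comment> \<open>N may be 0, so the limit uses continuity of x ln x on the closed half-line and
    not that of the logarithm.\<close>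
  have Rlim: "R \<longlonglongrightarrow> R0 + 1"
  proof -
    have "(\<lambda>n. NN a (fs n) * ln (NN a (fs n))) \<longlonglongrightarrow> N * ln N"
      by (rule continuous_on_tendsto_compose[OF xlnx_cont NNlim]) (use N0 NN_nonneg[OF a] in auto)
    then have "(\<lambda>n. NN a (fs n) * ln (NN a (fs n)) / 2) \<longlonglongrightarrow> N * ln N / 2"
      by (rule tendsto_divide[OF _ tendsto_const]) simp
    then have A: "(\<lambda>n. NN a (fs n) * ln (sqrt (NN a (fs n)))) \<longlonglongrightarrow> N * ln (sqrt N)"
      using N0 NN_nonneg[OF a] by (simp add: ln_sqrt)
    show ?thesis unfolding R_def R0_def
      by (rule tendsto_add[OF tendsto_add[OF tendsto_mult[OF tendsto_const l(1)] A] tendsto_const])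
  qed
  have \<Psi>n: "(\<integral>\<^sup>+x. ennreal (\<Psi> (fs n) x) \<partial>lebesgue) \<le> ennreal (R n)" "0 \<le> R n" for n
  proof -
    have c3: "Ck 3 (fs n)" "bsupp (fs n)" using fs by (auto simp: Q_approx_def Ccinf_Ck Ccinf_bsupp)
    define j where "j x = \<psi> (cmod (fs n x))" for x
    have jc: "continuous_on UNIV j" unfolding j_def \<psi>_def
      by (rule continuous_on_compose2[OF sq_ln_cont]) (use Ck_continuous[OF c3(1)] in \<open>auto intro!: continuous_intros\<close>)
    have js: "bsupp j" by (rule bsupp_imp[OF c3(2)]) (simp add: j_def \<psi>_def)
    have ij: "integrable lborel (\<lambda>x. \<rho> a x * j x)" by (intro integrable_bsupp continuous_on_mult rho_cont[OF a] jc bsupp_mult_right js)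
    have eq: "\<Psi> (fs n) x = \<rho> a x * j x + \<rho> a x" for x by (simp add: \<Psi>_def j_def algebra_simps)
    have i: "integrable lborel (\<Psi> (fs n))" unfolding eq[abs_def] using ij r_integrable[OF a] by simp
    have "(\<integral>x. \<Psi> (fs n) x \<partial>lborel) = (\<integral>x. \<rho> a x * j x \<partial>lborel) + 1"
      unfolding eq using ij r_integrable[OF a] r_integral[OF a] by simp
    also have "\<dots> \<le> R n"
      using lsi_test[OF c3 a] unfolding R_def En_def NN_def j_def \<psi>_def by simp
    finally have le: "(\<integral>x. \<Psi> (fs n) x \<partial>lborel) \<le> R n" .
    have "(\<integral>\<^sup>+x. ennreal (\<Psi> (fs n) x) \<partial>lebesgue) = ennreal (\<integral>x. \<Psi> (fs n) x \<partial>lborel)"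
      unfolding nn_integral_completion using i \<Psi>0 by (intro nn_integral_eq_integral) auto
    then show "(\<integral>\<^sup>+x. ennreal (\<Psi> (fs n) x) \<partial>lebesgue) \<le> ennreal (R n)" using le by (simp add: ennreal_leI)
    show "0 \<le> R n" using le Bochner_Integration.integral_nonneg[of lborel "\<Psi> (fs n)"] \<Psi>0 by (meson order.trans)
  qed
  have R0: "R0 + 1 \<ge> 0" by (rule LIMSEQ_le_const[OF Rlim]) (use \<Psi>n(2) in auto)
  have \<Psi>fm [measurable]: "\<Psi> f \<in> borel_measurable lebesgue" unfolding \<Psi>_def by measurable
  have \<Psi>nm [measurable]: "\<Psi> (fs n) \<in> borel_measurable lebesgue" for n unfolding \<Psi>_def by measurable
  have "(\<integral>\<^sup>+x. ennreal (\<Psi> f x) \<partial>lebesgue) = (\<integral>\<^sup>+x. liminf (\<lambda>n. ennreal (\<Psi> (fs (k n)) x)) \<partial>lebesgue)"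
  proof (rule nn_integral_cong_AE)
    show "AE x in lebesgue. ennreal (\<Psi> f x) = liminf (\<lambda>n. ennreal (\<Psi> (fs (k n)) x))"
      using \<Psi>lim
    proof eventually_elim
      fix x assume "(\<lambda>n. \<Psi> (fs (k n)) x) \<longlonglongrightarrow> \<Psi> f x"
      then have "(\<lambda>n. ennreal (\<Psi> (fs (k n)) x)) \<longlonglongrightarrow> ennreal (\<Psi> f x)" by (rule tendsto_ennrealI)
      then show "ennreal (\<Psi> f x) = liminf (\<lambda>n. ennreal (\<Psi> (fs (k n)) x))"
        by (intro lim_imp_Liminf[symmetric]) auto
    qed
  qed
  also have "\<dots> \<le> liminf (\<lambda>n. \<integral>\<^sup>+x. ennreal (\<Psi> (fs (k n)) x) \<partial>lebesgue)"
    by (rule nn_integral_liminf) measurable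
  also have "\<dots> \<le> liminf (\<lambda>n. ennreal (R (k n)))"
    by (rule Liminf_mono) (use \<Psi>n(1) in \<open>auto intro!: always_eventually\<close>)
  also have "\<dots> = ennreal (R0 + 1)"
    by (rule lim_imp_Liminf) (auto intro!: tendsto_ennrealI LIMSEQ_subseq_LIMSEQ[OF Rlim k(1), unfolded o_def])
  finally have fin: "(\<integral>\<^sup>+x. ennreal (\<Psi> f x) \<partial>lebesgue) \<le> ennreal (R0 + 1)" .
  have i\<Psi>: "integrable lebesgue (\<Psi> f)"
    by (rule integrableI_nonneg) (use \<Psi>0 fin in \<open>auto intro: le_less_trans\<close>)
  have "ennreal (\<integral>x. \<Psi> f x \<partial>lebesgue) \<le> ennreal (R0 + 1)"
    using fin nn_integral_eq_integral[OF i\<Psi>] \<Psi>0 by simp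
  then have le: "(\<integral>x. \<Psi> f x \<partial>lebesgue) \<le> R0 + 1" using R0 by (simp add: ennreal_le_iff)
  have ir: "integrable lebesgue (\<rho> a)" "(\<integral>x. \<rho> a x \<partial>lebesgue) = 1"
    using integrable_completion[of "\<rho> a" lborel] integral_completion[of "\<rho> a" lborel] r_measurable[OF a] r_integrable[OF a] r_integral[OF a] by auto
  have eq: "(\<lambda>x. (cmod (f x))\<^sup>2 * ln (cmod (f x)) * \<rho> a x) = (\<lambda>x. \<Psi> f x - \<rho> a x)"
    by (rule ext) (simp add: \<Psi>_def \<psi>_def algebra_simps)
  show "integrable lebesgue (\<lambda>x. (cmod (f x))\<^sup>2 * ln (cmod (f x)) * \<rho> a x)"
    unfolding eq by (rule Bochner_Integration.integrable_diff[OF i\<Psi> ir(1)])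
  have "(\<integral>x. (cmod (f x))\<^sup>2 * ln (cmod (f x)) * \<rho> a x \<partial>lebesgue) = (\<integral>x. \<Psi> f x \<partial>lebesgue) - 1"
    unfolding eq using Bochner_Integration.integral_diff[OF i\<Psi> ir(1)] ir(2) by simp
  also have "\<dots> \<le> R0" using le by simp
  finally show "(\<integral>x. (cmod (f x))\<^sup>2 * ln (cmod (f x)) * \<rho> a x \<partial>lebesgue)
      \<le> K\<^sup>2 * a / 2 * enn2real (Qform \<rho> a f) + (L2norm \<rho> a f)\<^sup>2 * ln (L2norm \<rho> a f)"
    using N0 by (simp add: R0_def Qf nrm)
qed

end

theorem theorem8p4:
  fixes \<rho> :: "real \<Rightarrow> H3 \<Rightarrow> real" and K a :: real and f :: "H3 \<Rightarrow> complex"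
  assumes "heat_kernel \<rho>"
    and "\<forall>t\<ge>0. \<forall>g::H3 \<Rightarrow> complex. C1c g \<longrightarrow>
           (\<forall>x. gradnorm (heatsg \<rho> t g) x \<le> K * heatsg \<rho> t (gradnorm g) x)"
    and "a > 0"
    and "Qform \<rho> a f < \<infinity>"
  shows "integrable lebesgue (\<lambda>x. (cmod (f x))\<^sup>2 * ln (cmod (f x)) * \<rho> a x) \<and>
         (\<integral>x. (cmod (f x))\<^sup>2 * ln (cmod (f x)) * \<rho> a x \<partial>lebesgue)
           \<le> (2 * K\<^sup>2 * a) * enn2real (Qform \<rho> a f) + 0 * (L2norm \<rho> a f)\<^sup>2
              + (L2norm \<rho> a f)\<^sup>2 * ln (L2norm \<rho> a f)"
proof -
  interpret heat_gradient \<rho> K by unfold_locales (fact assms)+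
  \<comment> \<open>The stated constant is four times the one obtained, and the energy is
    nonnegative.\<close>
  have "K\<^sup>2 * a / 2 * enn2real (Qform \<rho> a f) \<le> (2 * K\<^sup>2 * a) * enn2real (Qform \<rho> a f)"
    using assms(3) by (intro mult_right_mono) auto
  then have "(\<integral>x. (cmod (f x))\<^sup>2 * ln (cmod (f x)) * \<rho> a x \<partial>lebesgue)
      \<le> (2 * K\<^sup>2 * a) * enn2real (Qform \<rho> a f) + (L2norm \<rho> a f)\<^sup>2 * ln (L2norm \<rho> a f)"
    using lsi(2)[OF assms(3,4)] by linarith
  with lsi(1)[OF assms(3,4)] show ?thesis by simp
qed

end
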